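(* Let $\mathbf{R}$ be a discrete valuation ring with maximal ideal $\pi\mathbf{R}$ and residue field $\mathbf{k}$, let $k\ge 1$ be an integer, and put $\mathbf{R}_j=\mathbf{R}/\pi^j\mathbf{R}$ for $j \geq 1$. Let $\mathfrak{L}$ be a Lie algebra over $\mathbf{R}_k$ and let $\bar{\mathfrak{L}}=\mathfrak{L}\otimes_{\mathbf{R}}\mathbf{k}$ be its reduction to a Lie algebra over $\mathbf{k}$. Suppose that $\mathfrak{L}$ has a Lie algebra lift to an $\mathbf{R}_{k+1}$-Lie algebra. Then the set of all $\mathbf{R}_{k+1}$-Lie algebra lifts of $\mathfrak{L}$, up to isomorphism of Lie algebras inducing the identity on $\mathfrak{L}$, is in one-to-one correspondence with $H^2(\bar{\mathfrak{L}},ad)$.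
   Context: A Lie algebra over $\mathbf{R}_j$ ($j\ge1$) is a free $\mathbf{R}_j$-module of finite rank with an $\mathbf{R}_j$-bilinear bracket that is alternating ($[v,v]=0$ for all $v$) and satisfies the Jacobi identity $[[u,v],w]+[[v,w],u]+[[w,u],v]=0$. An $\mathbf{R}_{k+1}$-Lie algebra lift of $\mathfrak{L}$ is a Lie algebra $\hat{\mathfrak{L}}$ over $\mathbf{R}_{k+1}$, of the same rank as $\mathfrak{L}$, together with a surjective $\mathbf{R}_{k+1}$-linear map $mod:\hat{\mathfrak{L}}\to\mathfrak{L}$ that preserves brackets. An isomorphism $\Psi:\hat{\mathfrak{L}}_1\to\hat{\mathfrak{L}}_2$ of $\mathbf{R}_{k+1}$-Lie algebras between two lifts (with maps $mod_1$, $mod_2$ to $\mathfrak{L}$) induces the identity on $\mathfrak{L}$ if $mod_2\circ\Psi=mod_1$. $\wedge^s(\bar{\mathfrak{L}},ad)$ is the $\mathbf{k}$-vector space of alternating $s$-multilinear $\bar{\mathfrak{L}}$-valued forms on $\bar{\mathfrak{L}}$, with differential $$(d\omega)(x_0,\dots,x_s)=\sum_{i=0}^s(-1)^i[x_i,\omega(x_0,\dots,\hat{x_i},\dots,x_s)]+\sum_{i<j}(-1)^{i+j}\omega([x_i,x_j],x_0,\dots,\hat{x_i},\dots,\hat{x_j},\dots,x_s),$$ and $H^*(\bar{\mathfrak{L}},ad)$ is the cohomology of this complex. *)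

theory Defs
  imports "HOL-Algebra.Algebra"
begin

section \<open>Discrete valuation rings and their truncations\<close>

locale discrete_valuation_ring = principal_domain R for R (structure) +
  assumes local_ring: "\<exists>!I. maximalideal I R"
    and not_field: "\<not> field R"

definition quot_map :: "('a, 'r) ring_scheme \<Rightarrow> 'a set \<Rightarrow> 'a \<Rightarrow> 'a set" where
  "quot_map R I r = I +>\<^bsub>R\<^esub> r"

definition trunc_ring :: "('a, 'r) ring_scheme \<Rightarrow> 'a \<Rightarrow> nat \<Rightarrow> 'a set ring" where
  "trunc_ring R \<pi> j = R Quot (PIdl\<^bsub>R\<^esub> (\<pi> [^]\<^bsub>R\<^esub> j))"

text \<open>For \<open>j \<le> i\<close> this is the canonical ring homomorphism from \<open>trunc_ring R \<pi> i\<close> onto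
  \<open>trunc_ring R \<pi> j\<close>: it maps the coset \<open>\<pi>\<^sup>iR + r\<close> to \<open>\<pi>\<^sup>jR + (\<pi>\<^sup>iR + r) = \<pi>\<^sup>jR + r\<close>.\<close>

definition trunc_map :: "('a, 'r) ring_scheme \<Rightarrow> 'a \<Rightarrow> nat \<Rightarrow> 'a set \<Rightarrow> 'a set" where
  "trunc_map R \<pi> j C = PIdl\<^bsub>R\<^esub> (\<pi> [^]\<^bsub>R\<^esub> j) <+>\<^bsub>R\<^esub> C"


section \<open>Lie algebras\<close>

text \<open>The fields \<open>mult\<close> and \<open>one\<close>, inherited from \<open>module\<close>, carry no meaning.\<close>

record ('a, 'b) lie_algebra = "('a, 'b) module" +
  lie_bracket :: "'b \<Rightarrow> 'b \<Rightarrow> 'b"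

definition is_basis ::
    "('a, 'r) ring_scheme \<Rightarrow> ('a, 'b, 'm) module_scheme \<Rightarrow> nat \<Rightarrow> (nat \<Rightarrow> 'b) \<Rightarrow> bool" where
  "is_basis K M n b \<longleftrightarrow> b \<in> {..<n} \<rightarrow> carrier M \<and>
    (\<forall>v\<in>carrier M. \<exists>!c. c \<in> {..<n} \<rightarrow>\<^sub>E carrier K \<and> v = (\<Oplus>\<^bsub>M\<^esub>i\<in>{..<n}. c i \<odot>\<^bsub>M\<^esub> b i))"

text \<open>Over a nontrivial commutative ring all bases of \<open>M\<close> have the same cardinality, so that
  \<open>LEAST\<close> selects the only possible value.\<close>

definition free_rank :: "('a, 'r) ring_scheme \<Rightarrow> ('a, 'b, 'm) module_scheme \<Rightarrow> nat" where
  "free_rank K M = (LEAST n. \<exists>b. is_basis K M n b)"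

locale lie_algebra = module K L
  for K :: "('a, 'r) ring_scheme" (structure)
    and L :: "('a, 'b, 'm) lie_algebra_scheme" (structure) +
  assumes bracket_closed:
      "\<lbrakk>x \<in> carrier L; y \<in> carrier L\<rbrakk> \<Longrightarrow> lie_bracket L x y \<in> carrier L"
    and bracket_add_left:
      "\<lbrakk>x \<in> carrier L; y \<in> carrier L; z \<in> carrier L\<rbrakk> \<Longrightarrow>
        lie_bracket L (x \<oplus>\<^bsub>L\<^esub> y) z = lie_bracket L x z \<oplus>\<^bsub>L\<^esub> lie_bracket L y z"
    and bracket_add_right:
      "\<lbrakk>x \<in> carrier L; y \<in> carrier L; z \<in> carrier L\<rbrakk> \<Longrightarrow>
        lie_bracket L x (y \<oplus>\<^bsub>L\<^esub> z) = lie_bracket L x y \<oplus>\<^bsub>L\<^esub> lie_bracket L x z"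
    and bracket_smult_left:
      "\<lbrakk>a \<in> carrier K; x \<in> carrier L; y \<in> carrier L\<rbrakk> \<Longrightarrow>
        lie_bracket L (a \<odot>\<^bsub>L\<^esub> x) y = a \<odot>\<^bsub>L\<^esub> lie_bracket L x y"
    and bracket_smult_right:
      "\<lbrakk>a \<in> carrier K; x \<in> carrier L; y \<in> carrier L\<rbrakk> \<Longrightarrow>
        lie_bracket L x (a \<odot>\<^bsub>L\<^esub> y) = a \<odot>\<^bsub>L\<^esub> lie_bracket L x y"
    and bracket_self: "x \<in> carrier L \<Longrightarrow> lie_bracket L x x = \<zero>\<^bsub>L\<^esub>"
    and jacobi:
      "\<lbrakk>u \<in> carrier L; v \<in> carrier L; w \<in> carrier L\<rbrakk> \<Longrightarrow>
        lie_bracket L (lie_bracket L u v) w \<oplus>\<^bsub>L\<^esub> lie_bracket L (lie_bracket L v w) u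
          \<oplus>\<^bsub>L\<^esub> lie_bracket L (lie_bracket L w u) v = \<zero>\<^bsub>L\<^esub>"
    and free_of_finite_rank: "\<exists>n b. is_basis K L n b"

definition lie_hom :: "('a, 'r) ring_scheme \<Rightarrow> ('a, 'b, 'm) lie_algebra_scheme \<Rightarrow>
    ('a, 'c, 'n) lie_algebra_scheme \<Rightarrow> ('b \<Rightarrow> 'c) set" where
  "lie_hom K L M = {h \<in> carrier L \<rightarrow> carrier M.
     (\<forall>x\<in>carrier L. \<forall>y\<in>carrier L. h (x \<oplus>\<^bsub>L\<^esub> y) = h x \<oplus>\<^bsub>M\<^esub> h y) \<and>
     (\<forall>a\<in>carrier K. \<forall>x\<in>carrier L. h (a \<odot>\<^bsub>L\<^esub> x) = a \<odot>\<^bsub>M\<^esub> h x) \<and>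
     (\<forall>x\<in>carrier L. \<forall>y\<in>carrier L. h (lie_bracket L x y) = lie_bracket M (h x) (h y))}"

definition restrict_scalars ::
    "('r \<Rightarrow> 's) \<Rightarrow> ('s, 'b) lie_algebra \<Rightarrow> ('r, 'b) lie_algebra" where
  "restrict_scalars f L = \<lparr>carrier = carrier L, monoid.mult = monoid.mult L, monoid.one = monoid.one L,
     ring.zero = ring.zero L, ring.add = ring.add L, smult = (\<lambda>r. smult L (f r)), lie_bracket = lie_bracket L\<rparr>"


section \<open>Base change\<close>

definition ring_as_module :: "('r \<Rightarrow> 's) \<Rightarrow> 's ring \<Rightarrow> ('r, 's) module" where
  "ring_as_module g S = \<lparr>carrier = carrier S, monoid.mult = monoid.mult S, monoid.one = monoid.one S,
     ring.zero = ring.zero S, ring.add = ring.add S, smult = (\<lambda>r s. g r \<otimes>\<^bsub>S\<^esub> s)\<rparr>"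

definition tensor_relators :: "('a, 'r) ring_scheme \<Rightarrow> ('a, 'b, 'm) module_scheme \<Rightarrow>
    ('a, 'c, 'n) module_scheme \<Rightarrow> ('b \<times> 'c \<Rightarrow>\<^sub>0 int) set" where
  "tensor_relators R M N =
     {frag_of (x \<oplus>\<^bsub>M\<^esub> y, a) - frag_of (x, a) - frag_of (y, a) | x y a.
        x \<in> carrier M \<and> y \<in> carrier M \<and> a \<in> carrier N} \<union>
     {frag_of (x, a \<oplus>\<^bsub>N\<^esub> b) - frag_of (x, a) - frag_of (x, b) | x a b.
        x \<in> carrier M \<and> a \<in> carrier N \<and> b \<in> carrier N} \<union>
     {frag_of (r \<odot>\<^bsub>M\<^esub> x, a) - frag_of (x, r \<odot>\<^bsub>N\<^esub> a) | r x a.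
        r \<in> carrier R \<and> x \<in> carrier M \<and> a \<in> carrier N}"

definition free_on_pairs :: "('a, 'b, 'm) module_scheme \<Rightarrow> ('a, 'c, 'n) module_scheme \<Rightarrow>
    ('b \<times> 'c \<Rightarrow>\<^sub>0 int) monoid" where
  "free_on_pairs M N = free_Abelian_group (carrier M \<times> carrier N)"

definition tensor_kernel :: "('a, 'r) ring_scheme \<Rightarrow> ('a, 'b, 'm) module_scheme \<Rightarrow>
    ('a, 'c, 'n) module_scheme \<Rightarrow> ('b \<times> 'c \<Rightarrow>\<^sub>0 int) set" where
  "tensor_kernel R M N = generate (free_on_pairs M N) (tensor_relators R M N)"

definition tensor_class :: "('a, 'r) ring_scheme \<Rightarrow> ('a, 'b, 'm) module_scheme \<Rightarrow>
    ('a, 'c, 'n) module_scheme \<Rightarrow> ('b \<times> 'c \<Rightarrow>\<^sub>0 int) \<Rightarrow> ('b \<times> 'c \<Rightarrow>\<^sub>0 int) set" where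
  "tensor_class R M N f = tensor_kernel R M N #>\<^bsub>free_on_pairs M N\<^esub> f"

definition tensor_group :: "('a, 'r) ring_scheme \<Rightarrow> ('a, 'b, 'm) module_scheme \<Rightarrow>
    ('a, 'c, 'n) module_scheme \<Rightarrow> ('b \<times> 'c \<Rightarrow>\<^sub>0 int) set monoid" where
  "tensor_group R M N = free_on_pairs M N Mod tensor_kernel R M N"

definition smult_ext :: "'s ring \<Rightarrow> 's \<Rightarrow> ('b \<times> 's \<Rightarrow>\<^sub>0 int) \<Rightarrow> 'b \<times> 's \<Rightarrow>\<^sub>0 int" where
  "smult_ext S c f = frag_extend (\<lambda>(x, a). frag_of (x, c \<otimes>\<^bsub>S\<^esub> a)) f"

definition bracket_ext :: "('a, 'b) lie_algebra \<Rightarrow> 's ring \<Rightarrow>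
    ('b \<times> 's \<Rightarrow>\<^sub>0 int) \<Rightarrow> ('b \<times> 's \<Rightarrow>\<^sub>0 int) \<Rightarrow> 'b \<times> 's \<Rightarrow>\<^sub>0 int" where
  "bracket_ext L S f h = frag_extend (\<lambda>(x, a). frag_extend (\<lambda>(y, b).
     frag_of (lie_bracket L x y, a \<otimes>\<^bsub>S\<^esub> b)) h) f"

text \<open>For an \<open>R\<close>-module \<open>L\<close> with an \<open>R\<close>-bilinear bracket and a commutative \<open>R\<close>-algebra \<open>S\<close> with
  structure map \<open>g\<close>, this is the \<open>S\<close>-module \<open>L \<otimes>\<^sub>R S\<close> with scalar multiplication
  \<open>c (x \<otimes> a) = x \<otimes> ca\<close> and bracket \<open>[x \<otimes> a, y \<otimes> b] = [x, y] \<otimes> ab\<close>. As in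
  \<^const>\<open>rcoset_mult\<close>, the unions run over all representatives, which all give the same class; see
  \<open>base_change_smult\<close> and \<open>base_change_bracket\<close> below.\<close>

definition base_change :: "('a, 'r) ring_scheme \<Rightarrow> ('a \<Rightarrow> 's) \<Rightarrow> 's ring \<Rightarrow>
    ('a, 'b) lie_algebra \<Rightarrow> ('s, ('b \<times> 's \<Rightarrow>\<^sub>0 int) set) lie_algebra" where
  "base_change R g S L = (let N = ring_as_module g S; T = tensor_group R L N in
    \<lparr>carrier = carrier T, monoid.mult = undefined, monoid.one = undefined,
     ring.zero = monoid.one T, ring.add = monoid.mult T,
     smult = (\<lambda>c U. \<Union>f\<in>U. tensor_class R L N (smult_ext S c f)),
     lie_bracket = (\<lambda>U V. \<Union>f\<in>U. \<Union>h\<in>V. tensor_class R L N (bracket_ext L S f h))\<rparr>)"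


section \<open>Cohomology with adjoint coefficients\<close>

text \<open>An \<open>s\<close>-form is a function on lists of length \<open>s\<close>.\<close>

definition tuples :: "('a, 'b, 'm) module_scheme \<Rightarrow> nat \<Rightarrow> 'b list set" where
  "tuples L s = {xs. set xs \<subseteq> carrier L \<and> length xs = s}"

definition multilinear ::
    "('a, 'r) ring_scheme \<Rightarrow> ('a, 'b, 'm) module_scheme \<Rightarrow> nat \<Rightarrow> ('b list \<Rightarrow> 'b) \<Rightarrow> bool" where
  "multilinear K L s \<omega> \<longleftrightarrow> (\<forall>xs\<in>tuples L s. \<forall>i<s. \<forall>u\<in>carrier L.
     (\<forall>v\<in>carrier L. \<omega> (xs[i := u \<oplus>\<^bsub>L\<^esub> v]) = \<omega> (xs[i := u]) \<oplus>\<^bsub>L\<^esub> \<omega> (xs[i := v])) \<and>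
     (\<forall>a\<in>carrier K. \<omega> (xs[i := a \<odot>\<^bsub>L\<^esub> u]) = a \<odot>\<^bsub>L\<^esub> \<omega> (xs[i := u])))"

definition alternating :: "('a, 'b, 'm) module_scheme \<Rightarrow> nat \<Rightarrow> ('b list \<Rightarrow> 'b) \<Rightarrow> bool" where
  "alternating L s \<omega> \<longleftrightarrow>
     (\<forall>xs\<in>tuples L s. (\<exists>i j. i < j \<and> j < s \<and> xs ! i = xs ! j) \<longrightarrow> \<omega> xs = \<zero>\<^bsub>L\<^esub>)"

definition cochains ::
    "('a, 'r) ring_scheme \<Rightarrow> ('a, 'b) lie_algebra \<Rightarrow> nat \<Rightarrow> ('a, 'b list \<Rightarrow> 'b) module" where
  "cochains K L s =
    \<lparr>carrier = {\<omega> \<in> tuples L s \<rightarrow>\<^sub>E carrier L. multilinear K L s \<omega> \<and> alternating L s \<omega>},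
     monoid.mult = undefined, monoid.one = undefined,
     ring.zero = (\<lambda>xs\<in>tuples L s. \<zero>\<^bsub>L\<^esub>),
     ring.add = (\<lambda>\<omega> \<eta>. \<lambda>xs\<in>tuples L s. \<omega> xs \<oplus>\<^bsub>L\<^esub> \<eta> xs),
     smult = (\<lambda>a \<omega>. \<lambda>xs\<in>tuples L s. a \<odot>\<^bsub>L\<^esub> \<omega> xs)\<rparr>"

definition remove_nth :: "nat \<Rightarrow> 'b list \<Rightarrow> 'b list" where
  "remove_nth i xs = take i xs @ drop (Suc i) xs"

definition neg_one_pow :: "('a, 'b, 'm) module_scheme \<Rightarrow> nat \<Rightarrow> 'b \<Rightarrow> 'b" where
  "neg_one_pow L i v = (if even i then v else \<ominus>\<^bsub>L\<^esub> v)"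

definition differential ::
    "('a, 'b) lie_algebra \<Rightarrow> nat \<Rightarrow> ('b list \<Rightarrow> 'b) \<Rightarrow> 'b list \<Rightarrow> 'b" where
  "differential L s \<omega> = (\<lambda>xs\<in>tuples L (Suc s).
     (\<Oplus>\<^bsub>L\<^esub>i\<in>{..s}. neg_one_pow L i (lie_bracket L (xs ! i) (\<omega> (remove_nth i xs)))) \<oplus>\<^bsub>L\<^esub>
     (\<Oplus>\<^bsub>L\<^esub>j\<in>{..s}. \<Oplus>\<^bsub>L\<^esub>i\<in>{..<j}. neg_one_pow L (i + j)
        (\<omega> (lie_bracket L (xs ! i) (xs ! j) # remove_nth i (remove_nth j xs)))))"

definition cocycles ::
    "('a, 'r) ring_scheme \<Rightarrow> ('a, 'b) lie_algebra \<Rightarrow> nat \<Rightarrow> ('b list \<Rightarrow> 'b) set" where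
  "cocycles K L s =
     {\<omega> \<in> carrier (cochains K L s). differential L s \<omega> = \<zero>\<^bsub>cochains K L (Suc s)\<^esub>}"

fun coboundaries ::
    "('a, 'r) ring_scheme \<Rightarrow> ('a, 'b) lie_algebra \<Rightarrow> nat \<Rightarrow> ('b list \<Rightarrow> 'b) set" where
  "coboundaries K L 0 = {\<zero>\<^bsub>cochains K L 0\<^esub>}"
| "coboundaries K L (Suc s) = differential L s ` carrier (cochains K L s)"

text \<open>The underlying set of \<open>H\<^sup>s(L, ad)\<close>, that is, of the quotient of the cocycles by the
  coboundaries.\<close>

definition cohomology :: "('a, 'r) ring_scheme \<Rightarrow> ('a, 'b) lie_algebra \<Rightarrow> nat \<Rightarrow>
    ('b list \<Rightarrow> 'b) set set" where
  "cohomology K L s =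
     a_rcosets\<^bsub>(cochains K L s)\<lparr>carrier := cocycles K L s\<rparr>\<^esub> (coboundaries K L s)"


section \<open>Lifts\<close>

definition residue_field :: "('a, 'r) ring_scheme \<Rightarrow> 'a \<Rightarrow> 'a set ring" where
  "residue_field R \<pi> = R Quot (PIdl\<^bsub>R\<^esub> \<pi>)"

definition reduction :: "('a, 'r) ring_scheme \<Rightarrow> 'a \<Rightarrow> nat \<Rightarrow> ('a set, 'b) lie_algebra \<Rightarrow>
    ('a set, ('b \<times> 'a set \<Rightarrow>\<^sub>0 int) set) lie_algebra" where
  "reduction R \<pi> k L = base_change R (quot_map R (PIdl\<^bsub>R\<^esub> \<pi>)) (residue_field R \<pi>)
     (restrict_scalars (quot_map R (PIdl\<^bsub>R\<^esub> (\<pi> [^]\<^bsub>R\<^esub> k))) L)"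

definition is_lift :: "('a, 'r) ring_scheme \<Rightarrow> 'a \<Rightarrow> nat \<Rightarrow> ('a set, 'b) lie_algebra \<Rightarrow>
    ('a set, 'c) lie_algebra \<Rightarrow> ('c \<Rightarrow> 'b) \<Rightarrow> bool" where
  "is_lift R \<pi> k L M p \<longleftrightarrow>
     lie_algebra (trunc_ring R \<pi> (k + 1)) M \<and>
     free_rank (trunc_ring R \<pi> (k + 1)) M = free_rank (trunc_ring R \<pi> k) L \<and>
     p \<in> lie_hom (trunc_ring R \<pi> (k + 1)) M (restrict_scalars (trunc_map R \<pi> k) L) \<and>
     p ` carrier M = carrier L"

definition isomorphic_lifts :: "('a, 'r) ring_scheme \<Rightarrow> 'a \<Rightarrow> nat \<Rightarrow>
    ('a set, 'c) lie_algebra \<times> ('c \<Rightarrow> 'b) \<Rightarrow> ('a set, 'd) lie_algebra \<times> ('d \<Rightarrow> 'b) \<Rightarrow> bool" where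
  "isomorphic_lifts R \<pi> k = (\<lambda>(M1, p1) (M2, p2).
     \<exists>\<Psi>\<in>lie_hom (trunc_ring R \<pi> (k + 1)) M1 M2.
       bij_betw \<Psi> (carrier M1) (carrier M2) \<and> (\<forall>x\<in>carrier M1. p2 (\<Psi> x) = p1 x))"

definition lifts :: "('a, 'r) ring_scheme \<Rightarrow> 'a \<Rightarrow> nat \<Rightarrow> ('a set, 'b) lie_algebra \<Rightarrow>
    (('a set, 'c) lie_algebra \<times> ('c \<Rightarrow> 'b)) set" where
  "lifts R \<pi> k L = {(M, p). is_lift R \<pi> k L M p}"

definition lift_equiv :: "('a, 'r) ring_scheme \<Rightarrow> 'a \<Rightarrow> nat \<Rightarrow> ('a set, 'b) lie_algebra \<Rightarrow>
    ((('a set, 'c) lie_algebra \<times> ('c \<Rightarrow> 'b)) \<times> (('a set, 'c) lie_algebra \<times> ('c \<Rightarrow> 'b))) set" where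
  "lift_equiv R \<pi> k L =
     {(x, y). x \<in> lifts R \<pi> k L \<and> y \<in> lifts R \<pi> k L \<and> isomorphic_lifts R \<pi> k x y}"


section \<open>The operations of a base change are well defined\<close>

lemma free_on_pairs_simps [simp]:
  "carrier (free_on_pairs M N) = {f. Poly_Mapping.keys f \<subseteq> carrier M \<times> carrier N}"
  "monoid.mult (free_on_pairs M N) = (+)" "monoid.one (free_on_pairs M N) = 0"
  by (auto simp: free_on_pairs_def free_Abelian_group_def)

context
  fixes R :: "('a, 'r) ring_scheme" and M :: "('a, 'b, 'm) module_scheme"
    and N :: "('a, 'c, 'n) module_scheme"
  assumes M: "module R M" and N: "module R N"
begin

interpretation M: module R M by (rule M)
interpretation N: module R N by (rule N)
interpretation F: comm_group "free_on_pairs M N"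
  unfolding free_on_pairs_def by (rule abelian_free_Abelian_group)

lemma keys_diff3: "Poly_Mapping.keys (frag_of p - frag_of q - frag_of r :: 'z \<Rightarrow>\<^sub>0 int) \<subseteq> {p, q, r}"
  using keys_diff[of "frag_of p - frag_of q" "frag_of r"] keys_diff[of "frag_of p" "frag_of q"]
  by auto

lemma keys_diff2: "Poly_Mapping.keys (frag_of p - frag_of q :: 'z \<Rightarrow>\<^sub>0 int) \<subseteq> {p, q}"
  using keys_diff[of "frag_of p" "frag_of q"] by auto

lemma tensor_relators_carrier: "tensor_relators R M N \<subseteq> carrier (free_on_pairs M N)"
  unfolding tensor_relators_def
  by (auto 0 0 dest!: subsetD[OF keys_diff3] subsetD[OF keys_diff2])

lemma tensor_kernel_subgroup: "subgroup (tensor_kernel R M N) (free_on_pairs M N)"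
  unfolding tensor_kernel_def by (rule F.generate_is_subgroup[OF tensor_relators_carrier])

lemma tensor_class_member: "f' \<in> tensor_class R M N f \<longleftrightarrow> f' - f \<in> tensor_kernel R M N"
  by (auto simp: tensor_class_def r_coset_def) (metis diff_add_cancel)

lemma tensor_kernel_carrier: "f \<in> tensor_kernel R M N \<Longrightarrow> Poly_Mapping.keys f \<subseteq> carrier M \<times> carrier N"
  using subgroup.subset[OF tensor_kernel_subgroup] by auto

lemma tensor_kernel_add: "f \<in> tensor_kernel R M N \<Longrightarrow> f' \<in> tensor_kernel R M N \<Longrightarrow> f + f' \<in> tensor_kernel R M N"
  using subgroup.m_closed[OF tensor_kernel_subgroup] by auto

lemma tensor_kernel_0: "0 \<in> tensor_kernel R M N"
  using subgroup.one_closed[OF tensor_kernel_subgroup] by auto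

lemma tensor_kernel_minus: "f \<in> tensor_kernel R M N \<Longrightarrow> - f \<in> tensor_kernel R M N"
  using subgroup.m_inv_closed[OF tensor_kernel_subgroup, of f] tensor_kernel_carrier[of f]
  by (simp add: free_on_pairs_def)

lemma tensor_kernel_diff: "f \<in> tensor_kernel R M N \<Longrightarrow> f' \<in> tensor_kernel R M N \<Longrightarrow> f - f' \<in> tensor_kernel R M N"
  using tensor_kernel_add[OF _ tensor_kernel_minus] by force

lemma tensor_class_eq:
  assumes "f - f' \<in> tensor_kernel R M N" shows "tensor_class R M N f = tensor_class R M N f'"
proof -
  have "x - f \<in> tensor_kernel R M N \<longleftrightarrow> x - f' \<in> tensor_kernel R M N" for x
    using tensor_kernel_add[of "x - f" "f - f'"] tensor_kernel_diff[of "x - f'" "f - f'"] assms by auto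
  then show ?thesis by (auto simp: tensor_class_member)
qed

lemma tensor_kernel_induct:
  assumes f: "f \<in> tensor_kernel R M N" and rel: "\<And>r. r \<in> tensor_relators R M N \<Longrightarrow> \<phi> r \<in> tensor_kernel R M N"
   and add: "\<And>x y. \<phi> (x + y) = \<phi> x + \<phi> y"
  shows "\<phi> f \<in> tensor_kernel R M N"
proof -
  have [simp]: "\<phi> 0 = 0" using add[of 0 0] by simp
  have m: "\<phi> (- x) = - \<phi> x" for x using add[of x "-x"] by (simp add: eq_neg_iff_add_eq_0 add.commute)
  from f[unfolded tensor_kernel_def] show ?thesis
  proof (induction rule: generate.induct)
    case one then show ?case by (simp add: tensor_kernel_0)
  next
    case (incl h) then show ?case by (rule rel)
  next
    case (inv h)
    then have "Poly_Mapping.keys h \<subseteq> carrier M \<times> carrier N" using tensor_relators_carrier by auto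
    then have "inv\<^bsub>free_on_pairs M N\<^esub> h = - h" by (simp add: free_on_pairs_def)
    then show ?case using rel[OF inv] by (simp add: m tensor_kernel_minus)
  next
    case (eng a b) then show ?case by (simp add: add tensor_kernel_add)
  qed
qed

lemma UN_tensor_class:
  assumes rel: "\<And>r. r \<in> tensor_relators R M N \<Longrightarrow> \<phi> r \<in> tensor_kernel R M N"
   and add: "\<And>x y. \<phi> (x + y) = \<phi> x + \<phi> y"
  shows "(\<Union>u\<in>tensor_class R M N f. tensor_class R M N (\<phi> u)) = tensor_class R M N (\<phi> f)"
proof -
  have "tensor_class R M N (\<phi> u) = tensor_class R M N (\<phi> f)" if "u \<in> tensor_class R M N f" for u
  proof -
    have "u - f \<in> tensor_kernel R M N" using that by (simp add: tensor_class_member)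
    then have "\<phi> (u - f) \<in> tensor_kernel R M N" using rel add by (rule tensor_kernel_induct)
    moreover have "\<phi> (u - f) = \<phi> u - \<phi> f" using add[of "u - f" f] by simp
    ultimately show ?thesis by (simp add: tensor_class_eq)
  qed
  moreover have "f \<in> tensor_class R M N f" by (simp add: tensor_class_member tensor_kernel_0)
  ultimately show ?thesis by blast
qed

lemma relator_kernel: "r \<in> tensor_relators R M N \<Longrightarrow> r \<in> tensor_kernel R M N"
  unfolding tensor_kernel_def by (rule generate.incl)

end

context
  fixes R :: "('a, 'r) ring_scheme" and S :: "'s ring" and g and L :: "('a, 'b) lie_algebra"
  assumes S: "cring S" and L: "module R L" and N: "module R (ring_as_module g S)"
    and g: "\<And>r. r \<in> carrier R \<Longrightarrow> g r \<in> carrier S"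
    and br: "\<And>x y. x \<in> carrier L \<Longrightarrow> y \<in> carrier L \<Longrightarrow> lie_bracket L x y \<in> carrier L"
      "\<And>x y z. \<lbrakk>x \<in> carrier L; y \<in> carrier L; z \<in> carrier L\<rbrakk> \<Longrightarrow>
        lie_bracket L (x \<oplus>\<^bsub>L\<^esub> y) z = lie_bracket L x z \<oplus>\<^bsub>L\<^esub> lie_bracket L y z"
      "\<And>x y z. \<lbrakk>x \<in> carrier L; y \<in> carrier L; z \<in> carrier L\<rbrakk> \<Longrightarrow>
        lie_bracket L x (y \<oplus>\<^bsub>L\<^esub> z) = lie_bracket L x y \<oplus>\<^bsub>L\<^esub> lie_bracket L x z"
      "\<And>a x y. \<lbrakk>a \<in> carrier R; x \<in> carrier L; y \<in> carrier L\<rbrakk> \<Longrightarrow>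
        lie_bracket L (a \<odot>\<^bsub>L\<^esub> x) y = a \<odot>\<^bsub>L\<^esub> lie_bracket L x y"
      "\<And>a x y. \<lbrakk>a \<in> carrier R; x \<in> carrier L; y \<in> carrier L\<rbrakk> \<Longrightarrow>
        lie_bracket L x (a \<odot>\<^bsub>L\<^esub> y) = a \<odot>\<^bsub>L\<^esub> lie_bracket L x y"
begin

interpretation S: cring S by (rule S)

lemma bracket_ext_of:
  "bracket_ext L S (frag_of (x, a)) (frag_of (y, b)) = frag_of (lie_bracket L x y, a \<otimes>\<^bsub>S\<^esub> b)"
  by (simp add: bracket_ext_def)

lemma bracket_ext_add_left: "bracket_ext L S (f + f') h = bracket_ext L S f h + bracket_ext L S f' h"
  by (simp add: bracket_ext_def frag_extend_add)

lemma bracket_ext_diff_left: "bracket_ext L S (f - f') h = bracket_ext L S f h - bracket_ext L S f' h"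
  by (simp add: bracket_ext_def frag_extend_diff)

lemma bracket_ext_add_right: "bracket_ext L S f (h + h') = bracket_ext L S f h + bracket_ext L S f h'"
proof -
  have "frag_extend (\<lambda>z. p z + q z) f = frag_extend p f + frag_extend q f" for p q
    unfolding frag_extend_def by (simp only: frag_cmul_distrib2 sum.distrib)
  then show ?thesis by (simp only: bracket_ext_def frag_extend_add split_def)
qed

lemma bracket_ext_zero_right: "bracket_ext L S f 0 = 0"
  by (simp add: bracket_ext_def frag_extend_eq_0 split_def)

lemma bracket_ext_diff_right: "bracket_ext L S f (h - h') = bracket_ext L S f h - bracket_ext L S f h'"
proof -
  have "bracket_ext L S f h = bracket_ext L S f ((h - h') + h')" by simp
  then show ?thesis unfolding bracket_ext_add_right by (simp add: eq_diff_eq)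
qed

lemma tensor_kernel_relators:
  "\<lbrakk>x \<in> carrier L; y \<in> carrier L; a \<in> carrier S\<rbrakk> \<Longrightarrow> frag_of (x \<oplus>\<^bsub>L\<^esub> y, a) - frag_of (x, a) - frag_of (y, a) \<in> tensor_kernel R L (ring_as_module g S)"
  "\<lbrakk>x \<in> carrier L; b \<in> carrier S; a \<in> carrier S\<rbrakk> \<Longrightarrow> frag_of (x, a \<oplus>\<^bsub>S\<^esub> b) - frag_of (x, a) - frag_of (x, b) \<in> tensor_kernel R L (ring_as_module g S)"
  "\<lbrakk>r \<in> carrier R; x \<in> carrier L; a \<in> carrier S\<rbrakk> \<Longrightarrow> frag_of (r \<odot>\<^bsub>L\<^esub> x, a) - frag_of (x, g r \<otimes>\<^bsub>S\<^esub> a) \<in> tensor_kernel R L (ring_as_module g S)"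
proof -
  show "\<lbrakk>x \<in> carrier L; y \<in> carrier L; a \<in> carrier S\<rbrakk> \<Longrightarrow> frag_of (x \<oplus>\<^bsub>L\<^esub> y, a) - frag_of (x, a) - frag_of (y, a) \<in> tensor_kernel R L (ring_as_module g S)"
    by (rule relator_kernel[OF L N]) (unfold tensor_relators_def ring_as_module_def partial_object.simps ring.simps module.simps, blast)
  show "\<lbrakk>x \<in> carrier L; b \<in> carrier S; a \<in> carrier S\<rbrakk> \<Longrightarrow> frag_of (x, a \<oplus>\<^bsub>S\<^esub> b) - frag_of (x, a) - frag_of (x, b) \<in> tensor_kernel R L (ring_as_module g S)"
    by (rule relator_kernel[OF L N]) (unfold tensor_relators_def ring_as_module_def partial_object.simps ring.simps module.simps, blast)
  show "\<lbrakk>r \<in> carrier R; x \<in> carrier L; a \<in> carrier S\<rbrakk> \<Longrightarrow> frag_of (r \<odot>\<^bsub>L\<^esub> x, a) - frag_of (x, g r \<otimes>\<^bsub>S\<^esub> a) \<in> tensor_kernel R L (ring_as_module g S)"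
    by (rule relator_kernel[OF L N]) (unfold tensor_relators_def ring_as_module_def partial_object.simps ring.simps module.simps, blast)
qed

lemma tensor_relatorE:
  assumes "r \<in> tensor_relators R L (ring_as_module g S)"
  obtains (1) x y a where "r = frag_of (x \<oplus>\<^bsub>L\<^esub> y, a) - frag_of (x, a) - frag_of (y, a)" "x \<in> carrier L" "y \<in> carrier L" "a \<in> carrier S"
   | (2) x a b where "r = frag_of (x, a \<oplus>\<^bsub>S\<^esub> b) - frag_of (x, a) - frag_of (x, b)" "x \<in> carrier L" "a \<in> carrier S" "b \<in> carrier S"
   | (3) c x a where "r = frag_of (c \<odot>\<^bsub>L\<^esub> x, a) - frag_of (x, g c \<otimes>\<^bsub>S\<^esub> a)" "c \<in> carrier R" "x \<in> carrier L" "a \<in> carrier S"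
  using assms unfolding tensor_relators_def ring_as_module_def by auto

lemma base_change_smult:
  assumes c: "c \<in> carrier S"
  shows "c \<odot>\<^bsub>base_change R g S L\<^esub> tensor_class R L (ring_as_module g S) f = tensor_class R L (ring_as_module g S) (smult_ext S c f)"
proof -
  have *: "smult_ext S c r \<in> tensor_kernel R L (ring_as_module g S)"
    if "r \<in> tensor_relators R L (ring_as_module g S)" for r
    using that
  proof (cases rule: tensor_relatorE)
    case (1 x y a)
    then show ?thesis using c by (simp add: smult_ext_def frag_extend_diff tensor_kernel_relators)
  next
    case (2 x a b)
    then show ?thesis using c by (simp add: smult_ext_def frag_extend_diff tensor_kernel_relators S.r_distr)
  next
    case (3 d x a)
    have "c \<otimes>\<^bsub>S\<^esub> (g d \<otimes>\<^bsub>S\<^esub> a) = g d \<otimes>\<^bsub>S\<^esub> (c \<otimes>\<^bsub>S\<^esub> a)" using 3 c g by (simp add: S.m_lcomm)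
    then show ?thesis using 3 c by (simp add: smult_ext_def frag_extend_diff tensor_kernel_relators)
  qed
  have "(\<Union>f\<in>tensor_class R L (ring_as_module g S) f. tensor_class R L (ring_as_module g S) (smult_ext S c f)) = tensor_class R L (ring_as_module g S) (smult_ext S c f)"
    by (rule UN_tensor_class[OF L N]) (simp_all add: *, simp add: smult_ext_def frag_extend_add)
  then show ?thesis by (simp add: base_change_def Let_def)
qed

lemma bracket_ext_rel:
  assumes r: "r \<in> tensor_relators R L (ring_as_module g S)" and k: "Poly_Mapping.keys f \<subseteq> carrier L \<times> carrier S"
  shows "bracket_ext L S f r \<in> tensor_kernel R L (ring_as_module g S) \<and> bracket_ext L S r f \<in> tensor_kernel R L (ring_as_module g S)"
  using k
proof (induction f rule: frag_induction)
  case zero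
  have "bracket_ext L S 0 r = 0" by (simp add: bracket_ext_def)
  then show ?case using tensor_kernel_0[OF L N] unfolding bracket_ext_zero_right by simp
next
  case (one z)
  then obtain u s where z: "z = (u, s)" "u \<in> carrier L" "s \<in> carrier S" by auto
  from r show ?case
  proof (cases rule: tensor_relatorE)
    case (1 x y a)
    show ?thesis unfolding 1 z bracket_ext_diff_left bracket_ext_diff_right bracket_ext_of using z(2,3) 1(2-)
      by (simp add: br tensor_kernel_relators)
  next
    case (2 x a b)
    show ?thesis unfolding 2 z bracket_ext_diff_left bracket_ext_diff_right bracket_ext_of using z(2,3) 2(2-)
      by (simp add: br tensor_kernel_relators S.l_distr S.r_distr)
  next
    case (3 c x a)
    have "s \<otimes>\<^bsub>S\<^esub> (g c \<otimes>\<^bsub>S\<^esub> a) = g c \<otimes>\<^bsub>S\<^esub> (s \<otimes>\<^bsub>S\<^esub> a)" "(g c \<otimes>\<^bsub>S\<^esub> a) \<otimes>\<^bsub>S\<^esub> s = g c \<otimes>\<^bsub>S\<^esub> (a \<otimes>\<^bsub>S\<^esub> s)"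
      using 3 z g by (auto simp: S.m_ac)
    then show ?thesis unfolding 3 z bracket_ext_diff_left bracket_ext_diff_right bracket_ext_of using z(2,3) 3(2-)
      by (simp add: br tensor_kernel_relators)
  qed
next
  case (diff a b)
  then show ?case unfolding bracket_ext_diff_left bracket_ext_diff_right using tensor_kernel_diff[OF L N] by blast
qed

lemma base_change_bracket:
  assumes f: "Poly_Mapping.keys f \<subseteq> carrier L \<times> carrier S" and h: "Poly_Mapping.keys h \<subseteq> carrier L \<times> carrier S"
  shows "lie_bracket (base_change R g S L) (tensor_class R L (ring_as_module g S) f) (tensor_class R L (ring_as_module g S) h) = tensor_class R L (ring_as_module g S) (bracket_ext L S f h)"
proof -
  have "lie_bracket (base_change R g S L) (tensor_class R L (ring_as_module g S) f) (tensor_class R L (ring_as_module g S) h) = (\<Union>f'\<in>tensor_class R L (ring_as_module g S) f. \<Union>h'\<in>tensor_class R L (ring_as_module g S) h. tensor_class R L (ring_as_module g S) (bracket_ext L S f' h'))"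
    by (simp add: base_change_def Let_def)
  also have "\<dots> = (\<Union>f'\<in>tensor_class R L (ring_as_module g S) f. tensor_class R L (ring_as_module g S) (bracket_ext L S f' h))"
  proof (rule SUP_cong[OF refl])
    fix f' assume "f' \<in> tensor_class R L (ring_as_module g S) f"
    then have "f' - f \<in> tensor_kernel R L (ring_as_module g S)" using tensor_class_member[OF L N] by blast
    then have "Poly_Mapping.keys (f' - f) \<subseteq> carrier L \<times> carrier S"
      using tensor_kernel_carrier[OF L N] by (force simp: ring_as_module_def)
    then have f': "Poly_Mapping.keys f' \<subseteq> carrier L \<times> carrier S"
      using f keys_add[of "f' - f" f] by auto
    show "(\<Union>h'\<in>tensor_class R L (ring_as_module g S) h. tensor_class R L (ring_as_module g S) (bracket_ext L S f' h')) = tensor_class R L (ring_as_module g S) (bracket_ext L S f' h)"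
    proof (rule UN_tensor_class[OF L N])
      show "bracket_ext L S f' r \<in> tensor_kernel R L (ring_as_module g S)" if "r \<in> tensor_relators R L (ring_as_module g S)" for r
        using bracket_ext_rel[OF that f'] by blast
    qed (rule bracket_ext_add_right)
  qed
  also have "\<dots> = tensor_class R L (ring_as_module g S) (bracket_ext L S f h)"
  proof (rule UN_tensor_class[OF L N])
    show "bracket_ext L S r h \<in> tensor_kernel R L (ring_as_module g S)" if "r \<in> tensor_relators R L (ring_as_module g S)" for r
      using bracket_ext_rel[OF that h] by blast
  qed (rule bracket_ext_add_left)
  finally show ?thesis .
qed

end


section \<open>Independence of the type carrying the lifts\<close>

definition transport :: "('b \<Rightarrow> 'c) \<Rightarrow> ('a, 'b) lie_algebra \<Rightarrow> ('a, 'c) lie_algebra" where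
  "transport h N = (let g = inv_into (carrier N) h in
     \<lparr>carrier = h ` carrier N, monoid.mult = undefined, monoid.one = undefined,
      ring.zero = h \<zero>\<^bsub>N\<^esub>, ring.add = (\<lambda>x y. h (g x \<oplus>\<^bsub>N\<^esub> g y)),
      smult = (\<lambda>a x. h (a \<odot>\<^bsub>N\<^esub> g x)),
      lie_bracket = (\<lambda>x y. h (lie_bracket N (g x) (g y)))\<rparr>)"

context
  fixes K :: "('a, 'r) ring_scheme" and N :: "('a, 'b) lie_algebra" and h :: "'b \<Rightarrow> 'c"
  assumes N: "lie_algebra K N" and inj: "inj_on h (carrier N)"
begin

interpretation N: lie_algebra K N by (rule N)

lemma transport_simps:
  "carrier (transport h N) = h ` carrier N" "\<zero>\<^bsub>transport h N\<^esub> = h \<zero>\<^bsub>N\<^esub>"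
  "x \<in> carrier N \<Longrightarrow> y \<in> carrier N \<Longrightarrow> h x \<oplus>\<^bsub>transport h N\<^esub> h y = h (x \<oplus>\<^bsub>N\<^esub> y)"
  "x \<in> carrier N \<Longrightarrow> a \<odot>\<^bsub>transport h N\<^esub> h x = h (a \<odot>\<^bsub>N\<^esub> x)"
  "x \<in> carrier N \<Longrightarrow> y \<in> carrier N \<Longrightarrow> lie_bracket (transport h N) (h x) (h y) = h (lie_bracket N x y)"
  using inj by (auto simp: transport_def Let_def)

lemma transport_abelian_group: "abelian_group (transport h N)"
proof (rule abelian_groupI)
  fix x assume "x \<in> carrier (transport h N)"
  then obtain u where u: "u \<in> carrier N" "x = h u" by (auto simp: transport_simps)
  then show "\<exists>y\<in>carrier (transport h N). y \<oplus>\<^bsub>transport h N\<^esub> x = \<zero>\<^bsub>transport h N\<^esub>"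
    by (intro bexI[of _ "h (\<ominus>\<^bsub>N\<^esub> u)"]) (auto simp: transport_simps N.M.l_neg)
qed (auto simp: transport_simps N.M.a_ac)

lemma transport_module: "module K (transport h N)"
  by (rule moduleI)
    (auto simp: transport_simps transport_abelian_group N.smult_l_distr N.smult_r_distr
       N.smult_assoc1 N.R.cring_axioms)

interpretation M: module K "transport h N" by (rule transport_module)

lemma transport_finsum:
  assumes "finite I" "f \<in> I \<rightarrow> carrier N"
  shows "(\<Oplus>\<^bsub>transport h N\<^esub>i\<in>I. h (f i)) = h (\<Oplus>\<^bsub>N\<^esub>i\<in>I. f i)"
  using assms
proof (induction I rule: finite_induct)
  case (insert i I)
  then show ?case by (subst M.M.finsum_insert) (auto simp: transport_simps Pi_def)
qed (simp add: transport_simps)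

lemma transport_basis:
  assumes "is_basis K N n b" shows "is_basis K (transport h N) n (\<lambda>i. h (b i))"
  unfolding is_basis_def
proof (intro conjI ballI)
  have b: "b \<in> {..<n} \<rightarrow> carrier N" using assms by (auto simp: is_basis_def)
  then show "(\<lambda>i. h (b i)) \<in> {..<n} \<rightarrow> carrier (transport h N)" by (auto simp: transport_simps)
  let ?l = "\<lambda>c. \<Oplus>\<^bsub>transport h N\<^esub>i\<in>{..<n}. c i \<odot>\<^bsub>transport h N\<^esub> h (b i)"
  let ?r = "\<lambda>c. \<Oplus>\<^bsub>N\<^esub>i\<in>{..<n}. c i \<odot>\<^bsub>N\<^esub> b i"
  have *: "?l c = h (?r c)" and cl: "?r c \<in> carrier N"
    if "c \<in> {..<n} \<rightarrow>\<^sub>E carrier K" for c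
  proof -
    have c: "(\<lambda>i. c i \<odot>\<^bsub>N\<^esub> b i) \<in> {..<n} \<rightarrow> carrier N" using that b by (auto simp: PiE_def Pi_def)
    have "?l c = (\<Oplus>\<^bsub>transport h N\<^esub>i\<in>{..<n}. h (c i \<odot>\<^bsub>N\<^esub> b i))"
      using b c by (intro M.M.finsum_cong') (auto simp: transport_simps Pi_def)
    then show "?l c = h (?r c)" using c by (simp add: transport_finsum)
    show "?r c \<in> carrier N" using c by simp
  qed
  fix v assume "v \<in> carrier (transport h N)"
  then obtain u where u: "u \<in> carrier N" "v = h u" by (auto simp: transport_simps)
  have eq: "v = ?l c \<longleftrightarrow> u = ?r c" if "c \<in> {..<n} \<rightarrow>\<^sub>E carrier K" for c
    using *[OF that] cl[OF that] u inj by (auto dest: inj_onD)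
  have "\<exists>!c. c \<in> {..<n} \<rightarrow>\<^sub>E carrier K \<and> u = ?r c" using assms u by (auto simp: is_basis_def)
  then show "\<exists>!c. c \<in> {..<n} \<rightarrow>\<^sub>E carrier K \<and> v = ?l c" using eq by (smt (verit))
qed

lemma transport_lie_algebra: "lie_algebra K (transport h N)"
proof -
  have "\<exists>n b. is_basis K (transport h N) n b" using N.free_of_finite_rank transport_basis by blast
  then show ?thesis
    by unfold_locales
     (auto simp: transport_simps N.bracket_closed N.bracket_add_left N.bracket_add_right
      N.bracket_smult_left N.bracket_smult_right N.bracket_self N.jacobi)
qed

lemma transport_iso: "h \<in> lie_hom K N (transport h N)" "bij_betw h (carrier N) (carrier (transport h N))"
  using inj by (auto simp: lie_hom_def transport_simps bij_betw_def)

end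

lemma basis_bij:
  assumes "module K M" "is_basis K M n b"
  shows "bij_betw (\<lambda>c. \<Oplus>\<^bsub>M\<^esub>i\<in>{..<n}. c i \<odot>\<^bsub>M\<^esub> b i) ({..<n} \<rightarrow>\<^sub>E carrier K) (carrier M)"
proof -
  interpret module K M by fact
  have b: "b \<in> {..<n} \<rightarrow> carrier M" using assms by (auto simp: is_basis_def)
  have cl: "(\<Oplus>\<^bsub>M\<^esub>i\<in>{..<n}. c i \<odot>\<^bsub>M\<^esub> b i) \<in> carrier M" if "c \<in> {..<n} \<rightarrow>\<^sub>E carrier K" for c
    using that b by (intro M.finsum_closed) (auto simp: PiE_def Pi_def)
  have ex: "\<exists>!c. c \<in> {..<n} \<rightarrow>\<^sub>E carrier K \<and> v = (\<Oplus>\<^bsub>M\<^esub>i\<in>{..<n}. c i \<odot>\<^bsub>M\<^esub> b i)" if "v \<in> carrier M" for v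
    using that assms by (auto simp: is_basis_def)
  show ?thesis unfolding bij_betw_def
  proof (intro conjI inj_onI)
    fix c d assume "c \<in> {..<n} \<rightarrow>\<^sub>E carrier K" "d \<in> {..<n} \<rightarrow>\<^sub>E carrier K"
      "(\<Oplus>\<^bsub>M\<^esub>i\<in>{..<n}. c i \<odot>\<^bsub>M\<^esub> b i) = (\<Oplus>\<^bsub>M\<^esub>i\<in>{..<n}. d i \<odot>\<^bsub>M\<^esub> b i)"
    then show "c = d" using ex[OF cl[of c]] by blast
  qed (use ex cl in blast)
qed

lemma free_rank_basis:
  assumes "lie_algebra K M" shows "\<exists>b. is_basis K M (free_rank K M) b"
  unfolding free_rank_def
  by (rule LeastI_ex) (rule lie_algebra.free_of_finite_rank[OF assms])

lemma transport_free_rank: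
  assumes N: "lie_algebra K N" and inj: "inj_on h (carrier N)"
  shows "free_rank K (transport h N) = free_rank K N"
proof -
  let ?M = "transport h N" let ?g = "inv_into (carrier N) h"
  have "\<exists>b. is_basis K N n b" if "is_basis K ?M n b" for n b
  proof -
    note M = transport_lie_algebra[OF N inj]
    interpret N: lie_algebra K N by (rule N)
    interpret M: lie_algebra K ?M by (rule M)
    note tr = transport_simps[OF N inj]
    have b: "b \<in> {..<n} \<rightarrow> h ` carrier N" using that by (auto simp: is_basis_def tr)
    then have gb: "(\<lambda>i. ?g (b i)) \<in> {..<n} \<rightarrow> carrier N" by (auto simp: Pi_def inv_into_into)
    let ?l = "\<lambda>c. \<Oplus>\<^bsub>?M\<^esub>i\<in>{..<n}. c i \<odot>\<^bsub>?M\<^esub> b i"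
    let ?r = "\<lambda>c. \<Oplus>\<^bsub>N\<^esub>i\<in>{..<n}. c i \<odot>\<^bsub>N\<^esub> ?g (b i)"
    have eq: "?l c = h (?r c)" and cl: "?r c \<in> carrier N"
      if c: "c \<in> {..<n} \<rightarrow>\<^sub>E carrier K" for c
    proof -
      have cc: "(\<lambda>i. c i \<odot>\<^bsub>N\<^esub> ?g (b i)) \<in> {..<n} \<rightarrow> carrier N" using c gb by (auto simp: PiE_def Pi_def)
      have "?l c = (\<Oplus>\<^bsub>?M\<^esub>i\<in>{..<n}. h (c i \<odot>\<^bsub>N\<^esub> ?g (b i)))"
      proof (rule M.M.finsum_cong')
        fix i assume "i \<in> {..<n}"
        then have "b i \<in> h ` carrier N" using b by auto
        then have "h (?g (b i)) = b i" "?g (b i) \<in> carrier N" by (auto simp: f_inv_into_f inv_into_into)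
        then show "c i \<odot>\<^bsub>?M\<^esub> b i = h (c i \<odot>\<^bsub>N\<^esub> ?g (b i))" by (metis tr(4))
      qed (use cc in \<open>auto simp: tr\<close>)
      then show "?l c = h (?r c)" using cc by (simp add: transport_finsum[OF N inj])
      show "?r c \<in> carrier N" using cc by simp
    qed
    have "\<exists>!c. c \<in> {..<n} \<rightarrow>\<^sub>E carrier K \<and> v = ?r c" if v: "v \<in> carrier N" for v
    proof -
      have "\<exists>!c. c \<in> {..<n} \<rightarrow>\<^sub>E carrier K \<and> h v = ?l c"
        using \<open>is_basis K ?M n b\<close> v by (auto simp: is_basis_def tr)
      moreover have "h v = ?l c \<longleftrightarrow> v = ?r c" if "c \<in> {..<n} \<rightarrow>\<^sub>E carrier K" for c
        using eq[OF that] cl[OF that] v inj by (auto dest: inj_onD)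
      ultimately show ?thesis by (smt (verit))
    qed
    then have "is_basis K N n (\<lambda>i. ?g (b i))" using gb by (auto simp: is_basis_def)
    then show ?thesis by blast
  qed
  then have "(\<exists>b. is_basis K ?M n b) \<longleftrightarrow> (\<exists>b. is_basis K N n b)" for n
    using transport_basis[OF N inj] by blast
  then show ?thesis by (simp add: free_rank_def)
qed

text \<open>The lifts of \<open>L\<close> form a proper class. HOL can only collect those whose underlying set lies in
  a given type \<open>'c\<close>, but as soon as one lift does, every lift, on whatever type, is isomorphic to
  one that does, by an isomorphism inducing the identity on \<open>L\<close>.\<close>

lemma lift_transport:
  fixes M :: "('a set, 'c) lie_algebra" and N :: "('a set, 'd) lie_algebra"
  assumes "is_lift R \<pi> k L M p" and Nq: "is_lift R \<pi> k L N q"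
  shows "\<exists>(M' :: ('a set, 'c) lie_algebra) p'.
    is_lift R \<pi> k L M' p' \<and> isomorphic_lifts R \<pi> k (N, q) (M', p')"
proof -
  let ?K = "trunc_ring R \<pi> (k + 1)"
  have M: "lie_algebra ?K M" and N: "lie_algebra ?K N"
    and rk: "free_rank ?K M = free_rank ?K N" using assms by (auto simp: is_lift_def)
  obtain b b' where "is_basis ?K M (free_rank ?K M) b" "is_basis ?K N (free_rank ?K M) b'"
    using free_rank_basis[OF M] free_rank_basis[OF N] rk by auto
  then have "bij_betw (\<lambda>c. \<Oplus>\<^bsub>M\<^esub>i\<in>{..<free_rank ?K M}. c i \<odot>\<^bsub>M\<^esub> b i)
      ({..<free_rank ?K M} \<rightarrow>\<^sub>E carrier ?K) (carrier M)"
    and "bij_betw (\<lambda>c. \<Oplus>\<^bsub>N\<^esub>i\<in>{..<free_rank ?K M}. c i \<odot>\<^bsub>N\<^esub> b' i)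
      ({..<free_rank ?K M} \<rightarrow>\<^sub>E carrier ?K) (carrier N)"
    using basis_bij[OF lie_algebra.axioms(1)[OF M]] basis_bij[OF lie_algebra.axioms(1)[OF N]] by auto
  then obtain h where h: "bij_betw h (carrier N) (carrier M)"
    using bij_betw_trans[OF bij_betw_inv_into] by blast
  let ?M = "transport h N" and ?g = "inv_into (carrier N) h"
  have inj: "inj_on h (carrier N)" using h by (rule bij_betw_imp_inj_on)
  interpret N: lie_algebra ?K N by (rule N)
  note tr = transport_simps[OF N inj]
  have g: "?g (h x) = x" if "x \<in> carrier N" for x using that inj by simp
  have q: "q \<in> lie_hom ?K N (restrict_scalars (trunc_map R \<pi> k) L)" "q ` carrier N = carrier L"
    using Nq by (auto simp: is_lift_def)
  have "q \<circ> ?g \<in> lie_hom ?K ?M (restrict_scalars (trunc_map R \<pi> k) L)"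
    using q(1) by (simp add: lie_hom_def tr g Pi_def N.bracket_closed) (clarsimp simp: g)
  moreover have "(q \<circ> ?g) ` carrier ?M = carrier L"
    using q(2) by (simp add: tr g image_image)
  ultimately have "is_lift R \<pi> k L ?M (q \<circ> ?g)"
    using Nq transport_lie_algebra[OF N inj] transport_free_rank[OF N inj]
    by (simp add: is_lift_def)
  moreover have "isomorphic_lifts R \<pi> k (N, q) (?M, q \<circ> ?g)"
    using transport_iso[OF N inj] g unfolding isomorphic_lifts_def prod.case by (intro bexI[of _ h]) auto
  ultimately show ?thesis by blast
qed

end

(*
Let s and t be the classes of pi and pi^k in R_(k+1), and fix one lift M0 of L, with map p0. For every
lift (M, p), counting dimensions over the residue field shows that the kernel of M -> L/pi L is sM;
as M is free, the kernel of p is tM, and multiplication by t identifies L/pi L with it. Since M0 is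
free, M is isomorphic to M0 as a module over L, so that its bracket becomes [x, y] + t w(x, y) for an
alternating bilinear form w on L/pi L. The Jacobi identity for this bracket says that dw = 0, because
t^2 = 0. The module automorphisms of M0 over L are the maps 1 + t h with h a linear endomorphism of
L/pi L, and they change w by dh. Hence the forms w that belong to (M, p) make up one coset modulo
coboundaries, which determines the lift up to isomorphism.
*)
theory Submission
  imports Defs
begin

section \<open>Linear maps, bases and linear systems\<close>

text \<open>A lift is only asked to have the right rank and to map onto L. The exact sequence 0 -> B
  -> M -> L -> 0, where B is the reduction of L and embeds by multiplication by t, therefore has to
  be derived, and equality of ranks is what makes the dimension count work. The deformation theory
  afterwards rests on this sequence and on st = 0 and t^2 = 0. The second identity holds because 2k
  is at least k + 1, that is, because k is at least 1. This part is carried out for an abstract ring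
  K with two such elements. The reduction is a tensor product, hence a quotient of a free abelian
  group, and direct computation in it is awkward. It is reached through the surjection from L and
  through the injection \<open>\<theta>\<close> of B into M: an identity between forms is pulled
  back to arguments in M, multiplied by t, and becomes an identity between brackets of M, where the
  Lie axioms are at hand. The bijection has no canonical origin: the class of a lift measures its
  difference from the chosen one. Since the residue field may have characteristic two, alternation
  of a form is always checked on the diagonal and never deduced from antisymmetry.\<close>

definition linear_maps :: "('a, 'r) ring_scheme \<Rightarrow> ('a, 'b, 'm) module_scheme \<Rightarrow>
    ('a, 'c, 'n) module_scheme \<Rightarrow> ('b \<Rightarrow> 'c) set" where
  "linear_maps K M N = {h \<in> carrier M \<rightarrow> carrier N.
     (\<forall>x\<in>carrier M. \<forall>y\<in>carrier M. h (x \<oplus>\<^bsub>M\<^esub> y) = h x \<oplus>\<^bsub>N\<^esub> h y) \<and>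
     (\<forall>a\<in>carrier K. \<forall>x\<in>carrier M. h (a \<odot>\<^bsub>M\<^esub> x) = a \<odot>\<^bsub>N\<^esub> h x)}"

lemma linear_mapsD:
  assumes "h \<in> linear_maps K M N"
  shows "x \<in> carrier M \<Longrightarrow> h x \<in> carrier N"
    and "x \<in> carrier M \<Longrightarrow> y \<in> carrier M \<Longrightarrow> h (x \<oplus>\<^bsub>M\<^esub> y) = h x \<oplus>\<^bsub>N\<^esub> h y"
    and "a \<in> carrier K \<Longrightarrow> x \<in> carrier M \<Longrightarrow> h (a \<odot>\<^bsub>M\<^esub> x) = a \<odot>\<^bsub>N\<^esub> h x"
  using assms by (auto simp: linear_maps_def)

lemma lie_hom_iff:
  "h \<in> lie_hom K M N \<longleftrightarrow> h \<in> linear_maps K M N \<and>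
     (\<forall>x\<in>carrier M. \<forall>y\<in>carrier M. h (lie_bracket M x y) = lie_bracket N (h x) (h y))"
  by (auto simp: lie_hom_def linear_maps_def)

lemma linear_maps_inv_into:
  assumes "module K M" "h \<in> linear_maps K M N" "bij_betw h (carrier M) (carrier N)"
  shows "inv_into (carrier M) h \<in> linear_maps K N M"
proof -
  interpret module K M by fact
  have inj: "inj_on h (carrier M)" and im: "h ` carrier M = carrier N"
    using assms(3) by (auto simp: bij_betw_def)
  note h = linear_mapsD[OF assms(2)]
  have *: "inv_into (carrier M) h (h x) = x" if "x \<in> carrier M" for x
    using inj that by simp
  show ?thesis
    unfolding linear_maps_def im[symmetric]
    by (auto simp: * h(2,3)[symmetric] simp del: inv_into_f_f)
qed

lemma linear_maps_comp:
  assumes "g \<in> linear_maps K M N" "h \<in> linear_maps K N P"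
  shows "(\<lambda>x. h (g x)) \<in> linear_maps K M P"
  using assms by (auto simp: linear_maps_def Pi_def)

text \<open>Additivity alone is assumed because sums are later pushed through maps that are
  semilinear along a ring homomorphism, whose source and target are modules over different
  rings.\<close>

lemma additive_finsum:
  assumes "abelian_group M" "abelian_group N" "finite I" "f \<in> I \<rightarrow> carrier M"
    and h: "\<And>x. x \<in> carrier M \<Longrightarrow> h x \<in> carrier N"
      "\<And>x y. x \<in> carrier M \<Longrightarrow> y \<in> carrier M \<Longrightarrow> h (x \<oplus>\<^bsub>M\<^esub> y) = h x \<oplus>\<^bsub>N\<^esub> h y"
  shows "h (\<Oplus>\<^bsub>M\<^esub>i\<in>I. f i) = (\<Oplus>\<^bsub>N\<^esub>i\<in>I. h (f i))"
proof -
  interpret M: abelian_group M by fact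
  interpret N: abelian_group N by fact
  have "h \<zero>\<^bsub>M\<^esub> \<oplus>\<^bsub>N\<^esub> h \<zero>\<^bsub>M\<^esub> = h \<zero>\<^bsub>M\<^esub>" using h(2)[of "\<zero>\<^bsub>M\<^esub>" "\<zero>\<^bsub>M\<^esub>"] by simp
  then have "h \<zero>\<^bsub>M\<^esub> = \<zero>\<^bsub>N\<^esub>" using h(1) by (simp add: N.add.r_cancel_one)
  with assms(3,4) show ?thesis
    by (induction I rule: finite_induct) (auto simp: h Pi_def)
qed

lemma linear_maps_finsum:
  assumes "abelian_group M" "abelian_group N" "h \<in> linear_maps K M N" "finite I" "f \<in> I \<rightarrow> carrier M"
  shows "h (\<Oplus>\<^bsub>M\<^esub>i\<in>I. f i) = (\<Oplus>\<^bsub>N\<^esub>i\<in>I. h (f i))"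
  by (rule additive_finsum[OF assms(1,2,4,5)]) (use linear_mapsD(1,2)[OF assms(3)] in auto)

lemma linear_maps_minus:
  assumes "module K N" "g \<in> linear_maps K M N" "h \<in> linear_maps K M N"
  shows "(\<lambda>x. g x \<ominus>\<^bsub>N\<^esub> h x) \<in> linear_maps K M N"
proof -
  interpret N: module K N by fact
  show ?thesis using linear_mapsD[OF assms(2)] linear_mapsD[OF assms(3)]
    by (simp add: linear_maps_def N.M.minus_eq N.M.minus_add N.smult_r_distr N.smult_r_minus N.M.a_ac)
qed

lemma linear_maps_add:
  assumes "module K N" "g \<in> linear_maps K M N" "h \<in> linear_maps K M N"
  shows "(\<lambda>x. g x \<oplus>\<^bsub>N\<^esub> h x) \<in> linear_maps K M N"
proof -
  interpret N: module K N by fact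
  show ?thesis using linear_mapsD[OF assms(2)] linear_mapsD[OF assms(3)]
    by (simp add: linear_maps_def N.smult_r_distr N.M.a_ac)
qed

lemma linear_maps_a_inv:
  assumes "module K M" "module K N" "h \<in> linear_maps K M N" "x \<in> carrier M"
  shows "h (\<ominus>\<^bsub>M\<^esub> x) = \<ominus>\<^bsub>N\<^esub> h x"
proof -
  interpret M: module K M by fact
  interpret N: module K N by fact
  show ?thesis
    using linear_mapsD(1)[OF assms(3), of x] linear_mapsD(3)[OF assms(3), of "\<ominus>\<^bsub>K\<^esub> \<one>\<^bsub>K\<^esub>" x] assms(4)
    by (simp add: M.smult_l_minus N.smult_l_minus)
qed

section \<open>Coordinates in free modules and linear systems\<close>

lemma basis_coordinates:
  assumes M: "module K M" and b: "is_basis K M n b"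
  obtains co where "\<And>x i. x \<in> carrier M \<Longrightarrow> i < n \<Longrightarrow> co x i \<in> carrier K"
    and "\<And>x. x \<in> carrier M \<Longrightarrow> x = (\<Oplus>\<^bsub>M\<^esub>i\<in>{..<n}. co x i \<odot>\<^bsub>M\<^esub> b i)"
    and "\<And>x y i. x \<in> carrier M \<Longrightarrow> y \<in> carrier M \<Longrightarrow> i < n \<Longrightarrow> co (x \<oplus>\<^bsub>M\<^esub> y) i = co x i \<oplus>\<^bsub>K\<^esub> co y i"
    and "\<And>a x i. a \<in> carrier K \<Longrightarrow> x \<in> carrier M \<Longrightarrow> i < n \<Longrightarrow> co (a \<odot>\<^bsub>M\<^esub> x) i = a \<otimes>\<^bsub>K\<^esub> co x i"
    and "\<And>i j. i < n \<Longrightarrow> j < n \<Longrightarrow> co (b j) i = (if i = j then \<one>\<^bsub>K\<^esub> else \<zero>\<^bsub>K\<^esub>)"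
proof -
  interpret M: module K M by fact
  have bc: "b \<in> {..<n} \<rightarrow> carrier M" using b by (auto simp: is_basis_def)
  define l where "l c = (\<Oplus>\<^bsub>M\<^esub>i\<in>{..<n}. c i \<odot>\<^bsub>M\<^esub> b i)" for c
  let ?C = "{..<n} \<rightarrow>\<^sub>E carrier K"
  define co where "co v = (THE c. c \<in> ?C \<and> v = l c)" for v
  have ex1: "\<exists>!c. c \<in> ?C \<and> v = l c" if "v \<in> carrier M" for v
    using b that by (auto simp: is_basis_def l_def)
  have co: "co v \<in> ?C" "v = l (co v)" if "v \<in> carrier M" for v
    using theI'[OF ex1[OF that]] by (auto simp: co_def)
  have lcl: "l c \<in> carrier M" if "c \<in> ?C" for c
    unfolding l_def using that bc by (intro M.M.finsum_closed) (auto simp: PiE_def Pi_def)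
  \<comment> \<open>Uniqueness of expansions: any family that expands v is the coordinate family of
    v. Each property of the coordinates then follows by exhibiting a family and summing it.\<close>
  have coI: "co v = c" if "c \<in> ?C" "v = l c" for c v
    using ex1[of v] co[of v] lcl[of c] that by blast
  have cc: "co x i \<in> carrier K" if "x \<in> carrier M" "i < n" for x i
    using co(1)[OF that(1)] that by (auto simp: PiE_def Pi_def)
  have add: "co (x \<oplus>\<^bsub>M\<^esub> y) = (\<lambda>i\<in>{..<n}. co x i \<oplus>\<^bsub>K\<^esub> co y i)" if xy: "x \<in> carrier M" "y \<in> carrier M" for x y
  proof (rule coI)
    show "(\<lambda>i\<in>{..<n}. co x i \<oplus>\<^bsub>K\<^esub> co y i) \<in> ?C" using cc xy by auto
    have "l (\<lambda>i\<in>{..<n}. co x i \<oplus>\<^bsub>K\<^esub> co y i) = (\<Oplus>\<^bsub>M\<^esub>i\<in>{..<n}. co x i \<odot>\<^bsub>M\<^esub> b i \<oplus>\<^bsub>M\<^esub> co y i \<odot>\<^bsub>M\<^esub> b i)"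
      unfolding l_def using cc xy bc by (intro M.M.finsum_cong') (auto simp: M.smult_l_distr Pi_def)
    also have "\<dots> = l (co x) \<oplus>\<^bsub>M\<^esub> l (co y)"
      unfolding l_def using cc xy bc by (intro M.M.finsum_addf) (auto simp: Pi_def)
    finally show "x \<oplus>\<^bsub>M\<^esub> y = l (\<lambda>i\<in>{..<n}. co x i \<oplus>\<^bsub>K\<^esub> co y i)"
      using co(2)[OF xy(1)] co(2)[OF xy(2)] by simp
  qed
  have smult: "co (a \<odot>\<^bsub>M\<^esub> x) = (\<lambda>i\<in>{..<n}. a \<otimes>\<^bsub>K\<^esub> co x i)" if ax: "a \<in> carrier K" "x \<in> carrier M" for a x
  proof (rule coI)
    show "(\<lambda>i\<in>{..<n}. a \<otimes>\<^bsub>K\<^esub> co x i) \<in> ?C" using cc ax by auto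
    have "a \<odot>\<^bsub>M\<^esub> l (co x) = (\<Oplus>\<^bsub>M\<^esub>i\<in>{..<n}. a \<odot>\<^bsub>M\<^esub> (co x i \<odot>\<^bsub>M\<^esub> b i))"
      unfolding l_def using cc bc ax
      by (intro linear_maps_finsum[where h = "smult M a" and K = K])
        (auto simp: linear_maps_def Pi_def M.smult_r_distr M.smult_assoc1[symmetric] M.R.m_comm M.M.abelian_group_axioms)
    also have "\<dots> = l (\<lambda>i\<in>{..<n}. a \<otimes>\<^bsub>K\<^esub> co x i)"
      unfolding l_def using cc bc ax by (intro M.M.finsum_cong') (auto simp: M.smult_assoc1 Pi_def)
    finally show "a \<odot>\<^bsub>M\<^esub> x = l (\<lambda>i\<in>{..<n}. a \<otimes>\<^bsub>K\<^esub> co x i)" using co(2)[OF ax(2)] by simp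
  qed
  have basis: "co (b j) = (\<lambda>i\<in>{..<n}. if i = j then \<one>\<^bsub>K\<^esub> else \<zero>\<^bsub>K\<^esub>)" if j: "j < n" for j
  proof (rule coI)
    let ?e = "\<lambda>i\<in>{..<n}. if i = j then \<one>\<^bsub>K\<^esub> else \<zero>\<^bsub>K\<^esub>"
    show "?e \<in> ?C" by auto
    have "l ?e = (\<Oplus>\<^bsub>M\<^esub>i\<in>{..<n}. if j = i then b i else \<zero>\<^bsub>M\<^esub>)"
      unfolding l_def using bc j by (intro M.M.finsum_cong') (auto simp: Pi_def)
    then show "b j = l ?e" using bc j by (simp add: M.M.add.finprod_singleton)
  qed
  show thesis
    by (rule that[of co]) (use cc co(2) add smult basis in \<open>auto simp: l_def\<close>)
qed

text \<open>The extension sends x to the combination of the \<open>m i\<close> whose coefficients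
  are the coordinates of x. It supplies the comparison map between two lifts.\<close>

lemma linear_map_on_basis:
  assumes M: "module K M" and N: "module K N" and b: "is_basis K M n b" and m: "m \<in> {..<n} \<rightarrow> carrier N"
  shows "\<exists>h\<in>linear_maps K M N. \<forall>i<n. h (b i) = m i"
proof -
  interpret M: module K M by fact
  interpret N: module K N by fact
  have bc: "b \<in> {..<n} \<rightarrow> carrier M" using b by (auto simp: is_basis_def)
  obtain co where co: "\<And>x i. x \<in> carrier M \<Longrightarrow> i < n \<Longrightarrow> co x i \<in> carrier K"
    and "\<And>x. x \<in> carrier M \<Longrightarrow> x = (\<Oplus>\<^bsub>M\<^esub>i\<in>{..<n}. co x i \<odot>\<^bsub>M\<^esub> b i)"
    and add: "\<And>x y i. x \<in> carrier M \<Longrightarrow> y \<in> carrier M \<Longrightarrow> i < n \<Longrightarrow> co (x \<oplus>\<^bsub>M\<^esub> y) i = co x i \<oplus>\<^bsub>K\<^esub> co y i"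
    and smult: "\<And>a x i. a \<in> carrier K \<Longrightarrow> x \<in> carrier M \<Longrightarrow> i < n \<Longrightarrow> co (a \<odot>\<^bsub>M\<^esub> x) i = a \<otimes>\<^bsub>K\<^esub> co x i"
    and basis: "\<And>i j. i < n \<Longrightarrow> j < n \<Longrightarrow> co (b j) i = (if i = j then \<one>\<^bsub>K\<^esub> else \<zero>\<^bsub>K\<^esub>)"
    by (rule basis_coordinates[OF M b]) blast
  define h where "h x = (\<Oplus>\<^bsub>N\<^esub>i\<in>{..<n}. co x i \<odot>\<^bsub>N\<^esub> m i)" for x
  have t: "(\<lambda>i. co x i \<odot>\<^bsub>N\<^esub> m i) \<in> {..<n} \<rightarrow> carrier N" if "x \<in> carrier M" for x
    using co that m by (auto simp: Pi_def)
  have "h \<in> linear_maps K M N"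
    unfolding linear_maps_def
  proof (intro CollectI conjI ballI)
    show "h \<in> carrier M \<rightarrow> carrier N" using t by (simp add: h_def)
    fix x assume x: "x \<in> carrier M"
    show "h (x \<oplus>\<^bsub>M\<^esub> y) = h x \<oplus>\<^bsub>N\<^esub> h y" if y: "y \<in> carrier M" for y
    proof -
      have "h (x \<oplus>\<^bsub>M\<^esub> y) = (\<Oplus>\<^bsub>N\<^esub>i\<in>{..<n}. co x i \<odot>\<^bsub>N\<^esub> m i \<oplus>\<^bsub>N\<^esub> co y i \<odot>\<^bsub>N\<^esub> m i)"
        unfolding h_def using co add x y m by (intro N.M.finsum_cong') (auto simp: N.smult_l_distr Pi_def)
      then show ?thesis unfolding h_def using t x y by (simp add: N.M.finsum_addf)
    qed
    show "h (a \<odot>\<^bsub>M\<^esub> x) = a \<odot>\<^bsub>N\<^esub> h x" if a: "a \<in> carrier K" for a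
    proof -
      have "a \<odot>\<^bsub>N\<^esub> h x = (\<Oplus>\<^bsub>N\<^esub>i\<in>{..<n}. a \<odot>\<^bsub>N\<^esub> (co x i \<odot>\<^bsub>N\<^esub> m i))"
        unfolding h_def using t[OF x] a
        by (intro linear_maps_finsum[where h = "smult N a" and K = K])
          (auto simp: linear_maps_def N.smult_r_distr N.smult_assoc1[symmetric] M.R.m_comm N.M.abelian_group_axioms)
      also have "\<dots> = h (a \<odot>\<^bsub>M\<^esub> x)"
        unfolding h_def using co smult x a m by (intro N.M.finsum_cong') (auto simp: N.smult_assoc1 Pi_def)
      finally show ?thesis ..
    qed
  qed
  moreover have "h (b j) = m j" if j: "j < n" for j
  proof -
    have "h (b j) = (\<Oplus>\<^bsub>N\<^esub>i\<in>{..<n}. if j = i then m i else \<zero>\<^bsub>N\<^esub>)"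
      unfolding h_def using m j basis by (intro N.M.finsum_cong') (auto simp: Pi_def)
    then show ?thesis using m j by (simp add: N.M.add.finprod_singleton)
  qed
  ultimately show ?thesis by (intro bexI[of _ h]) auto
qed

lemma linear_maps_eq_on_basis:
  assumes M: "module K M" and b: "is_basis K M n b" and N: "abelian_group N"
    and g: "g \<in> linear_maps K M N" and h: "h \<in> linear_maps K M N"
    and gh: "\<And>i. i < n \<Longrightarrow> g (b i) = h (b i)" and x: "x \<in> carrier M"
  shows "g x = h x"
proof -
  interpret M: module K M by fact
  interpret N: abelian_group N by fact
  obtain c where c: "c \<in> {..<n} \<rightarrow>\<^sub>E carrier K" "x = (\<Oplus>\<^bsub>M\<^esub>i\<in>{..<n}. c i \<odot>\<^bsub>M\<^esub> b i)"
    using b x by (auto simp: is_basis_def)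
  have cb: "c i \<in> carrier K" "b i \<in> carrier M" if "i < n" for i
    using c(1) b that by (auto simp: is_basis_def PiE_def Pi_def)
  have f: "f x = (\<Oplus>\<^bsub>N\<^esub>i\<in>{..<n}. c i \<odot>\<^bsub>N\<^esub> f (b i))" if f: "f \<in> linear_maps K M N" for f
  proof -
    have "f x = (\<Oplus>\<^bsub>N\<^esub>i\<in>{..<n}. f (c i \<odot>\<^bsub>M\<^esub> b i))"
      unfolding c(2) using cb f by (intro linear_maps_finsum) (auto simp: M.M.abelian_group_axioms N)
    also have "\<dots> = (\<Oplus>\<^bsub>N\<^esub>i\<in>{..<n}. c i \<odot>\<^bsub>N\<^esub> f (b i))"
    proof (rule N.finsum_cong')
      show "(\<lambda>i. c i \<odot>\<^bsub>N\<^esub> f (b i)) \<in> {..<n} \<rightarrow> carrier N"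
        using cb by (auto simp: linear_mapsD(1)[OF f] linear_mapsD(3)[OF f, symmetric])
    qed (use cb in \<open>auto simp: linear_mapsD[OF f]\<close>)
    finally show ?thesis .
  qed
  have "(\<Oplus>\<^bsub>N\<^esub>i\<in>{..<n}. c i \<odot>\<^bsub>N\<^esub> g (b i)) = (\<Oplus>\<^bsub>N\<^esub>i\<in>{..<n}. c i \<odot>\<^bsub>N\<^esub> h (b i))"
  proof (rule N.finsum_cong')
    show "(\<lambda>i. c i \<odot>\<^bsub>N\<^esub> h (b i)) \<in> {..<n} \<rightarrow> carrier N"
      using cb by (auto simp: linear_mapsD(1)[OF h] linear_mapsD(3)[OF h, symmetric])
  qed (use gh in auto)
  then show ?thesis using f g h by simp
qed

text \<open>Divisibility by e can be tested on coefficients: the quotients \<open>d i\<close> are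
  the coefficients of the witness. It is applied with e the class of \<pi>.\<close>

lemma basis_smult_range:
  assumes M: "module K M" and b: "is_basis K M n b" and e: "e \<in> carrier K"
    and c: "\<And>i. i < n \<Longrightarrow> \<exists>d\<in>carrier K. c i = e \<otimes>\<^bsub>K\<^esub> d"
  shows "\<exists>w\<in>carrier M. (\<Oplus>\<^bsub>M\<^esub>i\<in>{..<n}. c i \<odot>\<^bsub>M\<^esub> b i) = e \<odot>\<^bsub>M\<^esub> w"
proof -
  interpret M: module K M by fact
  have bc: "b i \<in> carrier M" if "i < n" for i using b that by (auto simp: is_basis_def)
  obtain d where d: "\<And>i. i < n \<Longrightarrow> d i \<in> carrier K" "\<And>i. i < n \<Longrightarrow> c i = e \<otimes>\<^bsub>K\<^esub> d i" using c by metis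
  have "e \<odot>\<^bsub>M\<^esub> (\<Oplus>\<^bsub>M\<^esub>i\<in>{..<n}. d i \<odot>\<^bsub>M\<^esub> b i) = (\<Oplus>\<^bsub>M\<^esub>i\<in>{..<n}. e \<odot>\<^bsub>M\<^esub> (d i \<odot>\<^bsub>M\<^esub> b i))"
    using bc d(1) e
    by (intro linear_maps_finsum[where h = "smult M e" and K = K])
      (auto simp: linear_maps_def M.smult_r_distr M.smult_assoc1[symmetric] M.R.m_comm M.M.abelian_group_axioms)
  also have "\<dots> = (\<Oplus>\<^bsub>M\<^esub>i\<in>{..<n}. c i \<odot>\<^bsub>M\<^esub> b i)"
    using bc d e by (intro M.M.finsum_cong') (auto simp: M.smult_assoc1)
  finally show ?thesis using bc d(1) by (intro bexI[of _ "\<Oplus>\<^bsub>M\<^esub>i\<in>{..<n}. d i \<odot>\<^bsub>M\<^esub> b i"]) auto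
qed

text \<open>Gaussian elimination of the last equation.\<close>

lemma (in field) homogeneous_system_solution:
  assumes "finite I" "m < card I" "\<And>i l. i \<in> I \<Longrightarrow> l < m \<Longrightarrow> A i l \<in> carrier R"
  shows "\<exists>c\<in>I \<rightarrow> carrier R. (\<exists>i\<in>I. c i \<noteq> \<zero>) \<and> (\<forall>l<m. (\<Oplus>i\<in>I. c i \<otimes> A i l) = \<zero>)"
  using assms
proof (induction m arbitrary: I A)
  case 0
  then obtain i where "i \<in> I" by fastforce
  then show ?case by (intro bexI[of _ "\<lambda>_. \<one>"]) auto
next
  case (Suc m)
  note A = Suc.prems(3)
  show ?case
  proof (cases "\<forall>i\<in>I. A i m = \<zero>")
    case True
    have "\<exists>c\<in>I \<rightarrow> carrier R. (\<exists>i\<in>I. c i \<noteq> \<zero>) \<and> (\<forall>l<m. (\<Oplus>i\<in>I. c i \<otimes> A i l) = \<zero>)"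
      by (rule Suc.IH) (use Suc.prems in auto)
    then obtain c where c: "c \<in> I \<rightarrow> carrier R" "\<exists>i\<in>I. c i \<noteq> \<zero>" "\<forall>l<m. (\<Oplus>i\<in>I. c i \<otimes> A i l) = \<zero>"
      by - (erule bexE, elim conjE, rule that)
    have "(\<Oplus>i\<in>I. c i \<otimes> A i m) = (\<Oplus>i\<in>I. \<zero>)" using c(1) True by (intro add.finprod_cong') (auto simp: Pi_def)
    then show ?thesis using c by (intro bexI[of _ c] conjI) (auto simp: less_Suc_eq)
  next
    case False
    then obtain j where j: "j \<in> I" "A j m \<noteq> \<zero>" by blast
    define J where "J = I - {j}"
    have J: "finite J" "j \<notin> J" "I = insert j J" "m < card J" using Suc.prems(1,2) j by (auto simp: J_def)
    define u where "u = inv (A j m)"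
    have u: "u \<in> carrier R" "A j m \<otimes> u = \<one>" using A[OF j(1), of m] j(2) by (auto simp: u_def field_Units)
    \<comment> \<open>Adding \<open>e i\<close> times the pivot coefficients clears the coefficient
      of unknown i in the last equation.\<close>
    define e where "e i = \<ominus> (A i m \<otimes> u)" for i
    have e: "e i \<in> carrier R" if "i \<in> I" for i using A[OF that, of m] u by (simp add: e_def)
    have A': "A i l \<oplus> e i \<otimes> A j l \<in> carrier R" if "i \<in> J" "l < m" for i l
      using that A e j J by auto
    have "\<exists>c\<in>J \<rightarrow> carrier R. (\<exists>i\<in>J. c i \<noteq> \<zero>) \<and> (\<forall>l<m. (\<Oplus>i\<in>J. c i \<otimes> (A i l \<oplus> e i \<otimes> A j l)) = \<zero>)"
      by (rule Suc.IH[OF J(1,4) A'])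
    then obtain c where c: "c \<in> J \<rightarrow> carrier R" "\<exists>i\<in>J. c i \<noteq> \<zero>"
      "\<forall>l<m. (\<Oplus>i\<in>J. c i \<otimes> (A i l \<oplus> e i \<otimes> A j l)) = \<zero>"
      by - (erule bexE, elim conjE, rule that)
    have cJ: "c i \<in> carrier R" if "i \<in> J" for i using c(1) that by auto
    \<comment> \<open>The last equation, solved for the unknown j, determines its value from the
      values on J.\<close>
    define d where "d i = (if i = j then \<Oplus>i\<in>J. c i \<otimes> e i else c i)" for i
    have s: "(\<Oplus>i\<in>J. c i \<otimes> e i) \<in> carrier R" using cJ e J by (intro finsum_closed) auto
    have d: "d \<in> I \<rightarrow> carrier R" using s cJ J by (auto simp: d_def)
    have sum: "(\<Oplus>i\<in>I. d i \<otimes> A i l) = (\<Oplus>i\<in>J. c i \<otimes> (A i l \<oplus> e i \<otimes> A j l))" if l: "l < Suc m" for l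
    proof -
      have AI: "A i l \<in> carrier R" if "i \<in> I" for i using A that l by blast
      have "(\<Oplus>i\<in>I. d i \<otimes> A i l) = (\<Oplus>i\<in>J. c i \<otimes> e i) \<otimes> A j l \<oplus> (\<Oplus>i\<in>J. d i \<otimes> A i l)"
        unfolding J(3) using J AI s d by (subst add.finprod_insert) (auto simp: d_def Pi_def)
      also have "(\<Oplus>i\<in>J. d i \<otimes> A i l) = (\<Oplus>i\<in>J. c i \<otimes> A i l)"
        using J cJ AI by (intro add.finprod_cong') (auto simp: d_def)
      also have "(\<Oplus>i\<in>J. c i \<otimes> e i) \<otimes> A j l = (\<Oplus>i\<in>J. c i \<otimes> e i \<otimes> A j l)"
        using J cJ AI e by (intro finsum_ldistr) auto
      also have "(\<Oplus>i\<in>J. c i \<otimes> e i \<otimes> A j l) \<oplus> (\<Oplus>i\<in>J. c i \<otimes> A i l) = (\<Oplus>i\<in>J. c i \<otimes> e i \<otimes> A j l \<oplus> c i \<otimes> A i l)"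
        using J cJ AI e by (intro finsum_addf[symmetric]) auto
      also have "\<dots> = (\<Oplus>i\<in>J. c i \<otimes> (A i l \<oplus> e i \<otimes> A j l))"
        using J cJ AI e by (intro add.finprod_cong') (auto simp: r_distr m_assoc a_comm)
      finally show ?thesis .
    qed
    have "(\<Oplus>i\<in>J. c i \<otimes> (A i m \<oplus> e i \<otimes> A j m)) = (\<Oplus>i\<in>J. \<zero>)"
    proof (intro add.finprod_cong')
      fix i assume i: "i \<in> J"
      have Ac: "A i m \<in> carrier R" "A j m \<in> carrier R" using A i j J by auto
      have "A i m \<otimes> u \<otimes> A j m = A i m \<otimes> (A j m \<otimes> u)" using Ac u(1) by (simp add: m_ac)
      then have "e i \<otimes> A j m = \<ominus> A i m" using Ac u by (simp add: e_def l_minus)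
      then show "c i \<otimes> (A i m \<oplus> e i \<otimes> A j m) = \<zero>" using Ac cJ[OF i] by (simp add: r_neg)
    qed auto
    then have "\<forall>l<Suc m. (\<Oplus>i\<in>I. d i \<otimes> A i l) = \<zero>" using sum c(3) by (auto simp: less_Suc_eq)
    moreover have "\<exists>i\<in>I. d i \<noteq> \<zero>" using c(2) J by (auto simp: d_def)
    ultimately show ?thesis using d by (intro bexI[of _ d] conjI)
  qed
qed

section \<open>Cancellation in abelian groups and antisymmetry of brackets\<close>

lemma (in abelian_group) minus_eq_zero_iff:
  assumes "x \<in> carrier G" "y \<in> carrier G" shows "x \<ominus> y = \<zero> \<longleftrightarrow> x = y"
proof
  assume "x \<ominus> y = \<zero>"
  then have "x = \<ominus> (\<ominus> y)" using assms minus_equality[of x "\<ominus> y"] by (simp add: minus_eq)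
  then show "x = y" using assms by simp
qed (use assms in \<open>simp add: minus_eq r_neg\<close>)

text \<open>The shape in which two deformed brackets are compared: a is the undeformed bracket
  common to both sides, and n is a correction to be moved across.\<close>

lemma (in abelian_group) add_solve:
  assumes "a \<in> carrier G" "b \<in> carrier G" "c \<in> carrier G" "n \<in> carrier G"
  shows "(a \<oplus> b) \<oplus> n = a \<oplus> c \<longleftrightarrow> b = c \<ominus> n"
proof -
  have "(a \<oplus> b) \<oplus> n = a \<oplus> c \<longleftrightarrow> b \<oplus> n = c" using assms by (simp add: a_assoc)
  also have "\<dots> \<longleftrightarrow> b = c \<ominus> n"
  proof
    assume "b \<oplus> n = c" then show "b = c \<ominus> n" using assms by (auto simp: minus_eq a_assoc r_neg)
  next
    assume "b = c \<ominus> n" then show "b \<oplus> n = c" using assms by (auto simp: minus_eq a_assoc l_neg)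
  qed
  finally show ?thesis .
qed

context lie_algebra
begin

lemma bracket_zero_left [simp]: "x \<in> carrier L \<Longrightarrow> lie_bracket L \<zero>\<^bsub>L\<^esub> x = \<zero>\<^bsub>L\<^esub>"
  using bracket_smult_left[of "\<zero>\<^bsub>K\<^esub>" "\<zero>\<^bsub>L\<^esub>" x] by (simp add: bracket_closed)

lemma bracket_zero_right [simp]: "x \<in> carrier L \<Longrightarrow> lie_bracket L x \<zero>\<^bsub>L\<^esub> = \<zero>\<^bsub>L\<^esub>"
  using bracket_smult_right[of "\<zero>\<^bsub>K\<^esub>" x "\<zero>\<^bsub>L\<^esub>"] by (simp add: bracket_closed)

lemma bracket_minus_right:
  "x \<in> carrier L \<Longrightarrow> y \<in> carrier L \<Longrightarrow> lie_bracket L x (\<ominus>\<^bsub>L\<^esub> y) = \<ominus>\<^bsub>L\<^esub> lie_bracket L x y"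
  using bracket_add_right[of x "\<ominus>\<^bsub>L\<^esub> y" y] M.minus_equality by (simp add: bracket_closed M.l_neg)

lemma bracket_anti:
  assumes "x \<in> carrier L" "y \<in> carrier L"
  shows "lie_bracket L y x = \<ominus>\<^bsub>L\<^esub> lie_bracket L x y"
proof -
  have "\<zero>\<^bsub>L\<^esub> = lie_bracket L (x \<oplus>\<^bsub>L\<^esub> y) (x \<oplus>\<^bsub>L\<^esub> y)" using assms by (simp add: bracket_self)
  also have "\<dots> = (lie_bracket L x x \<oplus>\<^bsub>L\<^esub> lie_bracket L y x) \<oplus>\<^bsub>L\<^esub> (lie_bracket L x y \<oplus>\<^bsub>L\<^esub> lie_bracket L y y)"
    using assms by (simp only: bracket_add_left bracket_add_right M.a_closed)
  also have "\<dots> = lie_bracket L y x \<oplus>\<^bsub>L\<^esub> lie_bracket L x y"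
    using assms by (simp add: bracket_closed bracket_self)
  finally show ?thesis using assms M.minus_equality by (simp add: bracket_closed)
qed

lemma bracket_linear:
  "y \<in> carrier L \<Longrightarrow> (\<lambda>x. lie_bracket L x y) \<in> linear_maps K L L"
  "y \<in> carrier L \<Longrightarrow> lie_bracket L y \<in> linear_maps K L L"
  by (auto simp: linear_maps_def bracket_closed bracket_add_left bracket_add_right bracket_smult_left bracket_smult_right)

end

section \<open>Change of scalars and change of bracket\<close>

lemma restrict_scalars_simps [simp]:
  "carrier (restrict_scalars f N) = carrier N" "ring.zero (restrict_scalars f N) = ring.zero N"
  "ring.add (restrict_scalars f N) = ring.add N" "smult (restrict_scalars f N) a = smult N (f a)"
  "lie_bracket (restrict_scalars f N) = lie_bracket N"
  by (simp_all add: restrict_scalars_def)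

lemma restrict_scalars_module:
  assumes "module S N" "cring R" "f \<in> ring_hom R S"
  shows "module R (restrict_scalars f N)"
proof -
  interpret N: module S N by fact
  have "abelian_group (restrict_scalars f N)"
  proof (rule abelian_groupI)
    show "\<exists>y\<in>carrier (restrict_scalars f N). y \<oplus>\<^bsub>restrict_scalars f N\<^esub> x = \<zero>\<^bsub>restrict_scalars f N\<^esub>"
      if "x \<in> carrier (restrict_scalars f N)" for x
      using that by (intro bexI[of _ "\<ominus>\<^bsub>N\<^esub> x"]) (auto simp: N.M.l_neg)
  qed (auto simp: N.M.a_ac)
  then show ?thesis
    using assms(2) ring_hom_closed[OF assms(3)] ring_hom_add[OF assms(3)] ring_hom_mult[OF assms(3)] ring_hom_one[OF assms(3)]
    by (intro moduleI) (auto simp: N.smult_l_distr N.smult_r_distr N.smult_assoc1)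
qed

lemma module_bracket_update:
  fixes N :: "('a, 'c) lie_algebra"
  assumes "module K N"
  shows "module K (N\<lparr>lie_bracket := b\<rparr>)"
  using assms by (simp add: module_def abelian_group_def abelian_monoid_def abelian_group_axioms_def module_axioms_def)

text \<open>A basis involves only addition and scalars, so a deformation of the bracket keeps
  freeness and rank.\<close>

lemma is_basis_bracket_update:
  fixes N :: "('a, 'c) lie_algebra"
  shows "is_basis K (N\<lparr>lie_bracket := b\<rparr>) = is_basis K N"
  by (simp add: is_basis_def fun_eq_iff finsum_def)

section \<open>Forms of low degree\<close>

lemma tuples_iff:
  "xs \<in> tuples B 0 \<longleftrightarrow> xs = []"
  "xs \<in> tuples B (Suc s) \<longleftrightarrow> (\<exists>u us. xs = u # us \<and> u \<in> carrier B \<and> us \<in> tuples B s)"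
  by (auto simp: tuples_def length_Suc_conv)

lemma ball_tuples:
  "(\<forall>xs\<in>tuples B 0. P xs) \<longleftrightarrow> P []"
  "(\<forall>xs\<in>tuples B (Suc s). P xs) \<longleftrightarrow> (\<forall>u\<in>carrier B. \<forall>us\<in>tuples B s. P (u # us))"
  by (auto simp: tuples_iff)

lemma tuples_ConsI: "[] \<in> tuples B 0"
  "u \<in> carrier B \<Longrightarrow> us \<in> tuples B s \<Longrightarrow> u # us \<in> tuples B (Suc s)"
  by (auto simp: tuples_iff)

lemma tuples3: "xs \<in> tuples B 3 \<longleftrightarrow> (\<exists>u v w. xs = [u, v, w] \<and> u \<in> carrier B \<and> v \<in> carrier B \<and> w \<in> carrier B)"
  by (auto simp: tuples_iff numeral_3_eq_3)

text \<open>Restricted to tuples because elements of \<open>cochains\<close> are extensional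
  functions; equality of forms can then be checked on values.\<close>

definition form1 :: "('a, 'b, 'm) module_scheme \<Rightarrow> ('b \<Rightarrow> 'b) \<Rightarrow> 'b list \<Rightarrow> 'b" where
  "form1 B h = (\<lambda>xs\<in>tuples B 1. h (xs ! 0))"

definition form2 :: "('a, 'b, 'm) module_scheme \<Rightarrow> ('b \<Rightarrow> 'b \<Rightarrow> 'b) \<Rightarrow> 'b list \<Rightarrow> 'b" where
  "form2 B h = (\<lambda>xs\<in>tuples B 2. h (xs ! 0) (xs ! 1))"

lemma form1_apply: "u \<in> carrier B \<Longrightarrow> form1 B h [u] = h u"
  by (simp add: form1_def tuples_ConsI)

lemma form2_apply: "u \<in> carrier B \<Longrightarrow> v \<in> carrier B \<Longrightarrow> form2 B h [u, v] = h u v"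
  by (simp add: form2_def tuples_ConsI numeral_2_eq_2)

lemma cochains1_iff:
  "\<omega> \<in> carrier (cochains F B 1) \<longleftrightarrow> \<omega> \<in> tuples B 1 \<rightarrow>\<^sub>E carrier B \<and> (\<lambda>u. \<omega> [u]) \<in> linear_maps F B B"
proof -
  have "alternating B (Suc 0) \<omega>" by (auto simp: alternating_def)
  moreover have "multilinear F B (Suc 0) \<omega> \<longleftrightarrow> (\<forall>u\<in>carrier B.
      (\<forall>v\<in>carrier B. \<omega> [u \<oplus>\<^bsub>B\<^esub> v] = \<omega> [u] \<oplus>\<^bsub>B\<^esub> \<omega> [v]) \<and> (\<forall>a\<in>carrier F. \<omega> [a \<odot>\<^bsub>B\<^esub> u] = a \<odot>\<^bsub>B\<^esub> \<omega> [u]))"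
    by (auto simp: multilinear_def ball_tuples)
  ultimately show ?thesis by (auto simp: cochains_def linear_maps_def tuples_iff)
qed

text \<open>With two slots the only pair of positions is (0, 1), so alternation is vanishing on the
  diagonal, and multilinearity is linearity in each slot. The difference of two brackets has exactly
  these properties.\<close>

lemma cochains2_iff:
  "\<omega> \<in> carrier (cochains F B 2) \<longleftrightarrow> \<omega> \<in> tuples B 2 \<rightarrow>\<^sub>E carrier B \<and>
     (\<forall>v\<in>carrier B. (\<lambda>u. \<omega> [u, v]) \<in> linear_maps F B B \<and> (\<lambda>u. \<omega> [v, u]) \<in> linear_maps F B B
        \<and> \<omega> [v, v] = \<zero>\<^bsub>B\<^esub>)"
proof -
  have ex: "(\<exists>i j. i < j \<and> j < Suc (Suc 0) \<and> P i j) \<longleftrightarrow> P 0 1" for P :: "nat \<Rightarrow> nat \<Rightarrow> bool"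
    by (auto simp: less_Suc_eq)
  have "alternating B (Suc (Suc 0)) \<omega> \<longleftrightarrow> (\<forall>v\<in>carrier B. \<omega> [v, v] = \<zero>\<^bsub>B\<^esub>)"
    unfolding alternating_def ex by (auto simp: tuples_iff)
  moreover have "multilinear F B (Suc (Suc 0)) \<omega> \<longleftrightarrow> (\<forall>w\<in>carrier B. \<forall>u\<in>carrier B.
      (\<forall>v\<in>carrier B. \<omega> [u \<oplus>\<^bsub>B\<^esub> v, w] = \<omega> [u, w] \<oplus>\<^bsub>B\<^esub> \<omega> [v, w] \<and> \<omega> [w, u \<oplus>\<^bsub>B\<^esub> v] = \<omega> [w, u] \<oplus>\<^bsub>B\<^esub> \<omega> [w, v]) \<and>
      (\<forall>a\<in>carrier F. \<omega> [a \<odot>\<^bsub>B\<^esub> u, w] = a \<odot>\<^bsub>B\<^esub> \<omega> [u, w] \<and> \<omega> [w, a \<odot>\<^bsub>B\<^esub> u] = a \<odot>\<^bsub>B\<^esub> \<omega> [w, u]))"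
    by (simp add: multilinear_def ball_tuples less_Suc_eq all_conj_distrib) blast
  ultimately show ?thesis
    by (auto simp: cochains_def linear_maps_def tuples_iff numeral_2_eq_2)
qed

lemma cochain2_cong:
  assumes "\<omega> \<in> carrier (cochains F B 2)" "\<eta> \<in> carrier (cochains F B 2)"
    "\<And>u v. u \<in> carrier B \<Longrightarrow> v \<in> carrier B \<Longrightarrow> \<omega> [u, v] = \<eta> [u, v]"
  shows "\<omega> = \<eta>"
proof (rule PiE_ext)
  show "\<omega> \<in> tuples B 2 \<rightarrow>\<^sub>E carrier B" "\<eta> \<in> tuples B 2 \<rightarrow>\<^sub>E carrier B" using assms unfolding cochains2_iff by blast+
qed (use assms(3) in \<open>auto simp: tuples_iff numeral_2_eq_2\<close>)

lemma form1_cochain: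
  assumes "module F B" "h \<in> linear_maps F B B" shows "form1 B h \<in> carrier (cochains F B 1)"
proof -
  interpret module F B by fact
  have "(\<lambda>u. form1 B h [u]) \<in> linear_maps F B B"
    using assms(2) by (simp add: linear_maps_def form1_apply Pi_def)
  moreover have "form1 B h \<in> tuples B 1 \<rightarrow>\<^sub>E carrier B"
    using linear_mapsD(1)[OF assms(2)] by (auto simp: form1_def tuples_iff)
  ultimately show ?thesis by (simp only: cochains1_iff)
qed

lemma form2_cochain:
  assumes "module F B" "\<And>v. v \<in> carrier B \<Longrightarrow> (\<lambda>u. h u v) \<in> linear_maps F B B"
     "\<And>v. v \<in> carrier B \<Longrightarrow> (\<lambda>u. h v u) \<in> linear_maps F B B" "\<And>v. v \<in> carrier B \<Longrightarrow> h v v = \<zero>\<^bsub>B\<^esub>"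
   shows "form2 B h \<in> carrier (cochains F B 2)"
proof -
  interpret module F B by fact
  have "(\<lambda>u. form2 B h [u, v]) \<in> linear_maps F B B" "(\<lambda>u. form2 B h [v, u]) \<in> linear_maps F B B"
    if v: "v \<in> carrier B" for v
    using assms(2,3)[OF v] v by (simp_all add: linear_maps_def form2_apply Pi_def)
  moreover have "form2 B h \<in> tuples B 2 \<rightarrow>\<^sub>E carrier B"
    using linear_mapsD(1)[OF assms(2)] by (auto simp: form2_def tuples_iff numeral_2_eq_2)
  ultimately show ?thesis using assms(4) by (simp add: cochains2_iff form2_apply)
qed

section \<open>The differential in degrees one and two\<close>

context
  fixes B :: "('f, 'd) lie_algebra" (structure)
  assumes B: "abelian_group B"
    and br: "\<And>u v. u \<in> carrier B \<Longrightarrow> v \<in> carrier B \<Longrightarrow> lie_bracket B u v \<in> carrier B"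
begin

interpretation B: abelian_group B by (rule B)

lemma differential1:
  assumes "\<omega> \<in> tuples B 1 \<rightarrow> carrier B" "u \<in> carrier B" "v \<in> carrier B"
  shows "differential B 1 \<omega> [u, v] =
    lie_bracket B u (\<omega> [v]) \<oplus> \<ominus> lie_bracket B v (\<omega> [u]) \<oplus> \<ominus> \<omega> [lie_bracket B u v]"
proof -
  have w: "\<omega> [u] \<in> carrier B" if "u \<in> carrier B" for u
    using assms(1) that by (auto simp: tuples_iff)
  show ?thesis
    using assms(2,3) 
    by (simp add: differential_def tuples_ConsI neg_one_pow_def remove_nth_def B.finsum_Suc B.finsum_0
         atMost_Suc lessThan_Suc w br B.a_ac)
qed

lemma differential2:
  assumes "\<omega> \<in> tuples B 2 \<rightarrow> carrier B" "u \<in> carrier B" "v \<in> carrier B" "x \<in> carrier B"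
  shows "differential B 2 \<omega> [u, v, x] =
    (lie_bracket B u (\<omega> [v, x]) \<oplus> \<ominus> lie_bracket B v (\<omega> [u, x]) \<oplus> lie_bracket B x (\<omega> [u, v])) \<oplus>
    (\<ominus> \<omega> [lie_bracket B u v, x] \<oplus> \<omega> [lie_bracket B u x, v] \<oplus> \<ominus> \<omega> [lie_bracket B v x, u])"
proof -
  have w: "\<omega> [u, v] \<in> carrier B" if "u \<in> carrier B" "v \<in> carrier B" for u v
    using assms(1) that by (auto simp: tuples_iff numeral_2_eq_2)
  show ?thesis
    using assms(2-) unfolding numeral_2_eq_2
    by (simp add: differential_def tuples_ConsI neg_one_pow_def remove_nth_def B.finsum_Suc B.finsum_0
         atMost_Suc lessThan_Suc w br B.a_ac)
qed

end

section \<open>Deformations of a Lie bracket\<close>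

text \<open>As \<open>f\<close> is constant on each class, the union of its values over a class is
  the common value. For a set-valued \<open>f\<close> this describes the induced map on classes
  without choosing representatives; in the application the values are cosets of forms.\<close>

lemma bij_betw_quotient_image:
  fixes f :: "'x \<Rightarrow> 'y set"
  assumes "E = {(x, y). x \<in> A \<and> y \<in> A \<and> f x = f y}"
  shows "bij_betw (\<lambda>C. \<Union>(f ` C)) (A // E) (f ` A)"
proof -
  have "E `` {x} = {y \<in> A. f y = f x}" if "x \<in> A" for x using that assms by auto
  then have U: "\<Union>(f ` (E `` {x})) = f x" and E: "E `` {x} = {y \<in> A. f y = f x}" if "x \<in> A" for x
    using that by auto
  show ?thesis unfolding bij_betw_def
  proof
    show "inj_on (\<lambda>C. \<Union>(f ` C)) (A // E)"
    proof (rule inj_onI)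
      fix C D assume "C \<in> A // E" "D \<in> A // E" and eq: "\<Union>(f ` C) = \<Union>(f ` D)"
      then obtain x y where xy: "x \<in> A" "C = E `` {x}" "y \<in> A" "D = E `` {y}" by (auto elim!: quotientE)
      then have "f x = f y" using eq U by metis
      then show "C = D" using xy by (simp add: E)
    qed
    show "(\<lambda>C. \<Union>(f ` C)) ` (A // E) = f ` A"
    proof (intro equalityI subsetI)
      fix v assume "v \<in> (\<lambda>C. \<Union>(f ` C)) ` (A // E)"
      then obtain x where "x \<in> A" "v = \<Union>(f ` (E `` {x}))" by (auto elim!: quotientE)
      then show "v \<in> f ` A" using U by blast
    next
      fix v assume "v \<in> f ` A"
      then obtain x where x: "x \<in> A" "v = f x" by blast
      then have "v = \<Union>(f ` (E `` {x}))" using U by simp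
      then show "v \<in> (\<lambda>C. \<Union>(f ` C)) ` (A // E)" using x quotientI by (intro image_eqI) auto
    qed
  qed
qed

text \<open>In the application \<open>K\<close> is the ring over which the lifts live, \<open>s\<close> and \<open>t\<close> are the classes of \<open>\<pi>\<close> and
  \<open>\<pi>\<^sup>k\<close> in it, and \<open>B\<close> is the reduction of \<open>L\<close> over the residue field \<open>F\<close>, with \<open>r\<close> the reduction map.\<close>

locale lifting_problem =
  fixes K :: "('k, 'm) ring_scheme" and F :: "'f ring" and \<rho> :: "'k \<Rightarrow> 'f"
    and L :: "('k, 'b) lie_algebra" and B :: "('f, 'd) lie_algebra" and r :: "'b \<Rightarrow> 'd"
    and s t :: 'k
  assumes K: "cring K" and F: "cring F" and L: "module K L" and B: "module F B"
    and s: "s \<in> carrier K" and t: "t \<in> carrier K"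
    and st: "s \<otimes>\<^bsub>K\<^esub> t = \<zero>\<^bsub>K\<^esub>" and tt: "t \<otimes>\<^bsub>K\<^esub> t = \<zero>\<^bsub>K\<^esub>"
    and \<rho>: "\<rho> ` carrier K = carrier F"
    and r: "r ` carrier L = carrier B"
    and r_add: "\<And>x y. x \<in> carrier L \<Longrightarrow> y \<in> carrier L \<Longrightarrow> r (x \<oplus>\<^bsub>L\<^esub> y) = r x \<oplus>\<^bsub>B\<^esub> r y"
    and r_smult: "\<And>a x. a \<in> carrier K \<Longrightarrow> x \<in> carrier L \<Longrightarrow> r (a \<odot>\<^bsub>L\<^esub> x) = \<rho> a \<odot>\<^bsub>B\<^esub> r x"
    and r_bracket: "\<And>x y. x \<in> carrier L \<Longrightarrow> y \<in> carrier L \<Longrightarrow> r (lie_bracket L x y) = lie_bracket B (r x) (r y)"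
begin

text \<open>The three equivalences say that the sequence 0 -> B -> M -> L -> 0 is exact, where B ->
  M is induced by multiplication by t, and that the kernel of M -> B is sM. Ranks are not mentioned:
  they serve only to obtain these conditions from \<open>is_lift\<close>.\<close>

definition is_exact_lift :: "('k, 'c) lie_algebra \<Rightarrow> ('c \<Rightarrow> 'b) \<Rightarrow> bool" where
  "is_exact_lift M p \<longleftrightarrow> lie_algebra K M \<and> p \<in> lie_hom K M L \<and> p ` carrier M = carrier L \<and>
     (\<forall>x\<in>carrier M. (p x = \<zero>\<^bsub>L\<^esub> \<longleftrightarrow> (\<exists>w\<in>carrier M. x = t \<odot>\<^bsub>M\<^esub> w)) \<and>
       (r (p x) = \<zero>\<^bsub>B\<^esub> \<longleftrightarrow> (\<exists>w\<in>carrier M. x = s \<odot>\<^bsub>M\<^esub> w)) \<and>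
       (t \<odot>\<^bsub>M\<^esub> x = \<zero>\<^bsub>M\<^esub> \<longleftrightarrow> r (p x) = \<zero>\<^bsub>B\<^esub>))"

end

section \<open>The extension of L by its reduction that belongs to a lift\<close>

locale exact_lift = lifting_problem K F \<rho> L B r s t
  for K :: "('k, 'm) ring_scheme" and F :: "'f ring" and \<rho> :: "'k \<Rightarrow> 'f"
    and L :: "('k, 'b) lie_algebra" and B :: "('f, 'd) lie_algebra" and r :: "'b \<Rightarrow> 'd"
    and s t :: 'k +
  fixes M :: "('k, 'c) lie_algebra" and p :: "'c \<Rightarrow> 'b"
  assumes exact: "is_exact_lift M p"
begin

sublocale M: lie_algebra K M using exact by (simp add: is_exact_lift_def)
sublocale L: module K L by (rule L)
sublocale B: module F B by (rule B)

definition q where "q x = r (p x)"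

lemma p: "p \<in> linear_maps K M L" "p ` carrier M = carrier L"
  and p_bracket: "x \<in> carrier M \<Longrightarrow> y \<in> carrier M \<Longrightarrow> p (lie_bracket M x y) = lie_bracket L (p x) (p y)"
  using exact by (auto simp: is_exact_lift_def lie_hom_iff)

lemmas p_closed [simp] = linear_mapsD(1)[OF p(1)]
lemmas p_add = linear_mapsD(2)[OF p(1)]
lemmas p_smult = linear_mapsD(3)[OF p(1)]

lemma q_closed [simp]: "x \<in> carrier M \<Longrightarrow> q x \<in> carrier B"
  using r p_closed by (auto simp: q_def)

lemma q_add: "x \<in> carrier M \<Longrightarrow> y \<in> carrier M \<Longrightarrow> q (x \<oplus>\<^bsub>M\<^esub> y) = q x \<oplus>\<^bsub>B\<^esub> q y"
  by (simp add: q_def p_add r_add)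

lemma q_smult: "a \<in> carrier K \<Longrightarrow> x \<in> carrier M \<Longrightarrow> q (a \<odot>\<^bsub>M\<^esub> x) = \<rho> a \<odot>\<^bsub>B\<^esub> q x"
  by (simp add: q_def p_smult r_smult)

lemma q_bracket: "x \<in> carrier M \<Longrightarrow> y \<in> carrier M \<Longrightarrow> q (lie_bracket M x y) = lie_bracket B (q x) (q y)"
  by (simp add: q_def p_bracket r_bracket)

lemma q_surj: "q ` carrier M = carrier B"
  unfolding r[symmetric] p(2)[symmetric] by (simp add: q_def image_image)

lemma q_obtain: assumes "u \<in> carrier B" obtains x where "x \<in> carrier M" "u = q x"
  using assms q_surj by blast

lemma \<rho>_obtain: assumes "u \<in> carrier F" obtains a where "a \<in> carrier K" "u = \<rho> a"
  using assms \<rho> by blast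

sublocale P: abelian_group_hom M L p
proof (rule abelian_group_homI)
  show "group_hom (add_monoid M) (add_monoid L) p"
    using M.M.a_group L.M.a_group by (simp add: group_hom_def group_hom_axioms_def hom_def p_add)
qed (rule M.M.abelian_group_axioms L.M.abelian_group_axioms)+

sublocale Q: abelian_group_hom M B q
proof (rule abelian_group_homI)
  show "group_hom (add_monoid M) (add_monoid B) q"
    using M.M.a_group B.M.a_group by (simp add: group_hom_def group_hom_axioms_def hom_def q_add)
qed (rule M.M.abelian_group_axioms B.M.abelian_group_axioms)+

lemma B_bracket_closed: "u \<in> carrier B \<Longrightarrow> v \<in> carrier B \<Longrightarrow> lie_bracket B u v \<in> carrier B"
  by (elim q_obtain) (simp add: M.bracket_closed flip: q_bracket)

lemma st_smult [simp]: "x \<in> carrier M \<Longrightarrow> s \<odot>\<^bsub>M\<^esub> (t \<odot>\<^bsub>M\<^esub> x) = \<zero>\<^bsub>M\<^esub>" "x \<in> carrier M \<Longrightarrow> t \<odot>\<^bsub>M\<^esub> (s \<odot>\<^bsub>M\<^esub> x) = \<zero>\<^bsub>M\<^esub>"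
  "x \<in> carrier M \<Longrightarrow> t \<odot>\<^bsub>M\<^esub> (t \<odot>\<^bsub>M\<^esub> x) = \<zero>\<^bsub>M\<^esub>"
proof -
  have "t \<otimes>\<^bsub>K\<^esub> s = \<zero>\<^bsub>K\<^esub>" using M.R.m_comm[OF s t] st by simp
  then show "x \<in> carrier M \<Longrightarrow> s \<odot>\<^bsub>M\<^esub> (t \<odot>\<^bsub>M\<^esub> x) = \<zero>\<^bsub>M\<^esub>" "x \<in> carrier M \<Longrightarrow> t \<odot>\<^bsub>M\<^esub> (s \<odot>\<^bsub>M\<^esub> x) = \<zero>\<^bsub>M\<^esub>"
    "x \<in> carrier M \<Longrightarrow> t \<odot>\<^bsub>M\<^esub> (t \<odot>\<^bsub>M\<^esub> x) = \<zero>\<^bsub>M\<^esub>"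
    using s t st tt by (simp_all flip: M.smult_assoc1)
qed

lemma M_diff: "x \<in> carrier M \<Longrightarrow> y \<in> carrier M \<Longrightarrow> x = y \<oplus>\<^bsub>M\<^esub> (x \<ominus>\<^bsub>M\<^esub> y)"
  by (simp add: M.M.minus_eq M.M.a_lcomm M.M.r_neg)

lemma t_eq_iff: 
  assumes "x \<in> carrier M" "y \<in> carrier M"
  shows "t \<odot>\<^bsub>M\<^esub> x = t \<odot>\<^bsub>M\<^esub> y \<longleftrightarrow> q x = q y"
proof -
  have "t \<odot>\<^bsub>M\<^esub> x = t \<odot>\<^bsub>M\<^esub> y \<longleftrightarrow> t \<odot>\<^bsub>M\<^esub> (x \<ominus>\<^bsub>M\<^esub> y) = \<zero>\<^bsub>M\<^esub>"
    using assms t M.M.minus_eq_zero_iff[of "t \<odot>\<^bsub>M\<^esub> x" "t \<odot>\<^bsub>M\<^esub> y"]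
    by (simp add: M.M.minus_eq M.smult_r_distr M.smult_r_minus)
  also have "\<dots> \<longleftrightarrow> q (x \<ominus>\<^bsub>M\<^esub> y) = \<zero>\<^bsub>B\<^esub>"
    using assms exact by (simp add: is_exact_lift_def q_def)
  also have "\<dots> \<longleftrightarrow> q x = q y"
    using assms B.M.minus_eq_zero_iff[of "q x" "q y"] by (simp add: M.M.minus_eq B.M.minus_eq q_add)
  finally show ?thesis .
qed

lemma q_zero_obtain:
  assumes "x \<in> carrier M" "q x = \<zero>\<^bsub>B\<^esub>" obtains w where "w \<in> carrier M" "x = s \<odot>\<^bsub>M\<^esub> w"
  using assms exact by (auto simp: is_exact_lift_def q_def)

lemma p_zero_obtain:
  assumes "x \<in> carrier M" "p x = \<zero>\<^bsub>L\<^esub>" obtains w where "w \<in> carrier M" "x = t \<odot>\<^bsub>M\<^esub> w"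
  using assms exact by (auto simp: is_exact_lift_def q_def)

text \<open>The injection B -> M of the exact sequence: u goes to t x for any x that reduces to u.
  By \<open>t_eq_iff\<close> the choice of x is immaterial.\<close>

definition \<theta> where "\<theta> u = t \<odot>\<^bsub>M\<^esub> (SOME x. x \<in> carrier M \<and> q x = u)"

lemma \<theta>_q: assumes "x \<in> carrier M" shows "\<theta> (q x) = t \<odot>\<^bsub>M\<^esub> x"
proof -
  let ?y = "SOME y. y \<in> carrier M \<and> q y = q x"
  have "?y \<in> carrier M \<and> q ?y = q x" by (rule someI[of "\<lambda>y. y \<in> carrier M \<and> q y = q x" x]) (simp add: assms)
  then show ?thesis using assms by (simp add: \<theta>_def t_eq_iff)
qed

lemma \<theta>_closed [simp]: "u \<in> carrier B \<Longrightarrow> \<theta> u \<in> carrier M"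
  by (elim q_obtain) (simp add: \<theta>_q t)

lemma \<theta>_inj: "u \<in> carrier B \<Longrightarrow> v \<in> carrier B \<Longrightarrow> \<theta> u = \<theta> v \<longleftrightarrow> u = v"
  by (elim q_obtain) (simp add: \<theta>_q t_eq_iff)

lemma \<theta>_add: "u \<in> carrier B \<Longrightarrow> v \<in> carrier B \<Longrightarrow> \<theta> (u \<oplus>\<^bsub>B\<^esub> v) = \<theta> u \<oplus>\<^bsub>M\<^esub> \<theta> v"
  by (elim q_obtain) (simp add: \<theta>_q M.smult_r_distr t flip: q_add)

lemma \<theta>_smult: "a \<in> carrier K \<Longrightarrow> u \<in> carrier B \<Longrightarrow> \<theta> (\<rho> a \<odot>\<^bsub>B\<^esub> u) = a \<odot>\<^bsub>M\<^esub> \<theta> u"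
  by (elim q_obtain) (simp add: \<theta>_q t M.R.m_comm flip: q_smult M.smult_assoc1)

lemma \<theta>_zero [simp]: "\<theta> \<zero>\<^bsub>B\<^esub> = \<zero>\<^bsub>M\<^esub>"
  using \<theta>_q[of "\<zero>\<^bsub>M\<^esub>"] t by simp

lemma \<theta>_minus: "u \<in> carrier B \<Longrightarrow> \<theta> (\<ominus>\<^bsub>B\<^esub> u) = \<ominus>\<^bsub>M\<^esub> \<theta> u"
  by (elim q_obtain) (simp add: \<theta>_q M.smult_r_minus t flip: Q.hom_a_inv)

lemma p_\<theta> [simp]: "u \<in> carrier B \<Longrightarrow> p (\<theta> u) = \<zero>\<^bsub>L\<^esub>"
  using exact t by (elim q_obtain) (auto simp: is_exact_lift_def \<theta>_q)

lemma q_\<theta> [simp]: "u \<in> carrier B \<Longrightarrow> q (\<theta> u) = \<zero>\<^bsub>B\<^esub>"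
  using p_\<theta>[of u] Q.hom_zero P.hom_zero by (simp add: q_def)

lemma \<theta>_obtain:
  assumes "x \<in> carrier M" "p x = \<zero>\<^bsub>L\<^esub>" obtains u where "u \<in> carrier B" "x = \<theta> u"
proof -
  obtain w where "w \<in> carrier M" "x = t \<odot>\<^bsub>M\<^esub> w" by (rule p_zero_obtain[OF assms])
  then show ?thesis using that[of "q w"] by (simp add: \<theta>_q)
qed

text \<open>Since [x, t y] = t [x, y], the algebra M acts on the kernel of \<open>p\<close> through
  B, and this action is the adjoint one. Here the adjoint coefficients of the cohomology
  originate.\<close>

lemma bracket_\<theta>_right: "x \<in> carrier M \<Longrightarrow> u \<in> carrier B \<Longrightarrow> lie_bracket M x (\<theta> u) = \<theta> (lie_bracket B (q x) u)"
  by (elim q_obtain) (simp add: \<theta>_q t M.bracket_smult_right M.bracket_closed flip: q_bracket)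

lemma B_bracket_zero [simp]: "u \<in> carrier B \<Longrightarrow> lie_bracket B \<zero>\<^bsub>B\<^esub> u = \<zero>\<^bsub>B\<^esub>"
  by (elim q_obtain) (simp flip: Q.hom_zero q_bracket)

text \<open>\<open>q\<close> kills the image of \<open>\<theta>\<close>. This is t^2 = 0 expressed
  by brackets, and it removes all terms that are quadratic in the correction forms.\<close>

lemma bracket_\<theta>_\<theta>: "u \<in> carrier B \<Longrightarrow> v \<in> carrier B \<Longrightarrow> lie_bracket M (\<theta> u) (\<theta> v) = \<zero>\<^bsub>M\<^esub>"
  by (simp add: bracket_\<theta>_right)

section \<open>Descent along the reduction map\<close>

lemma s_\<theta>: "u \<in> carrier B \<Longrightarrow> s \<odot>\<^bsub>M\<^esub> \<theta> u = \<zero>\<^bsub>M\<^esub>"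
  using s t by (auto elim!: q_obtain simp: \<theta>_q)

text \<open>A linear map into the kernel of \<open>p\<close> kills \<open>sM\<close>, as \<open>s\<close> annihilates that kernel, and so
  descends along \<open>q\<close>.\<close>

lemma descend:
  assumes D: "D \<in> linear_maps K M M" and pD: "\<And>x. x \<in> carrier M \<Longrightarrow> p (D x) = \<zero>\<^bsub>L\<^esub>"
    and x: "x \<in> carrier M" and y: "y \<in> carrier M" and xy: "q x = q y"
  shows "D x = D y"
proof -
  have "q (x \<ominus>\<^bsub>M\<^esub> y) = \<zero>\<^bsub>B\<^esub>" using x y xy by (simp add: M.M.minus_eq q_add B.M.r_neg)
  then obtain w where w: "w \<in> carrier M" "x \<ominus>\<^bsub>M\<^esub> y = s \<odot>\<^bsub>M\<^esub> w" using q_zero_obtain x y M.M.minus_closed by metis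
  obtain u where "u \<in> carrier B" "D w = \<theta> u" using \<theta>_obtain[of "D w"] pD w linear_mapsD(1)[OF D] by auto
  then have "D (s \<odot>\<^bsub>M\<^esub> w) = \<zero>\<^bsub>M\<^esub>" using linear_mapsD(3)[OF D s w(1)] by (simp add: s_\<theta>)
  moreover have "D x = D y \<oplus>\<^bsub>M\<^esub> D (x \<ominus>\<^bsub>M\<^esub> y)"
    using linear_mapsD(2)[OF D, of y "x \<ominus>\<^bsub>M\<^esub> y"] M_diff[OF x y] x y by simp
  ultimately show ?thesis using w x y linear_mapsD(1)[OF D] by simp
qed

lemma linear_maps_BI:
  assumes "\<And>x. x \<in> carrier M \<Longrightarrow> h (q x) \<in> carrier B"
   "\<And>x y. x \<in> carrier M \<Longrightarrow> y \<in> carrier M \<Longrightarrow> h (q x \<oplus>\<^bsub>B\<^esub> q y) = h (q x) \<oplus>\<^bsub>B\<^esub> h (q y)"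
   "\<And>a x. a \<in> carrier K \<Longrightarrow> x \<in> carrier M \<Longrightarrow> h (\<rho> a \<odot>\<^bsub>B\<^esub> q x) = \<rho> a \<odot>\<^bsub>B\<^esub> h (q x)"
  shows "h \<in> linear_maps F B B"
  using assms by (auto simp: linear_maps_def elim!: q_obtain \<rho>_obtain)

text \<open>\<open>\<theta>\<close> is injective and semilinear along \<open>\<rho>\<close>, so an
  equation for \<open>\<eta>\<close> may be checked after applying it. As \<open>q\<close> and
  \<open>\<rho>\<close> are surjective, all vectors and scalars of B are reached from M and
  K.\<close>

lemma descend_linear:
  assumes D: "D \<in> linear_maps K M M" and \<eta>: "\<And>x. x \<in> carrier M \<Longrightarrow> \<eta> (q x) \<in> carrier B \<and> D x = \<theta> (\<eta> (q x))"
  shows "\<eta> \<in> linear_maps F B B"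
proof (rule linear_maps_BI)
  note D = linear_mapsD[OF D]
  show "\<eta> (q x) \<in> carrier B" if "x \<in> carrier M" for x using \<eta> that by blast
  show "\<eta> (q x \<oplus>\<^bsub>B\<^esub> q y) = \<eta> (q x) \<oplus>\<^bsub>B\<^esub> \<eta> (q y)" if "x \<in> carrier M" "y \<in> carrier M" for x y
  proof -
    have "\<theta> (\<eta> (q (x \<oplus>\<^bsub>M\<^esub> y))) = \<theta> (\<eta> (q x) \<oplus>\<^bsub>B\<^esub> \<eta> (q y))"
      using that \<eta> D(2)[of x y] by (simp add: \<theta>_add)
    then show ?thesis using that \<eta>[of x] \<eta>[of y] \<eta>[of "x \<oplus>\<^bsub>M\<^esub> y"] by (simp add: \<theta>_inj q_add)
  qed
  show "\<eta> (\<rho> a \<odot>\<^bsub>B\<^esub> q x) = \<rho> a \<odot>\<^bsub>B\<^esub> \<eta> (q x)" if "a \<in> carrier K" "x \<in> carrier M" for a x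
  proof -
    have "\<rho> a \<in> carrier F" using that \<rho> by blast
    moreover have "\<theta> (\<eta> (q (a \<odot>\<^bsub>M\<^esub> x))) = \<theta> (\<rho> a \<odot>\<^bsub>B\<^esub> \<eta> (q x))"
      using that \<eta>[of x] \<eta>[of "a \<odot>\<^bsub>M\<^esub> x"] D(3)[of a x] by (simp add: \<theta>_smult)
    ultimately show ?thesis using that \<eta>[of x] \<eta>[of "a \<odot>\<^bsub>M\<^esub> x"] by (simp add: \<theta>_inj q_smult)
  qed
qed

lemma descend_ex:
  assumes D: "D \<in> linear_maps K M M" and pD: "\<And>x. x \<in> carrier M \<Longrightarrow> p (D x) = \<zero>\<^bsub>L\<^esub>"
  shows "\<exists>\<eta>\<in>linear_maps F B B. \<forall>x\<in>carrier M. D x = \<theta> (\<eta> (q x))"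
proof -
  \<comment> \<open>Two choices are made: a preimage under \<open>q\<close>, and then the element
    that \<open>\<theta>\<close> sends to the value of \<open>D\<close> there.
    \<open>descend\<close> makes the result independent of the first, and injectivity of
    \<open>\<theta>\<close> determines the second.\<close>
  define \<eta> where "\<eta> u = (SOME v. v \<in> carrier B \<and> \<theta> v = D (SOME x. x \<in> carrier M \<and> q x = u))" for u
  have \<eta>: "\<eta> (q x) \<in> carrier B \<and> D x = \<theta> (\<eta> (q x))" if x: "x \<in> carrier M" for x
  proof -
    let ?y = "SOME y. y \<in> carrier M \<and> q y = q x"
    have y: "?y \<in> carrier M \<and> q ?y = q x" by (rule someI[of "\<lambda>y. y \<in> carrier M \<and> q y = q x" x]) (simp add: x)
    then have Dy: "D ?y = D x" using x by (intro descend[OF D pD]) auto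
    obtain v where "v \<in> carrier B" "D x = \<theta> v"
      using x \<theta>_obtain[of "D x"] pD linear_mapsD(1)[OF D] by auto
    then have "v \<in> carrier B \<and> \<theta> v = D ?y" by (simp add: Dy)
    then have "\<eta> (q x) \<in> carrier B \<and> \<theta> (\<eta> (q x)) = D ?y" unfolding \<eta>_def by (rule someI)
    then show ?thesis by (simp add: Dy)
  qed
  then have "\<eta> \<in> linear_maps F B B" using D descend_linear by blast
  then show ?thesis using \<eta> by blast
qed

text \<open>\<open>descend\<close> is applied in one argument at a time with the other one fixed.
  The two-forms on B that the proof constructs come from here, so that bilinearity and alternation
  are verified in M.\<close>

lemma descend2_ex:
  assumes D1: "\<And>y. y \<in> carrier M \<Longrightarrow> (\<lambda>x. D x y) \<in> linear_maps K M M"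
    and D2: "\<And>x. x \<in> carrier M \<Longrightarrow> D x \<in> linear_maps K M M"
    and D0: "\<And>x. x \<in> carrier M \<Longrightarrow> D x x = \<zero>\<^bsub>M\<^esub>"
    and pD: "\<And>x y. x \<in> carrier M \<Longrightarrow> y \<in> carrier M \<Longrightarrow> p (D x y) = \<zero>\<^bsub>L\<^esub>"
  shows "\<exists>\<omega>\<in>carrier (cochains F B 2). \<forall>x\<in>carrier M. \<forall>y\<in>carrier M. D x y = \<theta> (\<omega> [q x, q y])"
proof -
  define E where "E u = (SOME x. x \<in> carrier M \<and> q x = u)" for u
  have E: "E (q x) \<in> carrier M" "q (E (q x)) = q x" if "x \<in> carrier M" for x
    using someI[of "\<lambda>y. y \<in> carrier M \<and> q y = q x" x] that by (auto simp: E_def)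
  define W where "W u v = (SOME w. w \<in> carrier B \<and> \<theta> w = D (E u) (E v))" for u v
  have W: "W (q x) (q y) \<in> carrier B \<and> D x y = \<theta> (W (q x) (q y))" if xy: "x \<in> carrier M" "y \<in> carrier M" for x y
  proof -
    have "D (E (q x)) (E (q y)) = D x (E (q y))"
      using xy E[of x] E[of y] by (intro descend[OF D1]) (auto simp: pD)
    also have "\<dots> = D x y"
      using xy E[of y] by (intro descend[OF D2]) (auto simp: pD)
    finally have Dy: "D (E (q x)) (E (q y)) = D x y" .
    obtain v where "v \<in> carrier B" "D x y = \<theta> v"
      using xy \<theta>_obtain[of "D x y"] pD linear_mapsD(1)[OF D2] by metis
    then have "v \<in> carrier B \<and> \<theta> v = D (E (q x)) (E (q y))" by (simp add: Dy)
    then have "W (q x) (q y) \<in> carrier B \<and> \<theta> (W (q x) (q y)) = D (E (q x)) (E (q y))" unfolding W_def by (rule someI)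
    then show ?thesis by (simp add: Dy)
  qed
  have "form2 B W \<in> carrier (cochains F B 2)"
  proof (rule form2_cochain[OF B])
    fix v assume "v \<in> carrier B"
    then obtain y where y: "y \<in> carrier M" "v = q y" by (rule q_obtain)
    show "(\<lambda>u. W u v) \<in> linear_maps F B B" using descend_linear[OF D1[OF y(1)]] W y by simp
    show "(\<lambda>u. W v u) \<in> linear_maps F B B" using descend_linear[OF D2[OF y(1)]] W y by simp
    have "\<theta> (W v v) = \<theta> \<zero>\<^bsub>B\<^esub>" using W[of y y] D0[of y] y by simp
    then show "W v v = \<zero>\<^bsub>B\<^esub>" using W[of y y] y \<theta>_inj[of "W v v" "\<zero>\<^bsub>B\<^esub>"] by simp
  qed
  then show ?thesis using W by (intro bexI[of _ "form2 B W"]) (auto simp: form2_apply)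
qed

text \<open>As M is free, the map to L lifts along \<open>p'\<close> to a linear map into M'. Its
  bijectivity is the five lemma for two extensions of L by B: it commutes with the maps to L, hence
  with the reductions, and since it commutes with t it is the identity on the copies of B.\<close>

lemma module_iso_ex:
  assumes M': "is_exact_lift M' p'"
  shows "\<exists>\<phi>\<in>linear_maps K M M'. bij_betw \<phi> (carrier M) (carrier M') \<and> (\<forall>x\<in>carrier M. p' (\<phi> x) = p x)"
proof -
  interpret M': exact_lift K F \<rho> L B r s t M' p' by unfold_locales (rule M')
  obtain n b where b: "is_basis K M n b" using M.free_of_finite_rank by blast
  have bc: "b i \<in> carrier M" if "i < n" for i using b that by (auto simp: is_basis_def)
  have "\<exists>m. m \<in> carrier M' \<and> p' m = p (b i)" if "i < n" for i
    using M'.p(2) p_closed[OF bc[OF that]] by (metis imageE)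
  then obtain m where m: "\<And>i. i < n \<Longrightarrow> m i \<in> carrier M' \<and> p' (m i) = p (b i)" by metis
  obtain \<phi> where \<phi>: "\<phi> \<in> linear_maps K M M'" and \<phi>b: "\<And>i. i < n \<Longrightarrow> \<phi> (b i) = m i"
    using linear_map_on_basis[OF M.module_axioms M'.M.module_axioms b, of m] m by auto
  have p\<phi>: "p' (\<phi> x) = p x" if "x \<in> carrier M" for x
    using linear_maps_eq_on_basis[OF M.module_axioms b L.M.abelian_group_axioms linear_maps_comp[OF \<phi> M'.p(1)] p(1) _ that]
      \<phi>b m by simp
  have q\<phi>: "M'.q (\<phi> x) = q x" if "x \<in> carrier M" for x using p\<phi> that by (simp add: q_def M'.q_def)
  note \<phi>D = linear_mapsD[OF \<phi>]
  have \<phi>0: "\<phi> \<zero>\<^bsub>M\<^esub> = \<zero>\<^bsub>M'\<^esub>" using \<phi>D(3)[of "\<zero>\<^bsub>K\<^esub>" "\<zero>\<^bsub>M\<^esub>"] \<phi>D(1)[of "\<zero>\<^bsub>M\<^esub>"] by simp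
  have inj: "x = y" if xy: "x \<in> carrier M" "y \<in> carrier M" and e: "\<phi> x = \<phi> y" for x y
  proof -
    have d: "x \<ominus>\<^bsub>M\<^esub> y \<in> carrier M" using xy by simp
    have "\<phi> y \<oplus>\<^bsub>M'\<^esub> \<phi> (x \<ominus>\<^bsub>M\<^esub> y) = \<phi> y"
      using \<phi>D(2)[OF xy(2) d] M_diff[OF xy] e by simp
    then have z: "\<phi> (x \<ominus>\<^bsub>M\<^esub> y) = \<zero>\<^bsub>M'\<^esub>" using \<phi>D(1)[OF xy(2)] \<phi>D(1)[OF d] by (simp add: M'.M.M.add.l_cancel_one)
    then have "p (x \<ominus>\<^bsub>M\<^esub> y) = \<zero>\<^bsub>L\<^esub>" using p\<phi>[OF d] M'.P.hom_zero by simp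
    then obtain w where w: "w \<in> carrier M" "x \<ominus>\<^bsub>M\<^esub> y = t \<odot>\<^bsub>M\<^esub> w" using p_zero_obtain[OF d] by blast
    have "t \<odot>\<^bsub>M'\<^esub> \<phi> w = t \<odot>\<^bsub>M'\<^esub> \<zero>\<^bsub>M'\<^esub>" using z w \<phi>D(3)[OF t w(1)] t by simp
    then have "M'.q (\<phi> w) = M'.q \<zero>\<^bsub>M'\<^esub>" using \<phi>D(1)[OF w(1)] by (simp only: M'.t_eq_iff M'.M.M.zero_closed)
    then have "q w = q \<zero>\<^bsub>M\<^esub>" using q\<phi>[OF w(1)] by simp
    then have "t \<odot>\<^bsub>M\<^esub> w = \<zero>\<^bsub>M\<^esub>" using t_eq_iff[OF w(1), of "\<zero>\<^bsub>M\<^esub>"] t by simp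
    then show ?thesis using w(2) M_diff[OF xy] xy by simp
  qed
  have surj: "y \<in> \<phi> ` carrier M" if y: "y \<in> carrier M'" for y
  proof -
    obtain x where x: "x \<in> carrier M" "p x = p' y" using p(2) M'.p_closed[OF y] by (metis imageE)
    have d: "y \<ominus>\<^bsub>M'\<^esub> \<phi> x \<in> carrier M'" using y \<phi>D(1) x by simp
    have "p' (y \<ominus>\<^bsub>M'\<^esub> \<phi> x) = \<zero>\<^bsub>L\<^esub>"
      using y x \<phi>D(1) p\<phi>[OF x(1)] by (simp add: M'.M.M.minus_eq M'.p_add L.M.r_neg)
    then obtain z where z: "z \<in> carrier M'" "y \<ominus>\<^bsub>M'\<^esub> \<phi> x = t \<odot>\<^bsub>M'\<^esub> z" using M'.p_zero_obtain[OF d] by blast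
    \<comment> \<open>Since w and z have the same reduction, t \<phi>(w) = t z, and adding t w to x
      corrects it to a preimage of y.\<close>
    obtain w where w: "w \<in> carrier M" "M'.q z = q w" using q_obtain[OF M'.q_closed[OF z(1)]] by blast
    have "t \<odot>\<^bsub>M'\<^esub> z = \<phi> (t \<odot>\<^bsub>M\<^esub> w)" using w z \<phi>D(1,3) t q\<phi>[OF w(1)] by (simp add: M'.t_eq_iff)
    then have "y = \<phi> (x \<oplus>\<^bsub>M\<^esub> t \<odot>\<^bsub>M\<^esub> w)" using M'.M_diff[OF y \<phi>D(1)[OF x(1)]] z w t x \<phi>D(2) by simp
    then show ?thesis using x w t by blast
  qed
  have "bij_betw \<phi> (carrier M) (carrier M')"
    using inj surj \<phi>D(1) by (auto simp: bij_betw_def inj_on_def)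
  then show ?thesis using \<phi> p\<phi> by blast
qed

section \<open>Frames and the forms that represent a lift\<close>

definition frame :: "('k, 'e) lie_algebra \<Rightarrow> ('e \<Rightarrow> 'b) \<Rightarrow> ('c \<Rightarrow> 'e) \<Rightarrow> bool" where
  "frame M' p' \<phi> \<longleftrightarrow> \<phi> \<in> linear_maps K M M' \<and> bij_betw \<phi> (carrier M) (carrier M') \<and>
     (\<forall>x\<in>carrier M. p' (\<phi> x) = p x)"

definition deform :: "('d list \<Rightarrow> 'd) \<Rightarrow> 'c \<Rightarrow> 'c \<Rightarrow> 'c" where
  "deform \<omega> x y = lie_bracket M x y \<oplus>\<^bsub>M\<^esub> \<theta> (\<omega> [q x, q y])"

text \<open>Along some frame the bracket of M' becomes the bracket of M deformed by \<omega>. The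
  frame is existentially quantified, so one lift is represented by several forms, and the set of all
  of them is an invariant of the lift.\<close>

definition represents :: "('k, 'e) lie_algebra \<Rightarrow> ('e \<Rightarrow> 'b) \<Rightarrow> ('d list \<Rightarrow> 'd) \<Rightarrow> bool" where
  "represents M' p' \<omega> \<longleftrightarrow> \<omega> \<in> carrier (cochains F B 2) \<and> (\<exists>\<phi>. frame M' p' \<phi> \<and>
     (\<forall>x\<in>carrier M. \<forall>y\<in>carrier M. lie_bracket M' (\<phi> x) (\<phi> y) = \<phi> (deform \<omega> x y)))"

lemma cochain2D:
  assumes "\<omega> \<in> carrier (cochains F B 2)"
  shows "x \<in> carrier M \<Longrightarrow> y \<in> carrier M \<Longrightarrow> \<omega> [q x, q y] \<in> carrier B"
    and "y \<in> carrier M \<Longrightarrow> (\<lambda>x. \<theta> (\<omega> [q x, q y])) \<in> linear_maps K M M"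
    and "x \<in> carrier M \<Longrightarrow> (\<lambda>y. \<theta> (\<omega> [q x, q y])) \<in> linear_maps K M M"
    and "x \<in> carrier M \<Longrightarrow> \<theta> (\<omega> [q x, q x]) = \<zero>\<^bsub>M\<^esub>"
proof -
  note * = assms[unfolded cochains2_iff]
  have l: "(\<lambda>u. \<omega> [u, v]) \<in> linear_maps F B B" "(\<lambda>u. \<omega> [v, u]) \<in> linear_maps F B B" if "v \<in> carrier B" for v
    using * that by blast+
  note 1 = linear_mapsD(1)[OF l(1)]
  then show "x \<in> carrier M \<Longrightarrow> y \<in> carrier M \<Longrightarrow> \<omega> [q x, q y] \<in> carrier B" by simp
  note a = linear_mapsD(2)[OF l(1)] linear_mapsD(2)[OF l(2)] and m = linear_mapsD(3)[OF l(1)] linear_mapsD(3)[OF l(2)]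
  have \<rho>c: "\<rho> a \<in> carrier F" if "a \<in> carrier K" for a using \<rho> that by blast
  show "y \<in> carrier M \<Longrightarrow> (\<lambda>x. \<theta> (\<omega> [q x, q y])) \<in> linear_maps K M M"
    "x \<in> carrier M \<Longrightarrow> (\<lambda>y. \<theta> (\<omega> [q x, q y])) \<in> linear_maps K M M"
    by (auto simp: linear_maps_def 1 a m q_add q_smult \<theta>_add \<theta>_smult \<rho>c)
  show "x \<in> carrier M \<Longrightarrow> \<theta> (\<omega> [q x, q x]) = \<zero>\<^bsub>M\<^esub>" using * by simp
qed

lemma cochain1D:
  assumes "\<eta> \<in> carrier (cochains F B 1)"
  shows "x \<in> carrier M \<Longrightarrow> \<eta> [q x] \<in> carrier B"
    and "(\<lambda>x. \<theta> (\<eta> [q x])) \<in> linear_maps K M M"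
    and "\<eta> [\<zero>\<^bsub>B\<^esub>] = \<zero>\<^bsub>B\<^esub>"
proof -
  have *: "(\<lambda>u. \<eta> [u]) \<in> linear_maps F B B" using assms unfolding cochains1_iff by blast
  note D = linear_mapsD[OF *]
  show "x \<in> carrier M \<Longrightarrow> \<eta> [q x] \<in> carrier B" using D by simp
  have \<rho>c: "\<rho> a \<in> carrier F" if "a \<in> carrier K" for a using \<rho> that by blast
  show "(\<lambda>x. \<theta> (\<eta> [q x])) \<in> linear_maps K M M"
    by (auto simp: linear_maps_def D q_add q_smult \<theta>_add \<theta>_smult \<rho>c)
  have "\<eta> [\<zero>\<^bsub>B\<^esub>] \<oplus>\<^bsub>B\<^esub> \<eta> [\<zero>\<^bsub>B\<^esub>] = \<eta> [\<zero>\<^bsub>B\<^esub>]" using D(2)[of "\<zero>\<^bsub>B\<^esub>" "\<zero>\<^bsub>B\<^esub>"] by simp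
  then show "\<eta> [\<zero>\<^bsub>B\<^esub>] = \<zero>\<^bsub>B\<^esub>" using D(1)[of "\<zero>\<^bsub>B\<^esub>"] by (simp add: B.M.add.l_cancel_one)
qed

lemma deform_closed: "\<omega> \<in> carrier (cochains F B 2) \<Longrightarrow> x \<in> carrier M \<Longrightarrow> y \<in> carrier M \<Longrightarrow> deform \<omega> x y \<in> carrier M"
  by (simp add: deform_def M.bracket_closed cochain2D)

text \<open>Pulled back along a frame, the bracket of M' and the bracket of M have the same image in
  L. Their difference is therefore a bilinear alternating map into the kernel of \<open>p\<close>,
  and it descends to a form on B.\<close>

lemma represents_ex:
  assumes M': "is_exact_lift M' p'"
  shows "\<exists>\<omega>. represents M' p' \<omega>"
proof -
  interpret M': exact_lift K F \<rho> L B r s t M' p' by unfold_locales (rule M')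
  obtain \<phi> where \<phi>: "frame M' p' \<phi>" using module_iso_ex[OF M'] by (auto simp: frame_def)
  then have \<phi>l: "\<phi> \<in> linear_maps K M M'" and bij: "bij_betw \<phi> (carrier M) (carrier M')"
    and p\<phi>: "\<And>x. x \<in> carrier M \<Longrightarrow> p' (\<phi> x) = p x" by (auto simp: frame_def)
  define \<psi> where "\<psi> = inv_into (carrier M) \<phi>"
  have \<psi>l: "\<psi> \<in> linear_maps K M' M" unfolding \<psi>_def by (rule linear_maps_inv_into[OF M.module_axioms \<phi>l bij])
  have \<phi>\<psi>: "\<phi> (\<psi> y) = y" if "y \<in> carrier M'" for y
    using bij that by (simp add: \<psi>_def bij_betw_def f_inv_into_f)
  have p\<psi>: "p (\<psi> y) = p' y" if "y \<in> carrier M'" for y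
    using p\<phi>[of "\<psi> y"] \<phi>\<psi> that linear_mapsD(1)[OF \<psi>l] by simp
  note \<phi>c = linear_mapsD(1)[OF \<phi>l] and \<psi>c = linear_mapsD(1)[OF \<psi>l]
  define D where "D x y = \<psi> (lie_bracket M' (\<phi> x) (\<phi> y)) \<ominus>\<^bsub>M\<^esub> lie_bracket M x y" for x y
  have "\<exists>\<omega>\<in>carrier (cochains F B 2). \<forall>x\<in>carrier M. \<forall>y\<in>carrier M. D x y = \<theta> (\<omega> [q x, q y])"
  proof (rule descend2_ex)
    fix y assume y: "y \<in> carrier M"
    show "(\<lambda>x. D x y) \<in> linear_maps K M M"
      unfolding D_def using y \<phi>c
      by (intro linear_maps_minus linear_maps_comp[OF _ \<psi>l] linear_maps_comp[OF \<phi>l] M'.M.bracket_linear M.bracket_linear M.module_axioms)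
    show "D y \<in> linear_maps K M M"
      unfolding D_def using y \<phi>c
      by (intro linear_maps_minus linear_maps_comp[OF _ \<psi>l] linear_maps_comp[OF \<phi>l] M'.M.bracket_linear M.bracket_linear M.module_axioms)
    have "\<psi> \<zero>\<^bsub>M'\<^esub> = \<zero>\<^bsub>M\<^esub>" using linear_mapsD(3)[OF \<psi>l, of "\<zero>\<^bsub>K\<^esub>" "\<zero>\<^bsub>M'\<^esub>"] \<psi>c[of "\<zero>\<^bsub>M'\<^esub>"] by simp
    then show "D y y = \<zero>\<^bsub>M\<^esub>"
      using y \<phi>c by (simp add: D_def M.bracket_self M'.M.bracket_self M.M.minus_eq)
    fix x assume x: "x \<in> carrier M"
    have b: "lie_bracket M' (\<phi> x) (\<phi> y) \<in> carrier M'" "lie_bracket M x y \<in> carrier M"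
      using x y \<phi>c by (auto simp: M.bracket_closed M'.M.bracket_closed)
    then show "p (D x y) = \<zero>\<^bsub>L\<^esub>"
      using x y \<phi>c \<psi>c by (simp add: D_def M.M.minus_eq p_add p\<psi> p_bracket M'.p_bracket p\<phi> L.M.r_neg flip: p_bracket)
  qed
  then obtain \<omega> where \<omega>: "\<omega> \<in> carrier (cochains F B 2)" "\<And>x y. x \<in> carrier M \<Longrightarrow> y \<in> carrier M \<Longrightarrow> D x y
    = \<theta> (\<omega> [q x, q y])"
    by blast
  have "lie_bracket M' (\<phi> x) (\<phi> y) = \<phi> (deform \<omega> x y)" if xy: "x \<in> carrier M" "y \<in> carrier M" for x y
  proof -
    have b: "lie_bracket M' (\<phi> x) (\<phi> y) \<in> carrier M'" using xy \<phi>c by (simp add: M'.M.bracket_closed)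
    have "deform \<omega> x y = \<psi> (lie_bracket M' (\<phi> x) (\<phi> y))"
      using xy b M_diff[of "\<psi> (lie_bracket M' (\<phi> x) (\<phi> y))" "lie_bracket M x y"] \<psi>c \<omega>(2)[OF xy]
      by (simp add: deform_def M.bracket_closed D_def)
    then show ?thesis using \<phi>\<psi> b by simp
  qed
  then show ?thesis using \<phi> \<omega>(1) unfolding represents_def by blast
qed

text \<open>Seen in M, the differential of \<eta> is the failure of the endomorphism
  \<open>\<theta> (\<eta> [q x])\<close> to be a derivation; antisymmetry in M turns the second term
  of the differential into the second term of the Leibniz rule.\<close>

lemma \<theta>_differential1:
  assumes \<eta>: "\<eta> \<in> carrier (cochains F B 1)" and xy: "x \<in> carrier M" "y \<in> carrier M"
  shows "differential B 1 \<eta> [q x, q y] \<in> carrier B"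
    and "\<theta> (differential B 1 \<eta> [q x, q y]) =
      (lie_bracket M x (\<theta> (\<eta> [q y])) \<oplus>\<^bsub>M\<^esub> lie_bracket M (\<theta> (\<eta> [q x])) y) \<ominus>\<^bsub>M\<^esub> \<theta> (\<eta> [q (lie_bracket M x y)])"
proof -
  have \<eta>c: "\<eta> \<in> tuples B 1 \<rightarrow> carrier B" using \<eta> unfolding cochains1_iff by blast
  note d = differential1[OF B.M.abelian_group_axioms B_bracket_closed \<eta>c q_closed[OF xy(1)] q_closed[OF xy(2)]]
  have c: "\<eta> [q x] \<in> carrier B" "\<eta> [q y] \<in> carrier B" "\<eta> [q (lie_bracket M x y)] \<in> carrier B"
    using cochain1D(1)[OF \<eta>] xy by (auto simp: M.bracket_closed)
  show "differential B 1 \<eta> [q x, q y] \<in> carrier B"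
    using c xy by (simp only: d q_bracket) (simp add: B_bracket_closed flip: q_bracket)
  have "lie_bracket M (\<theta> (\<eta> [q x])) y = \<ominus>\<^bsub>M\<^esub> lie_bracket M y (\<theta> (\<eta> [q x]))"
    using c xy by (intro M.bracket_anti) auto
  then show "\<theta> (differential B 1 \<eta> [q x, q y]) =
      (lie_bracket M x (\<theta> (\<eta> [q y])) \<oplus>\<^bsub>M\<^esub> lie_bracket M (\<theta> (\<eta> [q x])) y) \<ominus>\<^bsub>M\<^esub> \<theta> (\<eta> [q (lie_bracket M x y)])"
    using c xy by (simp only: d) (simp add: \<theta>_add \<theta>_minus B_bracket_closed bracket_\<theta>_right M.M.minus_eq flip: q_bracket)
qed

text \<open>Over \<open>L\<close>, the module automorphisms of \<open>M\<close> are the maps \<open>1 + \<theta>\<eta>q\<close>; they carry the deformation by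
  \<open>\<omega> + d\<eta>\<close> to the deformation by \<open>\<omega>\<close>.\<close>

lemma deform_shift:
  assumes \<omega>: "\<omega> \<in> carrier (cochains F B 2)" and \<omega>': "\<omega>' \<in> carrier (cochains F B 2)"
    and \<eta>: "\<eta> \<in> carrier (cochains F B 1)" and \<sigma>: "\<And>x. x \<in> carrier M \<Longrightarrow> \<sigma> x = x \<oplus>\<^bsub>M\<^esub> \<theta> (\<eta> [q x])"
    and xy: "x \<in> carrier M" "y \<in> carrier M"
  shows "\<sigma> (deform \<omega>' x y) = deform \<omega> (\<sigma> x) (\<sigma> y) \<longleftrightarrow> \<omega>' [q x, q y] = differential B 1 \<eta> [q x, q y] \<oplus>\<^bsub>B\<^esub> \<omega> [q x, q y]"
proof -
  note c1 = cochain1D(1)[OF \<eta>] and c2 = cochain2D(1)[OF \<omega>] and c2' = cochain2D(1)[OF \<omega>'] and d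
    = \<theta>_differential1[OF \<eta> xy]
  let ?N = "\<lambda>x. \<theta> (\<eta> [q x])"
  have q\<sigma>: "q (\<sigma> x) = q x" if "x \<in> carrier M" for x using that c1 by (simp add: \<sigma> q_add)
  \<comment> \<open>Elements \<open>\<theta> u\<close> reduce to 0, so the correction
    \<open>?N\<close> takes the same value on the deformed and on the original bracket.\<close>
  have qd: "q (deform \<omega>' x y) = q (lie_bracket M x y)" using xy c2' by (simp add: deform_def q_add M.bracket_closed)
  have l: "\<sigma> (deform \<omega>' x y) = (lie_bracket M x y \<oplus>\<^bsub>M\<^esub> \<theta> (\<omega>' [q x, q y])) \<oplus>\<^bsub>M\<^esub> ?N (lie_bracket M x y)"
    using xy by (simp add: \<sigma> deform_closed \<omega>' qd) (simp add: deform_def)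
  \<comment> \<open>The bracket of the two corrections \<open>?N x\<close> and \<open>?N y\<close>
    drops out by \<open>bracket_\<theta>_\<theta>\<close>.\<close>
  have "lie_bracket M (\<sigma> x) (\<sigma> y) = lie_bracket M x y \<oplus>\<^bsub>M\<^esub> (lie_bracket M x (?N y) \<oplus>\<^bsub>M\<^esub> lie_bracket M (?N x) y)"
    using xy c1 by (simp add: \<sigma> M.bracket_add_left M.bracket_add_right bracket_\<theta>_\<theta> M.bracket_closed M.M.a_ac)
  then have r: "deform \<omega> (\<sigma> x) (\<sigma> y) = lie_bracket M x y \<oplus>\<^bsub>M\<^esub>
      ((lie_bracket M x (?N y) \<oplus>\<^bsub>M\<^esub> lie_bracket M (?N x) y) \<oplus>\<^bsub>M\<^esub> \<theta> (\<omega> [q x, q y]))"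
    using xy c1 c2 by (simp add: deform_def q\<sigma> M.bracket_closed M.M.a_ac)
  have "\<sigma> (deform \<omega>' x y) = deform \<omega> (\<sigma> x) (\<sigma> y) \<longleftrightarrow> \<theta> (\<omega>' [q x, q y]) =
      ((lie_bracket M x (?N y) \<oplus>\<^bsub>M\<^esub> lie_bracket M (?N x) y) \<oplus>\<^bsub>M\<^esub> \<theta> (\<omega> [q x, q y])) \<ominus>\<^bsub>M\<^esub> ?N (lie_bracket M x y)"
    unfolding l r using xy c1 c2 c2' by (intro M.M.add_solve) (auto simp: M.bracket_closed)
  also have "((lie_bracket M x (?N y) \<oplus>\<^bsub>M\<^esub> lie_bracket M (?N x) y) \<oplus>\<^bsub>M\<^esub> \<theta> (\<omega> [q x, q y])) \<ominus>\<^bsub>M\<^esub> ?N (lie_bracket M x y)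
     = \<theta> (differential B 1 \<eta> [q x, q y] \<oplus>\<^bsub>B\<^esub> \<omega> [q x, q y])"
    using xy c1 c2 d by (simp add: \<theta>_add M.bracket_closed M.M.minus_eq M.M.a_ac)
  finally show ?thesis using d xy c2 c2' by (simp add: \<theta>_inj)
qed

text \<open>Instead of verifying on B that d\<eta> is bilinear and alternating, the value of d\<eta>
  + \<omega> is written in M as \<open>D\<close>, an expression in brackets, and descended.
  Injectivity of \<open>\<theta>\<close> shows that the descended form is the given one.\<close>

lemma shift_cochain:
  assumes \<omega>: "\<omega> \<in> carrier (cochains F B 2)" and \<eta>: "\<eta> \<in> carrier (cochains F B 1)"
  shows "differential B 1 \<eta> \<oplus>\<^bsub>cochains F B 2\<^esub> \<omega> \<in> carrier (cochains F B 2)"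
proof -
  let ?N = "\<lambda>x. \<theta> (\<eta> [q x])" and ?\<omega>' = "differential B 1 \<eta> \<oplus>\<^bsub>cochains F B 2\<^esub> \<omega>"
  note N = cochain1D(2)[OF \<eta>] and \<Omega> = cochain2D[OF \<omega>] and d = \<theta>_differential1[OF \<eta>]
  define D where "D x y = ((lie_bracket M x (?N y) \<oplus>\<^bsub>M\<^esub> lie_bracket M (?N x) y) \<ominus>\<^bsub>M\<^esub> ?N (lie_bracket M x y)) \<oplus>\<^bsub>M\<^esub> \<theta> (\<omega> [q x, q y])" for x y
  have app: "?\<omega>' [u, v] = differential B 1 \<eta> [u, v] \<oplus>\<^bsub>B\<^esub> \<omega> [u, v]" if "u \<in> carrier B" "v \<in> carrier B" for u v
    using that by (simp add: cochains_def tuples_ConsI numeral_2_eq_2)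
  have D: "D x y = \<theta> (?\<omega>' [q x, q y])" and cl: "?\<omega>' [q x, q y] \<in> carrier B" if "x \<in> carrier M" "y \<in> carrier M" for x y
    using that d[OF that] \<Omega>(1)[OF that] unfolding D_def app[OF q_closed[OF that(1)] q_closed[OF that(2)]]
    by (simp_all add: \<theta>_add)
  have "\<exists>\<omega>''\<in>carrier (cochains F B 2). \<forall>x\<in>carrier M. \<forall>y\<in>carrier M. D x y = \<theta> (\<omega>'' [q x, q y])"
  proof (rule descend2_ex)
    fix y assume y: "y \<in> carrier M"
    note Ny = linear_mapsD(1)[OF N y]
    show "(\<lambda>x. D x y) \<in> linear_maps K M M" "D y \<in> linear_maps K M M"
      unfolding D_def using y Ny
      by (intro linear_maps_minus linear_maps_add linear_maps_comp[OF _ N] linear_maps_comp[OF N] M.bracket_linear M.module_axioms \<Omega>; simp)+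
    \<comment> \<open>On the diagonal the two outer brackets cancel by antisymmetry, and the inner
      bracket is zero, which \<open>?N\<close> preserves.\<close>
    have "?N \<zero>\<^bsub>M\<^esub> = \<zero>\<^bsub>M\<^esub>" using cochain1D(3)[OF \<eta>] by simp
    moreover have "lie_bracket M (?N y) y = \<ominus>\<^bsub>M\<^esub> lie_bracket M y (?N y)" by (rule M.bracket_anti[OF y Ny])
    ultimately show "D y y = \<zero>\<^bsub>M\<^esub>"
      using y Ny \<Omega>(4)[OF y] by (simp add: D_def M.bracket_self M.bracket_closed M.M.minus_eq M.M.r_neg)
    show "p (D x y) = \<zero>\<^bsub>L\<^esub>" if "x \<in> carrier M" for x using D[OF that y] cl[OF that y] by simp
  qed
  then obtain \<omega>'' where \<omega>'': "\<omega>'' \<in> carrier (cochains F B 2)"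
    "\<And>x y. x \<in> carrier M \<Longrightarrow> y \<in> carrier M \<Longrightarrow> D x y = \<theta> (\<omega>'' [q x, q y])" by blast
  have "\<omega>'' = ?\<omega>'"
  proof (rule PiE_ext[of _ "tuples B 2" "\<lambda>_. carrier B"])
    have eq: "?\<omega>' [u, v] = \<omega>'' [u, v]" if uv: "u \<in> carrier B" "v \<in> carrier B" for u v
    proof -
      obtain x y where "x \<in> carrier M" "u = q x" "y \<in> carrier M" "v = q y" using uv by (elim q_obtain) blast
      then show ?thesis using D cl \<omega>''(2) cochain2D(1)[OF \<omega>''(1)] by (simp add: \<theta>_inj)
    qed
    show w: "\<omega>'' \<in> tuples B 2 \<rightarrow>\<^sub>E carrier B" using \<omega>''(1) unfolding cochains2_iff by blast
    have ext: "?\<omega>' \<in> extensional (tuples B 2)" by (simp add: cochains_def)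
    show "?\<omega>' \<in> tuples B 2 \<rightarrow>\<^sub>E carrier B"
      using ext w eq by (force simp: PiE_def Pi_def tuples_iff numeral_2_eq_2)
    show "\<omega>'' xs = ?\<omega>' xs" if "xs \<in> tuples B 2" for xs using that eq by (auto simp: tuples_iff numeral_2_eq_2)
  qed
  then show ?thesis using \<omega>''(1) by simp
qed

section \<open>Dependence of the form on the frame\<close>

lemma frameD:
  assumes "frame M' p' \<phi>"
  shows "\<phi> \<in> linear_maps K M M'" "bij_betw \<phi> (carrier M) (carrier M')" "x \<in> carrier M \<Longrightarrow> p' (\<phi> x) = p x"
  using assms by (auto simp: frame_def)

lemma shift_linear:
  assumes \<eta>: "\<eta> \<in> carrier (cochains F B 1)"
  shows "(\<lambda>x. x \<oplus>\<^bsub>M\<^esub> \<theta> (\<eta> [q x])) \<in> linear_maps K M M"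
  by (rule linear_maps_add[OF M.module_axioms _ cochain1D(2)[OF \<eta>]]) (simp add: linear_maps_def)

text \<open>The endomorphism N = \<theta>\<eta>q satisfies N^2 = 0 because \<open>q\<close> kills
  the image of \<open>\<theta>\<close>. Hence 1 + N is invertible with inverse 1 - N, and it lies
  over the identity of L because \<open>p\<close> kills that image too.\<close>

lemma shift_frame:
  assumes fr: "frame M' p' \<phi>" and \<eta>: "\<eta> \<in> carrier (cochains F B 1)"
  shows "frame M' p' (\<lambda>x. \<phi> (x \<oplus>\<^bsub>M\<^esub> \<theta> (\<eta> [q x])))"
proof -
  note c = cochain1D(1)[OF \<eta>]
  have z: "\<ominus>\<^bsub>B\<^esub> \<zero>\<^bsub>B\<^esub> = \<zero>\<^bsub>B\<^esub>" using B.M.minus_equality[of "\<zero>\<^bsub>B\<^esub>" "\<zero>\<^bsub>B\<^esub>"] by simp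
  have "bij_betw (\<lambda>x. x \<oplus>\<^bsub>M\<^esub> \<theta> (\<eta> [q x])) (carrier M) (carrier M)"
  proof (rule bij_betw_byWitness[where f' = "\<lambda>x. x \<ominus>\<^bsub>M\<^esub> \<theta> (\<eta> [q x])"])
    show "\<forall>x\<in>carrier M. (x \<oplus>\<^bsub>M\<^esub> \<theta> (\<eta> [q x])) \<ominus>\<^bsub>M\<^esub> \<theta> (\<eta> [q (x \<oplus>\<^bsub>M\<^esub> \<theta> (\<eta> [q x]))]) = x"
      using c by (auto simp: q_add M.M.minus_eq M.M.a_assoc M.M.r_neg)
    show "\<forall>x\<in>carrier M. (x \<ominus>\<^bsub>M\<^esub> \<theta> (\<eta> [q x])) \<oplus>\<^bsub>M\<^esub> \<theta> (\<eta> [q (x \<ominus>\<^bsub>M\<^esub> \<theta> (\<eta> [q x]))]) = x"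
      using c by (auto simp: q_add M.M.minus_eq M.M.a_assoc M.M.l_neg z)
  qed (use c in auto)
  then have "bij_betw (\<lambda>x. \<phi> (x \<oplus>\<^bsub>M\<^esub> \<theta> (\<eta> [q x]))) (carrier M) (carrier M')"
    using bij_betw_trans[OF _ frameD(2)[OF fr]] by (simp add: comp_def)
  moreover have "p' (\<phi> (x \<oplus>\<^bsub>M\<^esub> \<theta> (\<eta> [q x]))) = p x" if "x \<in> carrier M" for x
    using that c by (simp add: frameD(3)[OF fr] p_add)
  ultimately show ?thesis
    using linear_maps_comp[OF shift_linear[OF \<eta>] frameD(1)[OF fr]] by (simp add: frame_def)
qed

text \<open>A frame composed with 1 + \<theta>\<eta>q is again a frame, and
  \<open>deform_shift\<close> identifies the form that belongs to it. So the forms of a lift are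
  stable under adding coboundaries.\<close>

lemma represents_shift:
  assumes rep: "represents M' p' \<omega>" and \<eta>: "\<eta> \<in> carrier (cochains F B 1)"
  shows "represents M' p' (differential B 1 \<eta> \<oplus>\<^bsub>cochains F B 2\<^esub> \<omega>)"
proof -
  from rep obtain \<phi> where \<omega>: "\<omega> \<in> carrier (cochains F B 2)" and fr: "frame M' p' \<phi>"
    and br: "\<And>x y. x \<in> carrier M \<Longrightarrow> y \<in> carrier M \<Longrightarrow> lie_bracket M' (\<phi> x) (\<phi> y) = \<phi> (deform \<omega> x y)"
    by (auto simp: represents_def)
  let ?\<omega>' = "differential B 1 \<eta> \<oplus>\<^bsub>cochains F B 2\<^esub> \<omega>" and ?\<sigma> = "\<lambda>x. x \<oplus>\<^bsub>M\<^esub> \<theta> (\<eta> [q x])"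
  have \<omega>': "?\<omega>' \<in> carrier (cochains F B 2)" by (rule shift_cochain[OF \<omega> \<eta>])
  have app: "?\<omega>' [u, v] = differential B 1 \<eta> [u, v] \<oplus>\<^bsub>B\<^esub> \<omega> [u, v]" if "u \<in> carrier B" "v \<in> carrier B" for u v
    using that by (simp add: cochains_def tuples_ConsI numeral_2_eq_2)
  have "lie_bracket M' (\<phi> (?\<sigma> x)) (\<phi> (?\<sigma> y)) = \<phi> (?\<sigma> (deform ?\<omega>' x y))" if xy: "x \<in> carrier M" "y \<in> carrier M" for x y
  proof -
    have "?\<sigma> (deform ?\<omega>' x y) = deform \<omega> (?\<sigma> x) (?\<sigma> y)"
      using deform_shift[OF \<omega> \<omega>' \<eta> _ xy, of ?\<sigma>] app[OF q_closed[OF xy(1)] q_closed[OF xy(2)]] by blast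
    then show ?thesis using br[of "?\<sigma> x" "?\<sigma> y"] linear_mapsD(1)[OF shift_linear[OF \<eta>]] xy by simp
  qed
  then show ?thesis unfolding represents_def using \<omega>' shift_frame[OF fr \<eta>] by blast
qed

text \<open>Two frames of one lift differ by an automorphism \<open>\<sigma>\<close> of the module M
  over L. Then \<open>\<sigma>\<close> minus the identity maps into the kernel of \<open>p\<close>
  and descends to some h on B, so \<open>\<sigma>\<close> is a shift by a one-form, and
  \<open>deform_shift\<close> gives the difference of the two forms.\<close>

lemma represents_unique:
  assumes rep: "represents M' p' \<omega>" and rep': "represents M' p' \<omega>'"
  shows "\<exists>\<eta>\<in>carrier (cochains F B 1). \<omega>' = differential B 1 \<eta> \<oplus>\<^bsub>cochains F B 2\<^esub> \<omega>"
proof -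
  from rep obtain \<phi> where \<omega>: "\<omega> \<in> carrier (cochains F B 2)" and fr: "frame M' p' \<phi>"
    and br: "\<And>x y. x \<in> carrier M \<Longrightarrow> y \<in> carrier M \<Longrightarrow> lie_bracket M' (\<phi> x) (\<phi> y) = \<phi> (deform \<omega> x y)"
    by (auto simp: represents_def)
  from rep' obtain \<phi>' where \<omega>': "\<omega>' \<in> carrier (cochains F B 2)" and fr': "frame M' p' \<phi>'"
    and br': "\<And>x y. x \<in> carrier M \<Longrightarrow> y \<in> carrier M \<Longrightarrow> lie_bracket M' (\<phi>' x) (\<phi>' y) = \<phi>' (deform \<omega>' x y)"
    by (auto simp: represents_def)
  note \<phi> = linear_mapsD[OF frameD(1)[OF fr]] and \<phi>' = linear_mapsD[OF frameD(1)[OF fr']]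
  define \<psi> where "\<psi> = inv_into (carrier M) \<phi>"
  have \<psi>l: "\<psi> \<in> linear_maps K M' M"
    unfolding \<psi>_def by (rule linear_maps_inv_into[OF M.module_axioms frameD(1,2)[OF fr]])
  have \<phi>\<psi>: "\<phi> (\<psi> y) = y" if "y \<in> carrier M'" for y
    using frameD(2)[OF fr] that by (simp add: \<psi>_def bij_betw_def f_inv_into_f)
  have \<psi>\<phi>: "\<psi> (\<phi> x) = x" if "x \<in> carrier M" for x
    using frameD(2)[OF fr] that by (simp add: \<psi>_def bij_betw_def)
  define \<sigma> where "\<sigma> x = \<psi> (\<phi>' x)" for x
  have \<sigma>l: "\<sigma> \<in> linear_maps K M M"
    unfolding \<sigma>_def by (rule linear_maps_comp[OF frameD(1)[OF fr'] \<psi>l])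
  note \<sigma>c = linear_mapsD(1)[OF \<sigma>l]
  have \<phi>\<sigma>: "\<phi> (\<sigma> x) = \<phi>' x" if "x \<in> carrier M" for x using that \<phi>' by (simp add: \<sigma>_def \<phi>\<psi>)
  have p\<sigma>: "p (\<sigma> x) = p x" if "x \<in> carrier M" for x
    using that frameD(3)[OF fr, of "\<sigma> x"] frameD(3)[OF fr', of x] \<phi>\<sigma> \<sigma>c by simp
  have "\<exists>h\<in>linear_maps F B B. \<forall>x\<in>carrier M. \<sigma> x \<ominus>\<^bsub>M\<^esub> x = \<theta> (h (q x))"
  proof (rule descend_ex)
    show "(\<lambda>x. \<sigma> x \<ominus>\<^bsub>M\<^esub> x) \<in> linear_maps K M M"
      by (rule linear_maps_minus[OF M.module_axioms \<sigma>l]) (simp add: linear_maps_def)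
    show "p (\<sigma> x \<ominus>\<^bsub>M\<^esub> x) = \<zero>\<^bsub>L\<^esub>" if "x \<in> carrier M" for x
      using that \<sigma>c p\<sigma> by (simp add: M.M.minus_eq p_add L.M.r_neg)
  qed
  then obtain h where h: "h \<in> linear_maps F B B" "\<And>x. x \<in> carrier M \<Longrightarrow> \<sigma> x \<ominus>\<^bsub>M\<^esub> x = \<theta> (h (q x))" by blast
  define \<eta> where "\<eta> = form1 B h"
  have \<eta>: "\<eta> \<in> carrier (cochains F B 1)" unfolding \<eta>_def by (rule form1_cochain[OF B h(1)])
  have \<sigma>: "\<sigma> x = x \<oplus>\<^bsub>M\<^esub> \<theta> (\<eta> [q x])" if "x \<in> carrier M" for x
    using M_diff[OF \<sigma>c[OF that] that] h(2)[OF that] that by (simp add: \<eta>_def form1_apply)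
  have "\<omega>' = differential B 1 \<eta> \<oplus>\<^bsub>cochains F B 2\<^esub> \<omega>"
  proof (rule cochain2_cong[OF \<omega>' shift_cochain[OF \<omega> \<eta>]])
    fix u v assume uv: "u \<in> carrier B" "v \<in> carrier B"
    then obtain x y where xy: "x \<in> carrier M" "u = q x" "y \<in> carrier M" "v = q y" by (elim q_obtain) blast
    have "\<phi> (\<sigma> (deform \<omega>' x y)) = \<phi> (deform \<omega> (\<sigma> x) (\<sigma> y))"
      using br[of "\<sigma> x" "\<sigma> y"] br'[of x y] xy \<sigma>c by (simp add: \<phi>\<sigma> deform_closed[OF \<omega>'])
    then have "\<psi> (\<phi> (\<sigma> (deform \<omega>' x y))) = \<psi> (\<phi> (deform \<omega> (\<sigma> x) (\<sigma> y)))" by simp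
    then have "\<sigma> (deform \<omega>' x y) = deform \<omega> (\<sigma> x) (\<sigma> y)"
      using xy \<sigma>c deform_closed[OF \<omega>] deform_closed[OF \<omega>'] by (simp add: \<psi>\<phi>)
    then have "\<omega>' [u, v] = differential B 1 \<eta> [u, v] \<oplus>\<^bsub>B\<^esub> \<omega> [u, v]"
      using deform_shift[OF \<omega> \<omega>' \<eta> \<sigma> xy(1,3)] xy by blast
    then show "\<omega>' [u, v] = (differential B 1 \<eta> \<oplus>\<^bsub>cochains F B 2\<^esub> \<omega>) [u, v]"
      using uv by (simp add: cochains_def tuples_ConsI numeral_2_eq_2)
  qed
  then show ?thesis using \<eta> by blast
qed

lemma represents_iso:
  assumes rep: "represents M1 p1 \<omega>" and \<Psi>: "\<Psi> \<in> lie_hom K M1 M2" "bij_betw \<Psi> (carrier M1) (carrier M2)"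
    "\<And>x. x \<in> carrier M1 \<Longrightarrow> p2 (\<Psi> x) = p1 x"
  shows "represents M2 p2 \<omega>"
proof -
  from rep obtain \<phi> where \<omega>: "\<omega> \<in> carrier (cochains F B 2)" and fr: "frame M1 p1 \<phi>"
    and br: "\<And>x y. x \<in> carrier M \<Longrightarrow> y \<in> carrier M \<Longrightarrow> lie_bracket M1 (\<phi> x) (\<phi> y) = \<phi> (deform \<omega> x y)"
    by (auto simp: represents_def)
  note \<phi> = linear_mapsD(1)[OF frameD(1)[OF fr]]
  have \<Psi>l: "\<Psi> \<in> linear_maps K M1 M2"
    and \<Psi>b: "\<And>x y. x \<in> carrier M1 \<Longrightarrow> y \<in> carrier M1 \<Longrightarrow> \<Psi> (lie_bracket M1 x y) = lie_bracket M2 (\<Psi> x) (\<Psi> y)"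
    using \<Psi>(1) by (auto simp: lie_hom_iff)
  have "frame M2 p2 (\<lambda>x. \<Psi> (\<phi> x))"
    using linear_maps_comp[OF frameD(1)[OF fr] \<Psi>l] bij_betw_trans[OF frameD(2)[OF fr] \<Psi>(2)] \<Psi>(3) \<phi> frameD(3)[OF fr]
    by (simp add: frame_def comp_def)
  moreover have "lie_bracket M2 (\<Psi> (\<phi> x)) (\<Psi> (\<phi> y)) = \<Psi> (\<phi> (deform \<omega> x y))" if "x \<in> carrier M" "y \<in> carrier M" for x y
    using that \<phi> br by (simp flip: \<Psi>b)
  ultimately show ?thesis using \<omega> unfolding represents_def by blast
qed

text \<open>Both frames turn the bracket into the same deformation of the bracket of M. The inverse
  of the first frame followed by the second therefore preserves brackets, and it lies over the
  identity of L.\<close>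

lemma iso_of_represents:
  assumes M1: "lie_algebra K M1" and rep1: "represents M1 p1 \<omega>" and rep2: "represents M2 p2 \<omega>"
  shows "\<exists>\<Psi>\<in>lie_hom K M1 M2. bij_betw \<Psi> (carrier M1) (carrier M2) \<and> (\<forall>x\<in>carrier M1. p2 (\<Psi> x) = p1 x)"
proof -
  from rep1 obtain \<phi> where \<omega>: "\<omega> \<in> carrier (cochains F B 2)" and fr: "frame M1 p1 \<phi>"
    and br: "\<And>x y. x \<in> carrier M \<Longrightarrow> y \<in> carrier M \<Longrightarrow> lie_bracket M1 (\<phi> x) (\<phi> y) = \<phi> (deform \<omega> x y)"
    by (auto simp: represents_def)
  from rep2 obtain \<phi>' where fr': "frame M2 p2 \<phi>'"
    and br': "\<And>x y. x \<in> carrier M \<Longrightarrow> y \<in> carrier M \<Longrightarrow> lie_bracket M2 (\<phi>' x) (\<phi>' y) = \<phi>' (deform \<omega> x y)"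
    by (auto simp: represents_def)
  note \<phi> = linear_mapsD(1)[OF frameD(1)[OF fr]] and \<phi>' = linear_mapsD(1)[OF frameD(1)[OF fr']]
  define \<psi> where "\<psi> = inv_into (carrier M) \<phi>"
  have \<psi>l: "\<psi> \<in> linear_maps K M1 M"
    unfolding \<psi>_def by (rule linear_maps_inv_into[OF M.module_axioms frameD(1,2)[OF fr]])
  note \<psi> = linear_mapsD(1)[OF \<psi>l]
  have \<phi>\<psi>: "\<phi> (\<psi> y) = y" if "y \<in> carrier M1" for y
    using frameD(2)[OF fr] that by (simp add: \<psi>_def bij_betw_def f_inv_into_f)
  have \<psi>\<phi>: "\<psi> (\<phi> x) = x" if "x \<in> carrier M" for x
    using frameD(2)[OF fr] that by (simp add: \<psi>_def bij_betw_def)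
  have bij: "bij_betw (\<lambda>x. \<phi>' (\<psi> x)) (carrier M1) (carrier M2)"
    using bij_betw_trans[OF bij_betw_inv_into[OF frameD(2)[OF fr]] frameD(2)[OF fr']] by (simp add: comp_def \<psi>_def)
  have "\<phi>' (\<psi> (lie_bracket M1 x y)) = lie_bracket M2 (\<phi>' (\<psi> x)) (\<phi>' (\<psi> y))"
    if xy: "x \<in> carrier M1" "y \<in> carrier M1" for x y
    using br[OF \<psi>[OF xy(1)] \<psi>[OF xy(2)]] br'[OF \<psi>[OF xy(1)] \<psi>[OF xy(2)]] xy \<psi>
    by (simp add: \<phi>\<psi> \<psi>\<phi> deform_closed[OF \<omega>])
  then have "(\<lambda>x. \<phi>' (\<psi> x)) \<in> lie_hom K M1 M2"
    using linear_maps_comp[OF \<psi>l frameD(1)[OF fr']] by (simp add: lie_hom_iff)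
  moreover have "p2 (\<phi>' (\<psi> x)) = p1 x" if "x \<in> carrier M1" for x
    using that \<psi> frameD(3)[OF fr', of "\<psi> x"] frameD(3)[OF fr, of "\<psi> x"] by (simp add: \<phi>\<psi>)
  ultimately show ?thesis using bij by (intro bexI[of _ "\<lambda>x. \<phi>' (\<psi> x)"]) auto
qed

section \<open>The Jacobi identity and cocycles\<close>

definition jacobiator :: "('d list \<Rightarrow> 'd) \<Rightarrow> 'c \<Rightarrow> 'c \<Rightarrow> 'c \<Rightarrow> 'c" where
  "jacobiator \<omega> x y z = deform \<omega> (deform \<omega> x y) z \<oplus>\<^bsub>M\<^esub> deform \<omega> (deform \<omega> y z) x \<oplus>\<^bsub>M\<^esub> deform \<omega> (deform \<omega> z x) y"

text \<open>In the expansion of the Jacobi sum of the deformed bracket the sum for M itself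
  vanishes, and no term quadratic in \<omega> arises, since \<open>q\<close> kills the image of
  \<open>\<theta>\<close>. The remaining linear terms [\<omega>(x,y),z] and \<omega>([x,y],z),
  summed cyclically, are the six terms of the differential up to the common sign, after antisymmetry
  has put the arguments in order.\<close>

lemma jacobiator_differential:
  assumes \<omega>: "\<omega> \<in> carrier (cochains F B 2)" and xyz: "x \<in> carrier M" "y \<in> carrier M" "z \<in> carrier M"
  shows "differential B 2 \<omega> [q x, q y, q z] \<in> carrier B"
    and "jacobiator \<omega> x y z = \<ominus>\<^bsub>M\<^esub> \<theta> (differential B 2 \<omega> [q x, q y, q z])"
proof -
  let ?O = "\<lambda>x y. \<theta> (\<omega> [q x, q y])"
  let ?S = "\<lambda>x y z. lie_bracket M (?O x y) z \<oplus>\<^bsub>M\<^esub> ?O (lie_bracket M x y) z"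
  note c = cochain2D(1)[OF \<omega>]
  have Oc: "?O x y \<in> carrier M" if "x \<in> carrier M" "y \<in> carrier M" for x y using c that by simp
  note Ol = linear_mapsD(2)[OF cochain2D(2)[OF \<omega>]] linear_mapsD(2)[OF cochain2D(3)[OF \<omega>]]
  have anti: "?O y x = \<ominus>\<^bsub>M\<^esub> ?O x y" if "x \<in> carrier M" "y \<in> carrier M" for x y
  proof -
    have "\<zero>\<^bsub>M\<^esub> = ?O (x \<oplus>\<^bsub>M\<^esub> y) (x \<oplus>\<^bsub>M\<^esub> y)" using that cochain2D(4)[OF \<omega>, of "x \<oplus>\<^bsub>M\<^esub> y"] by (simp only: M.M.a_closed)
    also have "\<dots> = (?O x x \<oplus>\<^bsub>M\<^esub> ?O y x) \<oplus>\<^bsub>M\<^esub> (?O x y \<oplus>\<^bsub>M\<^esub> ?O y y)"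
      using that Ol by (simp only: M.M.a_closed)
    also have "\<dots> = ?O y x \<oplus>\<^bsub>M\<^esub> ?O x y" using that Oc cochain2D(4)[OF \<omega>] by simp
    finally show ?thesis using that Oc M.M.minus_equality by simp
  qed
  have d1: "deform \<omega> (deform \<omega> x y) z = lie_bracket M (lie_bracket M x y) z \<oplus>\<^bsub>M\<^esub> ?S x y z"
    if "x \<in> carrier M" "y \<in> carrier M" "z \<in> carrier M" for x y z
    using that c Oc by (simp add: deform_def q_add M.bracket_add_left M.bracket_closed M.M.a_ac)
  have "jacobiator \<omega> x y z = (lie_bracket M (lie_bracket M x y) z \<oplus>\<^bsub>M\<^esub> lie_bracket M (lie_bracket M y z) x \<oplus>\<^bsub>M\<^esub>
      lie_bracket M (lie_bracket M z x) y) \<oplus>\<^bsub>M\<^esub> (?S x y z \<oplus>\<^bsub>M\<^esub> ?S y z x \<oplus>\<^bsub>M\<^esub> ?S z x y)"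
    using xyz Oc by (simp add: jacobiator_def d1 M.bracket_closed M.M.a_ac)
  also have "\<dots> = ?S x y z \<oplus>\<^bsub>M\<^esub> ?S y z x \<oplus>\<^bsub>M\<^esub> ?S z x y"
    using xyz Oc by (simp add: M.jacobi M.bracket_closed)
  finally have J: "jacobiator \<omega> x y z = ?S x y z \<oplus>\<^bsub>M\<^esub> ?S y z x \<oplus>\<^bsub>M\<^esub> ?S z x y" .
  have \<omega>c: "\<omega> \<in> tuples B 2 \<rightarrow> carrier B" using \<omega> unfolding cochains2_iff by blast
  note d = differential2[OF B.M.abelian_group_axioms B_bracket_closed \<omega>c q_closed[OF xyz(1)] q_closed[OF xyz(2)] q_closed[OF xyz(3)]]
  note bc = M.bracket_closed
  show "differential B 2 \<omega> [q x, q y, q z] \<in> carrier B"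
    using c xyz bc by (simp only: d) (simp add: B_bracket_closed flip: q_bracket)
  have "\<theta> (differential B 2 \<omega> [q x, q y, q z]) =
     (lie_bracket M x (?O y z) \<oplus>\<^bsub>M\<^esub> \<ominus>\<^bsub>M\<^esub> lie_bracket M y (?O x z) \<oplus>\<^bsub>M\<^esub> lie_bracket M z (?O x y)) \<oplus>\<^bsub>M\<^esub>
     (\<ominus>\<^bsub>M\<^esub> ?O (lie_bracket M x y) z \<oplus>\<^bsub>M\<^esub> ?O (lie_bracket M x z) y \<oplus>\<^bsub>M\<^esub> \<ominus>\<^bsub>M\<^esub> ?O (lie_bracket M y z) x)"
    using c xyz bc
    by (simp only: d) (simp add: \<theta>_add \<theta>_minus B_bracket_closed bracket_\<theta>_right flip: q_bracket)
  also have "lie_bracket M x (?O y z) = \<ominus>\<^bsub>M\<^esub> lie_bracket M (?O y z) x" using xyz Oc by (intro M.bracket_anti) auto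
  also have "\<ominus>\<^bsub>M\<^esub> lie_bracket M y (?O x z) = \<ominus>\<^bsub>M\<^esub> lie_bracket M (?O z x) y"
    using xyz Oc by (simp add: anti[of z x] M.bracket_minus_right bc M.bracket_anti[of "?O z x" y])
  also have "lie_bracket M z (?O x y) = \<ominus>\<^bsub>M\<^esub> lie_bracket M (?O x y) z" using xyz Oc by (intro M.bracket_anti) auto
  also have "?O (lie_bracket M x z) y = \<ominus>\<^bsub>M\<^esub> ?O (lie_bracket M z x) y"
  proof -
    have "?O (lie_bracket M x z) y = ?O (\<ominus>\<^bsub>M\<^esub> lie_bracket M z x) y" using xyz by (simp add: M.bracket_anti[of z x])
    also have "\<dots> = \<ominus>\<^bsub>M\<^esub> ?O (lie_bracket M z x) y"
      using linear_maps_a_inv[OF M.module_axioms M.module_axioms cochain2D(2)[OF \<omega>, of y], of "lie_bracket M z x"] xyz bc by simp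
    finally show ?thesis .
  qed
  finally show "jacobiator \<omega> x y z = \<ominus>\<^bsub>M\<^esub> \<theta> (differential B 2 \<omega> [q x, q y, q z])"
    unfolding J using xyz Oc bc by (simp add: M.M.minus_add M.M.a_ac)
qed

lemma jacobiator_eq_zero_iff:
  assumes \<omega>: "\<omega> \<in> carrier (cochains F B 2)" and xyz: "x \<in> carrier M" "y \<in> carrier M" "z \<in> carrier M"
  shows "jacobiator \<omega> x y z = \<zero>\<^bsub>M\<^esub> \<longleftrightarrow> differential B 2 \<omega> [q x, q y, q z] = \<zero>\<^bsub>B\<^esub>"
proof -
  let ?d = "differential B 2 \<omega> [q x, q y, q z]"
  note J = jacobiator_differential[OF \<omega> xyz]
  have "\<ominus>\<^bsub>M\<^esub> \<theta> ?d = \<zero>\<^bsub>M\<^esub> \<longleftrightarrow> \<theta> ?d = \<theta> \<zero>\<^bsub>B\<^esub>"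
  proof
    assume "\<ominus>\<^bsub>M\<^esub> \<theta> ?d = \<zero>\<^bsub>M\<^esub>"
    then have "\<theta> ?d \<oplus>\<^bsub>M\<^esub> \<zero>\<^bsub>M\<^esub> = \<zero>\<^bsub>M\<^esub>" using M.M.r_neg[of "\<theta> ?d"] J(1) by simp
    then show "\<theta> ?d = \<theta> \<zero>\<^bsub>B\<^esub>" using J(1) by simp
  next
    assume "\<theta> ?d = \<theta> \<zero>\<^bsub>B\<^esub>"
    then show "\<ominus>\<^bsub>M\<^esub> \<theta> ?d = \<zero>\<^bsub>M\<^esub>" using M.M.minus_equality[of "\<zero>\<^bsub>M\<^esub>" "\<zero>\<^bsub>M\<^esub>"] by simp
  qed
  then show ?thesis using J by (simp add: \<theta>_inj del: \<theta>_zero)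
qed

text \<open>As \<open>q\<close> is surjective, the arguments of the differential may be taken to be
  reductions of elements of M; the cocycle condition then reads as the Jacobi identity of the
  deformed bracket.\<close>

lemma cocycle_iff:
  "\<omega> \<in> cocycles F B 2 \<longleftrightarrow> \<omega> \<in> carrier (cochains F B 2) \<and>
     (\<forall>x\<in>carrier M. \<forall>y\<in>carrier M. \<forall>z\<in>carrier M. jacobiator \<omega> x y z = \<zero>\<^bsub>M\<^esub>)"
proof -
  have "differential B 2 \<omega> = \<zero>\<^bsub>cochains F B (Suc 2)\<^esub> \<longleftrightarrow>
      (\<forall>x\<in>carrier M. \<forall>y\<in>carrier M. \<forall>z\<in>carrier M. differential B 2 \<omega> [q x, q y, q z] = \<zero>\<^bsub>B\<^esub>)" (is "?l \<longleftrightarrow> ?r")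
  proof
    assume ?l
    then show ?r by (auto simp: cochains_def tuples_ConsI numeral_2_eq_2)
  next
    assume r: ?r
    have "differential B 2 \<omega> xs = \<zero>\<^bsub>B\<^esub>" if xs: "xs \<in> tuples B 3" for xs
    proof -
      obtain u v w where "xs = [u, v, w]" "u \<in> carrier B" "v \<in> carrier B" "w \<in> carrier B"
        using xs by (auto simp: tuples3)
      then show ?thesis using r by (elim q_obtain) simp
    qed
    moreover have "differential B 2 \<omega> \<in> extensional (tuples B 3)"
      by (simp add: differential_def numeral_3_eq_3 numeral_2_eq_2)
    ultimately show ?l
      by (intro extensionalityI[of _ "tuples B 3"]) (auto simp: cochains_def numeral_3_eq_3 numeral_2_eq_2)
  qed
  then show ?thesis by (auto simp: cocycles_def jacobiator_eq_zero_iff)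
qed

text \<open>A frame is injective and carries the deformed bracket to the bracket of M', so the
  Jacobi identity of M' pulls back to M.\<close>

lemma represents_cocycle:
  assumes M': "lie_algebra K M'" and rep: "represents M' p' \<omega>"
  shows "\<omega> \<in> cocycles F B 2"
proof -
  interpret M': lie_algebra K M' by (rule M')
  from rep obtain \<phi> where \<omega>: "\<omega> \<in> carrier (cochains F B 2)" and fr: "frame M' p' \<phi>"
    and br: "\<And>x y. x \<in> carrier M \<Longrightarrow> y \<in> carrier M \<Longrightarrow> lie_bracket M' (\<phi> x) (\<phi> y) = \<phi> (deform \<omega> x y)"
    by (auto simp: represents_def)
  note \<phi> = linear_mapsD[OF frameD(1)[OF fr]] and dc = deform_closed[OF \<omega>]
  have \<phi>0: "\<phi> \<zero>\<^bsub>M\<^esub> = \<zero>\<^bsub>M'\<^esub>" using \<phi>(3)[of "\<zero>\<^bsub>K\<^esub>" "\<zero>\<^bsub>M\<^esub>"] \<phi>(1)[of "\<zero>\<^bsub>M\<^esub>"] by simp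
  have "jacobiator \<omega> x y z = \<zero>\<^bsub>M\<^esub>" if xyz: "x \<in> carrier M" "y \<in> carrier M" "z \<in> carrier M" for x y z
  proof -
    have "\<phi> (jacobiator \<omega> x y z) = \<phi> \<zero>\<^bsub>M\<^esub>"
      using xyz M'.jacobi[of "\<phi> x" "\<phi> y" "\<phi> z"] \<phi>(1) by (simp add: jacobiator_def \<phi>(2) dc br \<phi>0)
    then show ?thesis
      using frameD(2)[OF fr] xyz dc by (auto simp: bij_betw_def jacobiator_def dest!: inj_onD)
  qed
  then show ?thesis using \<omega> by (simp add: cocycle_iff)
qed

section \<open>Every cocycle comes from a lift\<close>

lemma deform_lie_algebra:
  assumes \<omega>: "\<omega> \<in> cocycles F B 2"
  shows "lie_algebra K (M\<lparr>lie_bracket := deform \<omega>\<rparr>)"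
proof -
  let ?M = "M\<lparr>lie_bracket := deform \<omega>\<rparr>"
  have \<omega>c: "\<omega> \<in> carrier (cochains F B 2)"
    and J: "\<And>x y z. x \<in> carrier M \<Longrightarrow> y \<in> carrier M \<Longrightarrow> z \<in> carrier M \<Longrightarrow> jacobiator \<omega> x y z = \<zero>\<^bsub>M\<^esub>"
    using \<omega> by (auto simp: cocycle_iff)
  note \<Omega> = cochain2D[OF \<omega>c] and dc = deform_closed[OF \<omega>c]
  have dl: "(\<lambda>x. deform \<omega> x y) \<in> linear_maps K M M" "deform \<omega> y \<in> linear_maps K M M" if y: "y \<in> carrier M" for y
    unfolding deform_def using y
    by (intro linear_maps_add M.bracket_linear M.module_axioms \<Omega>; simp)+
  have self: "deform \<omega> x x = \<zero>\<^bsub>M\<^esub>" if "x \<in> carrier M" for x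
    using that \<Omega>(4)[OF that] by (simp add: deform_def M.bracket_self)
  have ba: "\<exists>n b. is_basis K ?M n b" using M.free_of_finite_rank by (simp add: is_basis_bracket_update)
  show ?thesis
    by (intro lie_algebra.intro lie_algebra_axioms.intro module_bracket_update M.module_axioms ba)
      (use J in \<open>simp_all add: dc self linear_mapsD(2,3)[OF dl(1)] linear_mapsD(2,3)[OF dl(2)] jacobiator_def\<close>)
qed

text \<open>\<open>\<theta>\<close> maps into the kernel of \<open>p\<close>, so \<open>p\<close>
  still preserves brackets. The kernel conditions concern only the module structure and the map,
  both unchanged.\<close>

lemma deform_exact:
  assumes \<omega>: "\<omega> \<in> cocycles F B 2"
  shows "is_exact_lift (M\<lparr>lie_bracket := deform \<omega>\<rparr>) p"
proof -
  have \<omega>c: "\<omega> \<in> carrier (cochains F B 2)" using \<omega> by (simp add: cocycle_iff)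
  have "p (deform \<omega> x y) = lie_bracket L (p x) (p y)" if xy: "x \<in> carrier M" "y \<in> carrier M" for x y
    using xy cochain2D(1)[OF \<omega>c xy]
    by (simp add: deform_def p_add M.bracket_closed flip: p_bracket)
  then have "p \<in> lie_hom K (M\<lparr>lie_bracket := deform \<omega>\<rparr>) L"
    using p(1) by (simp add: lie_hom_iff linear_maps_def)
  then show ?thesis
    using exact deform_lie_algebra[OF \<omega>] by (simp add: is_exact_lift_def)
qed

lemma deform_represents:
  assumes \<omega>: "\<omega> \<in> cocycles F B 2"
  shows "represents (M\<lparr>lie_bracket := deform \<omega>\<rparr>) p \<omega>"
proof -
  have "frame (M\<lparr>lie_bracket := deform \<omega>\<rparr>) p (\<lambda>x. x)"
    by (simp add: frame_def linear_maps_def bij_betw_def)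
  then show ?thesis using \<omega> by (auto simp: represents_def cocycle_iff intro!: exI[of _ "\<lambda>x. x"])
qed

text \<open>By \<open>represents_shift\<close> and \<open>represents_unique\<close> the forms of a
  lift are one orbit under the addition of coboundaries. This is a coset attached to the lift
  without any choice of frame.\<close>

lemma represented_coset:
  assumes M': "lie_algebra K M'" and rep: "represents M' p' \<omega>"
  shows "{\<omega>. represents M' p' \<omega>} =
    coboundaries F B 2 +>\<^bsub>(cochains F B 2)\<lparr>carrier := cocycles F B 2\<rparr>\<^esub> \<omega>"
proof -
  have c: "coboundaries F B 2 = differential B 1 ` carrier (cochains F B 1)"
    by (simp add: numeral_2_eq_2)
  have "{\<omega>. represents M' p' \<omega>} = (\<lambda>\<eta>. differential B 1 \<eta> \<oplus>\<^bsub>cochains F B 2\<^esub> \<omega>) ` carrier (cochains F B 1)"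
    using represents_unique[OF rep] represents_shift[OF rep] by blast
  then show ?thesis unfolding c by (auto simp: a_r_coset_def r_coset_def)
qed

text \<open>The classifying map sends a lift to its coset of representing forms. Lifts with a common
  form are isomorphic over L, and an isomorphism over L transports forms, so the map is well defined
  and injective on classes. It is onto because \<open>\<Lambda>\<close> contains the deformations of
  M by all cocycles.\<close>

theorem lifts_cohomology:
  fixes \<Lambda> :: "(('k, 'c) lie_algebra \<times> ('c \<Rightarrow> 'b)) set"
  assumes \<Lambda>: "\<And>M' p'. (M', p') \<in> \<Lambda> \<Longrightarrow> is_exact_lift M' p'"
    and deform: "\<And>\<omega>. \<omega> \<in> cocycles F B 2 \<Longrightarrow> (M\<lparr>lie_bracket := deform \<omega>\<rparr>, p) \<in> \<Lambda>"
    and E: "E = {((M1, p1), (M2, p2)). (M1, p1) \<in> \<Lambda> \<and> (M2, p2) \<in> \<Lambda> \<and>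
      (\<exists>\<Psi>\<in>lie_hom K M1 M2. bij_betw \<Psi> (carrier M1) (carrier M2) \<and> (\<forall>x\<in>carrier M1. p2 (\<Psi> x) = p1 x))}"
  shows "\<exists>\<Phi>. bij_betw \<Phi> (\<Lambda> // E) (cohomology F B 2)"
proof -
  define f where "f Z = {\<omega>. represents (fst Z) (snd Z) \<omega>}" for Z :: "('k, 'c) lie_algebra \<times> ('c \<Rightarrow> 'b)"
  have lie: "lie_algebra K M'" if "(M', p') \<in> \<Lambda>" for M' p' using \<Lambda>[OF that] by (simp add: is_exact_lift_def)
  have coset: "f (M', p') = coboundaries F B 2 +>\<^bsub>(cochains F B 2)\<lparr>carrier := cocycles F B 2\<rparr>\<^esub> \<omega>"
    if "(M', p') \<in> \<Lambda>" "represents M' p' \<omega>" for M' p' \<omega>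
    using represented_coset[OF lie[OF that(1)] that(2)] by (simp add: f_def)
  have "(\<exists>\<Psi>\<in>lie_hom K M1 M2. bij_betw \<Psi> (carrier M1) (carrier M2) \<and> (\<forall>x\<in>carrier M1. p2 (\<Psi> x) = p1 x))
      \<longleftrightarrow> f (M1, p1) = f (M2, p2)" (is "?l \<longleftrightarrow> ?r") if M12: "(M1, p1) \<in> \<Lambda>" "(M2, p2) \<in> \<Lambda>" for M1 p1 M2 p2
  proof
    assume ?l
    then obtain \<Psi> where \<Psi>: "\<Psi> \<in> lie_hom K M1 M2" "bij_betw \<Psi> (carrier M1) (carrier M2)" "\<And>x. x \<in> carrier M1 \<Longrightarrow> p2 (\<Psi> x) = p1 x"
      by blast
    obtain \<omega> where "represents M1 p1 \<omega>" using represents_ex[OF \<Lambda>[OF M12(1)]] by blast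
    moreover from this have "represents M2 p2 \<omega>" by (rule represents_iso) (use \<Psi> in auto)
    ultimately show ?r using coset M12 by simp
  next
    assume r: ?r
    obtain \<omega> where "represents M1 p1 \<omega>" using represents_ex[OF \<Lambda>[OF M12(1)]] by blast
    moreover from this have "represents M2 p2 \<omega>" using r by (auto simp: f_def)
    ultimately show ?l using iso_of_represents[OF lie[OF M12(1)]] by blast
  qed
  then have "E = {(Y, Z). Y \<in> \<Lambda> \<and> Z \<in> \<Lambda> \<and> f Y = f Z}"
    unfolding E by (simp add: set_eq_iff cong: conj_cong)
  then have bij: "bij_betw (\<lambda>C. \<Union>(f ` C)) (\<Lambda> // E) (f ` \<Lambda>)" by (rule bij_betw_quotient_image)
  have "f ` \<Lambda> = cohomology F B 2"
  proof
    show "f ` \<Lambda> \<subseteq> cohomology F B 2"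
    proof
      fix v assume "v \<in> f ` \<Lambda>"
      then obtain M' p' where M': "(M', p') \<in> \<Lambda>" "v = f (M', p')" by auto
      obtain \<omega> where "represents M' p' \<omega>" using represents_ex[OF \<Lambda>[OF M'(1)]] by blast
      then show "v \<in> cohomology F B 2"
        using coset[OF M'(1)] M'(2) represents_cocycle[OF lie[OF M'(1)]]
        by (auto simp: cohomology_def A_RCOSETS_def RCOSETS_def a_r_coset_def)
    qed
    show "cohomology F B 2 \<subseteq> f ` \<Lambda>"
    proof
      fix v assume "v \<in> cohomology F B 2"
      then obtain \<omega> where \<omega>: "\<omega> \<in> cocycles F B 2"
        and v: "v = coboundaries F B 2 +>\<^bsub>(cochains F B 2)\<lparr>carrier := cocycles F B 2\<rparr>\<^esub> \<omega>"
        by (auto simp: cohomology_def A_RCOSETS_def RCOSETS_def a_r_coset_def)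
      then have "v = f (M\<lparr>lie_bracket := local.deform \<omega>\<rparr>, p)"
        using coset[OF deform[OF \<omega>] deform_represents[OF \<omega>]] by simp
      then show "v \<in> f ` \<Lambda>" using deform[OF \<omega>] by blast
    qed
  qed
  then show ?thesis using bij by auto
qed

end

section \<open>Base change along a surjective ring homomorphism\<close>

context
  fixes R :: "('a, 'r) ring_scheme" and S :: "'s ring" and g and L :: "('a, 'b) lie_algebra"
  assumes S: "cring S" and L: "module R L" and g: "g \<in> ring_hom R S" and surj: "g ` carrier R = carrier S"
    and br: "\<And>x y. x \<in> carrier L \<Longrightarrow> y \<in> carrier L \<Longrightarrow> lie_bracket L x y \<in> carrier L"
      "\<And>x y z. \<lbrakk>x \<in> carrier L; y \<in> carrier L; z \<in> carrier L\<rbrakk> \<Longrightarrow>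
        lie_bracket L (x \<oplus>\<^bsub>L\<^esub> y) z = lie_bracket L x z \<oplus>\<^bsub>L\<^esub> lie_bracket L y z"
      "\<And>x y z. \<lbrakk>x \<in> carrier L; y \<in> carrier L; z \<in> carrier L\<rbrakk> \<Longrightarrow>
        lie_bracket L x (y \<oplus>\<^bsub>L\<^esub> z) = lie_bracket L x y \<oplus>\<^bsub>L\<^esub> lie_bracket L x z"
      "\<And>a x y. \<lbrakk>a \<in> carrier R; x \<in> carrier L; y \<in> carrier L\<rbrakk> \<Longrightarrow>
        lie_bracket L (a \<odot>\<^bsub>L\<^esub> x) y = a \<odot>\<^bsub>L\<^esub> lie_bracket L x y"
      "\<And>a x y. \<lbrakk>a \<in> carrier R; x \<in> carrier L; y \<in> carrier L\<rbrakk> \<Longrightarrow>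
        lie_bracket L x (a \<odot>\<^bsub>L\<^esub> y) = a \<odot>\<^bsub>L\<^esub> lie_bracket L x y"
begin

interpretation S: cring S by (rule S)
interpretation L: module R L by (rule L)

private abbreviation (input) "N \<equiv> ring_as_module g S"
private abbreviation (input) "B \<equiv> base_change R g S L"

private lemma ring_as_module_simps:
  "carrier N = carrier S" "ring.zero N = \<zero>\<^bsub>S\<^esub>" "ring.add N = ring.add S" "smult N = (\<lambda>r s. g r \<otimes>\<^bsub>S\<^esub> s)"
  by (simp_all add: ring_as_module_def)

private lemma ring_as_module: "module R N"
proof -
  note g' = ring_hom_closed[OF g] ring_hom_add[OF g] ring_hom_mult[OF g] ring_hom_one[OF g]
  have "abelian_group N"
  proof (rule abelian_groupI)
    show "\<exists>y\<in>carrier N. y \<oplus>\<^bsub>N\<^esub> x = \<zero>\<^bsub>N\<^esub>" if "x \<in> carrier N" for x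
      using that by (intro bexI[of _ "\<ominus>\<^bsub>S\<^esub> x"]) (auto simp: ring_as_module_simps S.l_neg)
  qed (auto simp: ring_as_module_simps S.a_ac)
  then show ?thesis
    by (intro moduleI) (auto simp: ring_as_module_simps g' L.R.cring_axioms S.l_distr S.r_distr S.m_assoc)
qed

private lemma g_closed: "r \<in> carrier R \<Longrightarrow> g r \<in> carrier S" by (rule ring_hom_closed[OF g])

private lemmas relators = tensor_kernel_relators[OF S L ring_as_module g_closed br]
private lemmas class_eq = tensor_class_eq[OF L ring_as_module]
private lemma class_bracket:
  assumes "Poly_Mapping.keys f \<subseteq> carrier L \<times> carrier S" "Poly_Mapping.keys h \<subseteq> carrier L \<times> carrier S"
  shows "lie_bracket B (tensor_class R L N f) (tensor_class R L N h) = tensor_class R L N (bracket_ext L S f h)"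
  using assms by (intro base_change_bracket S L ring_as_module) (simp_all add: br g_closed)

private lemma class_smult:
  assumes "c \<in> carrier S"
  shows "c \<odot>\<^bsub>B\<^esub> tensor_class R L N f = tensor_class R L N (smult_ext S c f)"
  using assms by (intro base_change_smult S L ring_as_module) (simp_all add: br g_closed)

private lemmas kernel_add = tensor_kernel_add[OF L ring_as_module]
private lemmas kernel_diff = tensor_kernel_diff[OF L ring_as_module]
private lemmas kernel_0 = tensor_kernel_0[OF L ring_as_module]

text \<open>The canonical map to the tensor product, x to x tensor 1.\<close>

definition base_change_map :: "'b \<Rightarrow> ('b \<times> 's \<Rightarrow>\<^sub>0 int) set" where
  "base_change_map x = tensor_class R L N (frag_of (x, \<one>\<^bsub>S\<^esub>))"

interpretation G: comm_group "free_on_pairs L N"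
  unfolding free_on_pairs_def by (rule abelian_free_Abelian_group)

private lemma kernel_normal: "tensor_kernel R L N \<lhd> free_on_pairs L N"
  by (rule G.subgroup_imp_normal[OF tensor_kernel_subgroup[OF L ring_as_module]])

private lemma base_change_simps:
  "carrier B = {tensor_class R L N f | f. Poly_Mapping.keys f \<subseteq> carrier L \<times> carrier S}"
  "ring.zero B = tensor_kernel R L N"
  by (auto simp: base_change_def Let_def tensor_group_def FactGroup_def RCOSETS_def tensor_class_def ring_as_module_simps)

private lemma base_change_add:
  assumes "Poly_Mapping.keys f \<subseteq> carrier L \<times> carrier S" "Poly_Mapping.keys h \<subseteq> carrier L \<times> carrier S"
  shows "tensor_class R L N f \<oplus>\<^bsub>B\<^esub> tensor_class R L N h = tensor_class R L N (f + h)"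
  using normal.rcos_sum[OF kernel_normal, of f h] assms
  by (simp add: base_change_def Let_def tensor_group_def FactGroup_def tensor_class_def ring_as_module_simps)

private lemma base_change_abelian_group: "abelian_group B"
proof -
  interpret T: comm_group "tensor_group R L N"
    unfolding tensor_group_def by (rule G.abelian_FactGroup[OF tensor_kernel_subgroup[OF L ring_as_module]])
  have B: "carrier B = carrier (tensor_group R L N)" "ring.zero B = monoid.one (tensor_group R L N)"
    "ring.add B = monoid.mult (tensor_group R L N)"
    by (simp_all add: base_change_def Let_def)
  show ?thesis
    by (rule abelian_groupI) (auto simp: B T.m_ac intro: T.l_inv_ex)
qed

text \<open>As \<open>g\<close> is surjective and \<open>x \<otimes> g a = a x \<otimes> 1\<close>, the elements \<open>x \<otimes> 1\<close> exhaust the tensor product.\<close>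

lemma base_change_map_surj: "base_change_map ` carrier L = carrier B"
proof
  show "base_change_map ` carrier L \<subseteq> carrier B" by (auto simp: base_change_simps base_change_map_def)
  have ex: "\<exists>x\<in>carrier L. f - frag_of (x, \<one>\<^bsub>S\<^esub>) \<in> tensor_kernel R L N"
    if "Poly_Mapping.keys f \<subseteq> carrier L \<times> carrier S" for f
    using that
  proof (induction f rule: frag_induction)
    case zero
    have "frag_of (\<zero>\<^bsub>L\<^esub> \<oplus>\<^bsub>L\<^esub> \<zero>\<^bsub>L\<^esub>, \<one>\<^bsub>S\<^esub>) - frag_of (\<zero>\<^bsub>L\<^esub>, \<one>\<^bsub>S\<^esub>) - frag_of (\<zero>\<^bsub>L\<^esub>, \<one>\<^bsub>S\<^esub>) \<in> tensor_kernel R L N"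
      by (rule relators) auto
    then show ?case by (intro bexI[of _ "\<zero>\<^bsub>L\<^esub>"]) auto
  next
    case (one z)
    then obtain u a where z: "z = (u, g a)" "u \<in> carrier L" "a \<in> carrier R" unfolding surj[symmetric] by auto
    have "frag_of (a \<odot>\<^bsub>L\<^esub> u, \<one>\<^bsub>S\<^esub>) - frag_of (u, g a \<otimes>\<^bsub>S\<^esub> \<one>\<^bsub>S\<^esub>) \<in> tensor_kernel R L N"
      using z by (intro relators) auto
    then have "0 - (frag_of (a \<odot>\<^bsub>L\<^esub> u, \<one>\<^bsub>S\<^esub>) - frag_of (u, g a \<otimes>\<^bsub>S\<^esub> \<one>\<^bsub>S\<^esub>)) \<in> tensor_kernel R L N"
      by (rule kernel_diff[OF kernel_0])
    moreover have "g a \<otimes>\<^bsub>S\<^esub> \<one>\<^bsub>S\<^esub> = g a" using z g_closed by simp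
    ultimately have "frag_of (u, g a) - frag_of (a \<odot>\<^bsub>L\<^esub> u, \<one>\<^bsub>S\<^esub>) \<in> tensor_kernel R L N" by simp
    then show ?case using z by (intro bexI[of _ "a \<odot>\<^bsub>L\<^esub> u"]) auto
  next
    case (diff f h)
    then obtain x y where xy: "x \<in> carrier L" "f - frag_of (x, \<one>\<^bsub>S\<^esub>) \<in> tensor_kernel R L N"
      "y \<in> carrier L" "h - frag_of (y, \<one>\<^bsub>S\<^esub>) \<in> tensor_kernel R L N" by auto
    \<comment> \<open>The induction step concerns a difference, whereas the relators express
      additivity; so x is split as (x - y) + y.\<close>
    have "frag_of ((x \<ominus>\<^bsub>L\<^esub> y) \<oplus>\<^bsub>L\<^esub> y, \<one>\<^bsub>S\<^esub>) - frag_of (x \<ominus>\<^bsub>L\<^esub> y, \<one>\<^bsub>S\<^esub>) - frag_of (y, \<one>\<^bsub>S\<^esub>) \<in> tensor_kernel R L N"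
      using xy by (intro relators) auto
    moreover have "(x \<ominus>\<^bsub>L\<^esub> y) \<oplus>\<^bsub>L\<^esub> y = x" using xy by (simp add: L.M.minus_eq L.M.a_assoc L.M.l_neg)
    ultimately have "(f - frag_of (x, \<one>\<^bsub>S\<^esub>) - (h - frag_of (y, \<one>\<^bsub>S\<^esub>))) +
       (frag_of (x, \<one>\<^bsub>S\<^esub>) - frag_of (x \<ominus>\<^bsub>L\<^esub> y, \<one>\<^bsub>S\<^esub>) - frag_of (y, \<one>\<^bsub>S\<^esub>)) \<in> tensor_kernel R L N"
      by (intro kernel_add[OF kernel_diff[OF xy(2,4)]]) simp
    then show ?case using xy by (intro bexI[of _ "x \<ominus>\<^bsub>L\<^esub> y"]) (auto simp: algebra_simps)
  qed
  show "carrier B \<subseteq> base_change_map ` carrier L"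
  proof
    fix v assume "v \<in> carrier B"
    then obtain f where f: "v = tensor_class R L N f" "Poly_Mapping.keys f \<subseteq> carrier L \<times> carrier S"
      unfolding base_change_simps by blast
    obtain x where x: "x \<in> carrier L" "f - frag_of (x, \<one>\<^bsub>S\<^esub>) \<in> tensor_kernel R L N" using ex[OF f(2)] by blast
    have "v = base_change_map x" unfolding f(1) base_change_map_def by (rule class_eq[OF x(2)])
    then show "v \<in> base_change_map ` carrier L" using x(1) by blast
  qed
qed

lemma base_change_map_add:
  assumes "x \<in> carrier L" "y \<in> carrier L" shows "base_change_map (x \<oplus>\<^bsub>L\<^esub> y)
    = base_change_map x \<oplus>\<^bsub>B\<^esub> base_change_map y"
proof -
  have "frag_of (x \<oplus>\<^bsub>L\<^esub> y, \<one>\<^bsub>S\<^esub>) - frag_of (x, \<one>\<^bsub>S\<^esub>) - frag_of (y, \<one>\<^bsub>S\<^esub>) \<in> tensor_kernel R L N"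
    using assms by (intro relators) auto
  then show ?thesis
    using assms by (simp add: base_change_map_def base_change_add) (simp add: class_eq diff_diff_eq)
qed

lemma base_change_map_smult:
  assumes "a \<in> carrier R" "x \<in> carrier L" shows "base_change_map (a \<odot>\<^bsub>L\<^esub> x) = g a \<odot>\<^bsub>B\<^esub> base_change_map x"
proof -
  have "frag_of (a \<odot>\<^bsub>L\<^esub> x, \<one>\<^bsub>S\<^esub>) - frag_of (x, g a \<otimes>\<^bsub>S\<^esub> \<one>\<^bsub>S\<^esub>) \<in> tensor_kernel R L N"
    using assms by (intro relators) auto
  then show ?thesis
    using assms g_closed unfolding base_change_map_def class_smult[OF g_closed[OF assms(1)]]
    by (simp add: smult_ext_def class_eq)
qed

lemma base_change_map_bracket:
  assumes "x \<in> carrier L" "y \<in> carrier L" shows "base_change_map (lie_bracket L x y)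
    = lie_bracket B (base_change_map x) (base_change_map y)"
  using assms unfolding base_change_map_def
  by (subst class_bracket) (auto simp: bracket_ext_def)

text \<open>Every vector has the form x tensor 1 and every scalar the form g a, so each module law
  is the image of the corresponding law of L.\<close>

lemma base_change_module: "module S B"
proof -
  interpret B: abelian_group B by (rule base_change_abelian_group)
  note g' = ring_hom_closed[OF g] ring_hom_add[OF g, symmetric] ring_hom_mult[OF g, symmetric] ring_hom_one[OF g, symmetric]
  show ?thesis
    by (rule moduleI; (rule S | rule base_change_abelian_group)?; unfold base_change_map_surj[symmetric] surj[symmetric])
      (auto simp: g' L.smult_l_distr L.smult_r_distr L.smult_assoc1 simp flip: base_change_map_add base_change_map_smult)
qed

text \<open>A semilinear functional \<open>f\<close> factors through the tensor product, as \<open>x \<otimes> s\<close> goes to \<open>f x s\<close>.\<close>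

lemma base_change_map_eq_zero_imp:
  assumes x: "x \<in> carrier L" "base_change_map x = \<zero>\<^bsub>B\<^esub>"
    and f: "\<And>x. x \<in> carrier L \<Longrightarrow> f x \<in> carrier S"
      "\<And>x y. x \<in> carrier L \<Longrightarrow> y \<in> carrier L \<Longrightarrow> f (x \<oplus>\<^bsub>L\<^esub> y) = f x \<oplus>\<^bsub>S\<^esub> f y"
      "\<And>a x. a \<in> carrier R \<Longrightarrow> x \<in> carrier L \<Longrightarrow> f (a \<odot>\<^bsub>L\<^esub> x) = g a \<otimes>\<^bsub>S\<^esub> f x"
  shows "f x = \<zero>\<^bsub>S\<^esub>"
proof -
  obtain h where h: "h \<in> hom (free_Abelian_group (carrier L \<times> carrier S)) (add_monoid S)"
    and hf: "\<And>z. z \<in> carrier L \<times> carrier S \<Longrightarrow> h (frag_of z) = f (fst z) \<otimes>\<^bsub>S\<^esub> snd z"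
  proof (rule comm_group.free_Abelian_group_universal[OF S.a_comm_group])
    show "(\<lambda>z. f (fst z) \<otimes>\<^bsub>S\<^esub> snd z) ` (carrier L \<times> carrier S) \<subseteq> carrier (add_monoid S)" using f(1) by auto
  qed blast
  interpret h: group_hom "free_on_pairs L N" "add_monoid S" h
    using h S.a_group G.is_group by (simp add: group_hom_def group_hom_axioms_def free_on_pairs_def ring_as_module_simps)
  have hd: "h (u - v) = h u \<ominus>\<^bsub>S\<^esub> h v" 
    if "Poly_Mapping.keys u \<subseteq> carrier L \<times> carrier S" "Poly_Mapping.keys v \<subseteq> carrier L \<times> carrier S" for u v
  proof -
    have k: "Poly_Mapping.keys (u - v) \<subseteq> carrier L \<times> carrier S" using keys_diff[of u v] that by blast
    have "h u = h (u - v) \<oplus>\<^bsub>S\<^esub> h v"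
      using h.hom_mult[of "u - v" v] that k by (simp add: ring_as_module_simps)
    then show ?thesis using h.hom_closed[of "u - v"] h.hom_closed[of v] k that
      by (simp add: ring_as_module_simps S.minus_eq S.a_assoc S.r_neg)
  qed
  have canc: "((a \<oplus>\<^bsub>S\<^esub> b) \<ominus>\<^bsub>S\<^esub> a) \<ominus>\<^bsub>S\<^esub> b = \<zero>\<^bsub>S\<^esub>" if "a \<in> carrier S" "b \<in> carrier S" for a b
  proof -
    have "(a \<oplus>\<^bsub>S\<^esub> b) \<ominus>\<^bsub>S\<^esub> a = b" using that by (simp add: S.minus_eq S.a_comm[of a b] S.a_assoc S.r_neg)
    then show ?thesis using that by (simp add: S.minus_eq S.r_neg)
  qed
  \<comment> \<open>Each relator is a defect of biadditivity or of balancedness over R, and the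
    pairing of x and s to \<open>f x\<close> times s has no such defect.\<close>
  have rel: "h r = \<zero>\<^bsub>S\<^esub>" if r: "r \<in> tensor_relators R L N" for r
  proof -
    consider (1) x y a where "r = frag_of (x \<oplus>\<^bsub>L\<^esub> y, a) - frag_of (x, a)
      - frag_of (y, a)" "x \<in> carrier L" "y \<in> carrier L" "a \<in> carrier S"
      | (2) x a b where "r = frag_of (x, a \<oplus>\<^bsub>S\<^esub> b) - frag_of (x, a)
        - frag_of (x, b)" "x \<in> carrier L" "a \<in> carrier S" "b \<in> carrier S"
      | (3) c x a where "r = frag_of (c \<odot>\<^bsub>L\<^esub> x, a)
        - frag_of (x, g c \<otimes>\<^bsub>S\<^esub> a)" "c \<in> carrier R" "x \<in> carrier L" "a \<in> carrier S"
      using r unfolding tensor_relators_def ring_as_module_simps by blast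
    then show ?thesis
    proof cases
      case 1
      then have k: "Poly_Mapping.keys (frag_of (x \<oplus>\<^bsub>L\<^esub> y, a) - frag_of (x, a)) \<subseteq> carrier L \<times> carrier S"
        using keys_diff[of "frag_of (x \<oplus>\<^bsub>L\<^esub> y, a)" "frag_of (x, a)"] by auto
      have "h r = (h (frag_of (x \<oplus>\<^bsub>L\<^esub> y, a)) \<ominus>\<^bsub>S\<^esub> h (frag_of (x, a))) \<ominus>\<^bsub>S\<^esub> h (frag_of (y, a))"
        using 1 k by (simp add: hd)
      then show ?thesis
        using 1 f(1) by (simp add: hf f(2) S.l_distr canc)
    next
      case 2
      then have k: "Poly_Mapping.keys (frag_of (x, a \<oplus>\<^bsub>S\<^esub> b) - frag_of (x, a)) \<subseteq> carrier L \<times> carrier S"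
        using keys_diff[of "frag_of (x, a \<oplus>\<^bsub>S\<^esub> b)" "frag_of (x, a)"] by auto
      have "h r = (h (frag_of (x, a \<oplus>\<^bsub>S\<^esub> b)) \<ominus>\<^bsub>S\<^esub> h (frag_of (x, a))) \<ominus>\<^bsub>S\<^esub> h (frag_of (x, b))"
        using 2 k by (simp add: hd)
      then show ?thesis
        using 2 f(1) by (simp add: hf S.r_distr canc)
    next
      case 3
      then show ?thesis using f(1) g_closed by (simp add: hd hf f S.minus_eq S.m_ac S.r_neg)
    qed
  qed
  have "h u = \<zero>\<^bsub>S\<^esub>" if "u \<in> tensor_kernel R L N" for u
    using that unfolding tensor_kernel_def
  proof (induction rule: generate.induct)
    case (incl r) then show ?case by (rule rel)
  next
    case (inv r)
    then have "r \<in> carrier (free_on_pairs L N)" using tensor_relators_carrier[OF L ring_as_module] by blast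
    then show ?case using rel[OF inv] h.hom_inv[of r] monoid.inv_one[OF S.add.monoid_axioms] by simp
  next
    case (eng a b)
    then have "a \<in> carrier (free_on_pairs L N)" "b \<in> carrier (free_on_pairs L N)"
      using subgroup.subset[OF tensor_kernel_subgroup[OF L ring_as_module]] by (auto simp: tensor_kernel_def)
    then show ?case using eng h.hom_mult[of a b] by simp
  qed (use h.hom_one in simp)
  moreover have "frag_of (x, \<one>\<^bsub>S\<^esub>) \<in> tensor_kernel R L N"
  proof -
    have "frag_of (x, \<one>\<^bsub>S\<^esub>) \<in> base_change_map x"
      using kernel_0 by (simp add: base_change_map_def tensor_class_member[OF L ring_as_module])
    then show ?thesis using x(2) by (simp add: base_change_simps)
  qed
  ultimately show ?thesis using hf[of "(x, \<one>\<^bsub>S\<^esub>)"] x(1) f(1)[OF x(1)] by simp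
qed

end

section \<open>Truncations of a discrete valuation ring\<close>

locale truncation =
  fixes R :: "('a, 'r) ring_scheme" (structure) and \<pi> :: 'a
  assumes dvr: "discrete_valuation_ring R" and \<pi>: "\<pi> \<in> carrier R"
    and max: "maximalideal (PIdl \<pi>) R"
begin

sublocale discrete_valuation_ring R by (rule dvr)

definition cls :: "nat \<Rightarrow> 'a \<Rightarrow> 'a set" where "cls j = quot_map R (PIdl (\<pi> [^] j))"

text \<open>Otherwise the zero ideal would be maximal and R would be a field. This is what permits
  powers of \<pi> to be cancelled in R.\<close>

lemma \<pi>_nonzero: "\<pi> \<noteq> \<zero>"
proof
  assume "\<pi> = \<zero>"
  then have "PIdl \<pi> = {\<zero>}" by (auto simp: cgenideal_def intro!: exI[of _ \<zero>])
  then show False using max zeromaximalideal_eq_field not_field by simp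
qed

lemma pow_closed: "\<pi> [^] (j :: nat) \<in> carrier R" using \<pi> by simp

lemma ideal_pow: "ideal (PIdl (\<pi> [^] (j :: nat))) R" by (rule cgenideal_ideal[OF pow_closed])

lemma cring_trunc: "cring (trunc_ring R \<pi> j)"
  unfolding trunc_ring_def by (rule ideal.quotient_is_cring[OF ideal_pow is_cring])

lemma cls_hom: "cls j \<in> ring_hom R (trunc_ring R \<pi> j)"
  using ideal.rcos_ring_hom[OF ideal_pow] by (simp add: cls_def quot_map_def[abs_def] trunc_ring_def)

lemma cls_surj: "cls j ` carrier R = carrier (trunc_ring R \<pi> j)"
  by (auto simp: cls_def quot_map_def trunc_ring_def FactRing_simps)

lemmas cls_closed [simp] = ring_hom_closed[OF cls_hom]
lemmas cls_add = ring_hom_add[OF cls_hom]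
lemmas cls_mult = ring_hom_mult[OF cls_hom]
lemmas cls_one = ring_hom_one[OF cls_hom]

lemma cls_zero_iff:
  assumes r: "r \<in> carrier R" shows "cls j r = \<zero>\<^bsub>trunc_ring R \<pi> j\<^esub> \<longleftrightarrow> (\<exists>d\<in>carrier R. r = d \<otimes> \<pi> [^] j)"
proof -
  interpret ideal "PIdl (\<pi> [^] j)" R by (rule ideal_pow)
  have "cls j r = \<zero>\<^bsub>trunc_ring R \<pi> j\<^esub> \<longleftrightarrow> r \<in> PIdl (\<pi> [^] j)"
    using rcos_const_imp_mem[OF r] a_rcos_const[of r]
      unfolding cls_def quot_map_def trunc_ring_def FactRing_def ring.simps
    by blast
  then show ?thesis unfolding cgenideal_def by blast
qed

text \<open>For j at most i the ideal of \<pi>^i lies in that of \<pi>^j and is absorbed when the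
  two are added, so the sum of ideal and coset is the coset of the same representative.\<close>

lemma trunc_map_cls:
  assumes "j \<le> i" "r \<in> carrier R" shows "trunc_map R \<pi> j (cls i r) = cls j r"
proof -
  have sub: "PIdl (\<pi> [^] i) \<subseteq> PIdl (\<pi> [^] j)"
  proof
    fix x assume "x \<in> PIdl (\<pi> [^] i)"
    then obtain y where y: "y \<in> carrier R" "x = y \<otimes> \<pi> [^] i" by (auto simp: cgenideal_def)
    have "\<pi> [^] i = \<pi> [^] (i - j) \<otimes> \<pi> [^] j" using assms \<pi> by (simp add: nat_pow_mult)
    then have "x = (y \<otimes> \<pi> [^] (i - j)) \<otimes> \<pi> [^] j" using y \<pi> by (simp add: m_assoc)
    then show "x \<in> PIdl (\<pi> [^] j)" using y \<pi> by (auto simp: cgenideal_def)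
  qed
  interpret I: ideal "PIdl (\<pi> [^] i)" R by (rule ideal_pow)
  interpret J: ideal "PIdl (\<pi> [^] j)" R by (rule ideal_pow)
  have "PIdl (\<pi> [^] j) <+> PIdl (\<pi> [^] i) = PIdl (\<pi> [^] j)"
  proof
    show "PIdl (\<pi> [^] j) <+> PIdl (\<pi> [^] i) \<subseteq> PIdl (\<pi> [^] j)"
      using sub J.a_closed by (fastforce simp: set_add_def set_mult_def)
    show "PIdl (\<pi> [^] j) \<subseteq> PIdl (\<pi> [^] j) <+> PIdl (\<pi> [^] i)"
    proof
      fix x assume x: "x \<in> PIdl (\<pi> [^] j)"
      then have "x \<oplus> \<zero> = x" using J.a_Hcarr by simp
      then have "x \<in> (\<Union>h\<in>PIdl (\<pi> [^] j). \<Union>k\<in>PIdl (\<pi> [^] i). {h \<oplus> k})"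
        using x I.zero_closed by (intro UN_I[of x] UN_I[of \<zero>]) simp_all
      then show "x \<in> PIdl (\<pi> [^] j) <+> PIdl (\<pi> [^] i)" by (simp add: set_add_def set_mult_def)
    qed
  qed
  then show ?thesis
    using a_setmult_rcos_assoc[OF J.a_subset I.a_subset assms(2)] by (simp add: trunc_map_def cls_def quot_map_def)
qed

lemma cls_obtain:
  assumes "a \<in> carrier (trunc_ring R \<pi> j)" obtains r where "r \<in> carrier R" "a = cls j r"
  using assms unfolding cls_surj[symmetric] by blast

lemma trunc_map_hom:
  assumes "j \<le> i" shows "trunc_map R \<pi> j \<in> ring_hom (trunc_ring R \<pi> i) (trunc_ring R \<pi> j)"
  by (rule ring_hom_memI; (elim cls_obtain)?)
    (use assms in \<open>simp_all add: trunc_map_cls flip: cls_add cls_mult cls_one\<close>)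

lemma trunc_map_surj: "j \<le> i \<Longrightarrow> trunc_map R \<pi> j ` carrier (trunc_ring R \<pi> i) = carrier (trunc_ring R \<pi> j)"
  unfolding cls_surj[symmetric] by (simp add: image_image trunc_map_cls)

lemma residue_field_eq: "residue_field R \<pi> = trunc_ring R \<pi> 1"
  using \<pi> by (simp add: residue_field_def trunc_ring_def)

lemma field_trunc: "field (trunc_ring R \<pi> 1)"
  using maximalideal.quotient_is_field[OF max is_cring] residue_field_eq by (simp add: residue_field_def)

text \<open>The hypothesis lifts to an equation \<pi>^i r = d \<pi>^j in the domain R. Cancelling
  \<pi>^i leaves r = \<pi> d \<pi>^(j-i-1), where i < j leaves at least one factor \<pi>.\<close>

lemma trunc_torsion:
  assumes ij: "i < j" and a: "a \<in> carrier (trunc_ring R \<pi> j)"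
    and z: "cls j (\<pi> [^] i) \<otimes>\<^bsub>trunc_ring R \<pi> j\<^esub> a = \<zero>\<^bsub>trunc_ring R \<pi> j\<^esub>"
  shows "\<exists>d\<in>carrier (trunc_ring R \<pi> j). a = cls j \<pi> \<otimes>\<^bsub>trunc_ring R \<pi> j\<^esub> d"
proof -
  obtain r where r: "r \<in> carrier R" "a = cls j r" using a by (rule cls_obtain)
  have "cls j (\<pi> [^] i \<otimes> r) = \<zero>\<^bsub>trunc_ring R \<pi> j\<^esub>" using z r \<pi> by (simp add: cls_mult)
  then obtain d where d: "d \<in> carrier R" "\<pi> [^] i \<otimes> r = d \<otimes> \<pi> [^] j"
    using cls_zero_iff[of "\<pi> [^] i \<otimes> r" j] r \<pi> by auto
  have "\<pi> [^] j = \<pi> [^] i \<otimes> (\<pi> [^] (j - i - 1) \<otimes> \<pi>)"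
    using \<pi> ij nat_pow_mult[of \<pi> i "Suc (j - i - 1)"] by simp
  then have "\<pi> [^] i \<otimes> r = \<pi> [^] i \<otimes> (\<pi> \<otimes> (d \<otimes> \<pi> [^] (j - i - 1)))" using d \<pi> by (simp add: m_ac)
  moreover have "\<pi> [^] i \<noteq> \<zero>" using \<pi> \<pi>_nonzero by (induction i) (auto simp: integral_iff)
  ultimately have "r = \<pi> \<otimes> (d \<otimes> \<pi> [^] (j - i - 1))" using r d \<pi> by (subst (asm) m_lcancel) auto
  then show ?thesis using r d \<pi> by (intro bexI[of _ "cls j (d \<otimes> \<pi> [^] (j - i - 1))"]) (simp_all flip: cls_mult)
qed

lemma trunc_residue_zero:
  assumes j: "1 \<le> j" and a: "a \<in> carrier (trunc_ring R \<pi> j)"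
    and z: "trunc_map R \<pi> 1 a = \<zero>\<^bsub>trunc_ring R \<pi> 1\<^esub>"
  shows "\<exists>d\<in>carrier (trunc_ring R \<pi> j). a = cls j \<pi> \<otimes>\<^bsub>trunc_ring R \<pi> j\<^esub> d"
proof -
  obtain r where r: "r \<in> carrier R" "a = cls j r" using a by (rule cls_obtain)
  then obtain d where "d \<in> carrier R" "r = d \<otimes> \<pi>"
    using z trunc_map_cls[OF j r(1)] cls_zero_iff[OF r(1), of 1] \<pi> by auto
  then show ?thesis using r \<pi> by (intro bexI[of _ "cls j d"]) (simp_all add: m_comm flip: cls_mult)
qed

text \<open>The coordinates of x are killed by the same power of \<pi>, so the statement for the
  ring applies to each of them.\<close>

lemma module_torsion:
  assumes M: "module (trunc_ring R \<pi> j) M" and b: "is_basis (trunc_ring R \<pi> j) M n b" and ij: "i < j"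
    and x: "x \<in> carrier M" and z: "cls j (\<pi> [^] i) \<odot>\<^bsub>M\<^esub> x = \<zero>\<^bsub>M\<^esub>"
  shows "\<exists>w\<in>carrier M. x = cls j \<pi> \<odot>\<^bsub>M\<^esub> w"
proof -
  let ?K = "trunc_ring R \<pi> j"
  interpret M: module ?K M by fact
  obtain co where co: "\<And>x i. x \<in> carrier M \<Longrightarrow> i < n \<Longrightarrow> co x i \<in> carrier ?K"
    and ex: "\<And>x. x \<in> carrier M \<Longrightarrow> x = (\<Oplus>\<^bsub>M\<^esub>i\<in>{..<n}. co x i \<odot>\<^bsub>M\<^esub> b i)"
    and "\<And>x y i. x \<in> carrier M \<Longrightarrow> y \<in> carrier M \<Longrightarrow> i < n \<Longrightarrow> co (x \<oplus>\<^bsub>M\<^esub> y) i = co x i \<oplus>\<^bsub>?K\<^esub> co y i"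
    and sm: "\<And>a x i. a \<in> carrier ?K \<Longrightarrow> x \<in> carrier M \<Longrightarrow> i < n \<Longrightarrow> co (a \<odot>\<^bsub>M\<^esub> x) i = a \<otimes>\<^bsub>?K\<^esub> co x i"
    and "\<And>i j. i < n \<Longrightarrow> j < n \<Longrightarrow> co (b j) i = (if i = j then \<one>\<^bsub>?K\<^esub> else \<zero>\<^bsub>?K\<^esub>)"
    by (rule basis_coordinates[OF M b]) blast
  have "\<exists>d\<in>carrier ?K. co x l = cls j \<pi> \<otimes>\<^bsub>?K\<^esub> d" if l: "l < n" for l
  proof (rule trunc_torsion[OF ij])
    have "co \<zero>\<^bsub>M\<^esub> l = \<zero>\<^bsub>?K\<^esub>" using sm[of "\<zero>\<^bsub>?K\<^esub>" "\<zero>\<^bsub>M\<^esub>" l] co[of "\<zero>\<^bsub>M\<^esub>" l] l by simp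
    then show "cls j (\<pi> [^] i) \<otimes>\<^bsub>?K\<^esub> co x l = \<zero>\<^bsub>?K\<^esub>" using sm[of "cls j (\<pi> [^] i)" x l] x z l \<pi> by simp
  qed (use co x l in auto)
  then have "\<exists>w\<in>carrier M. (\<Oplus>\<^bsub>M\<^esub>i\<in>{..<n}. co x i \<odot>\<^bsub>M\<^esub> b i) = cls j \<pi> \<odot>\<^bsub>M\<^esub> w"
    using \<pi> by (intro basis_smult_range[OF M b]) auto
  then show ?thesis using ex[OF x] by simp
qed

text \<open>The coordinates reduced modulo \<pi> play the role of the dual basis of the vector space
  M/\<pi>M, without that quotient being formed: they are semilinear on M and their common kernel is
  \<pi>M. They are used for L and for its lifts alike.\<close>

lemma residue_coordinates:
  assumes j: "1 \<le> j" and M: "module (trunc_ring R \<pi> j) M" and b: "is_basis (trunc_ring R \<pi> j) M n b"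
  obtains l where "\<And>i x. x \<in> carrier M \<Longrightarrow> i < n \<Longrightarrow> l i x \<in> carrier (trunc_ring R \<pi> 1)"
    and "\<And>i x y. x \<in> carrier M \<Longrightarrow> y \<in> carrier M \<Longrightarrow> i < n \<Longrightarrow> l i (x \<oplus>\<^bsub>M\<^esub> y) = l i x \<oplus>\<^bsub>trunc_ring R \<pi> 1\<^esub> l i y"
    and "\<And>i a x. a \<in> carrier (trunc_ring R \<pi> j) \<Longrightarrow> x \<in> carrier M \<Longrightarrow> i < n \<Longrightarrow>
      l i (a \<odot>\<^bsub>M\<^esub> x) = trunc_map R \<pi> 1 a \<otimes>\<^bsub>trunc_ring R \<pi> 1\<^esub> l i x"
    and "\<And>i m. i < n \<Longrightarrow> m < n \<Longrightarrow> l i (b m) = (if i = m then \<one>\<^bsub>trunc_ring R \<pi> 1\<^esub> else \<zero>\<^bsub>trunc_ring R \<pi> 1\<^esub>)"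
    and "\<And>x. x \<in> carrier M \<Longrightarrow> (\<And>i. i < n \<Longrightarrow> l i x = \<zero>\<^bsub>trunc_ring R \<pi> 1\<^esub>) \<Longrightarrow> \<exists>w\<in>carrier M. x = cls j \<pi> \<odot>\<^bsub>M\<^esub> w"
proof -
  let ?K = "trunc_ring R \<pi> j" and ?F = "trunc_ring R \<pi> 1"
  interpret M: module ?K M by fact
  interpret F: cring ?F by (rule cring_trunc)
  obtain co where co: "\<And>x i. x \<in> carrier M \<Longrightarrow> i < n \<Longrightarrow> co x i \<in> carrier ?K"
    and ex: "\<And>x. x \<in> carrier M \<Longrightarrow> x = (\<Oplus>\<^bsub>M\<^esub>i\<in>{..<n}. co x i \<odot>\<^bsub>M\<^esub> b i)"
    and add: "\<And>x y i. x \<in> carrier M \<Longrightarrow> y \<in> carrier M \<Longrightarrow> i < n \<Longrightarrow> co (x \<oplus>\<^bsub>M\<^esub> y) i = co x i \<oplus>\<^bsub>?K\<^esub> co y i"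
    and sm: "\<And>a x i. a \<in> carrier ?K \<Longrightarrow> x \<in> carrier M \<Longrightarrow> i < n \<Longrightarrow> co (a \<odot>\<^bsub>M\<^esub> x) i = a \<otimes>\<^bsub>?K\<^esub> co x i"
    and ba: "\<And>i j. i < n \<Longrightarrow> j < n \<Longrightarrow> co (b j) i = (if i = j then \<one>\<^bsub>?K\<^esub> else \<zero>\<^bsub>?K\<^esub>)"
    by (rule basis_coordinates[OF M b]) blast
  note h = trunc_map_hom[OF j]
  note h' = ring_hom_closed[OF h] ring_hom_add[OF h] ring_hom_mult[OF h] ring_hom_one[OF h]
    ring_hom_zero[OF h cring.axioms(1)[OF cring_trunc] cring.axioms(1)[OF cring_trunc]]
  show thesis
  proof (rule that[of "\<lambda>i x. trunc_map R \<pi> 1 (co x i)"])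
    fix x assume x: "x \<in> carrier M" and z: "\<And>i. i < n \<Longrightarrow> trunc_map R \<pi> 1 (co x i) = \<zero>\<^bsub>?F\<^esub>"
    have "\<exists>w\<in>carrier M. (\<Oplus>\<^bsub>M\<^esub>i\<in>{..<n}. co x i \<odot>\<^bsub>M\<^esub> b i) = cls j \<pi> \<odot>\<^bsub>M\<^esub> w"
      using \<pi> x co by (intro basis_smult_range[OF M b] trunc_residue_zero[OF j] z) auto
    then show "\<exists>w\<in>carrier M. x = cls j \<pi> \<odot>\<^bsub>M\<^esub> w" using ex[OF x] by simp
  qed (simp_all add: co add sm ba h' del: One_nat_def)
qed

end

section \<open>Lifts of a Lie algebra over a truncation\<close>

locale lie_truncation = truncation R \<pi> for R :: "('a, 'r) ring_scheme" (structure) and \<pi> :: 'a +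
  fixes k :: nat and L :: "('a set, 'b) lie_algebra"
  assumes k: "1 \<le> k" and lie: "lie_algebra (trunc_ring R \<pi> k) L"
begin

interpretation L: lie_algebra "trunc_ring R \<pi> k" L by (rule lie)

definition "K = trunc_ring R \<pi> (k + 1)"
definition "F = residue_field R \<pi>"
text \<open>L over R, as the base change to the residue field requires. The companion
  \<open>LK\<close> is L over the ring of the lifts, so that the map of a lift is linear over a
  single ring.\<close>

definition "LR = restrict_scalars (cls k) L"
definition "LK = restrict_scalars (trunc_map R \<pi> k) L"
definition "Lbar = reduction R \<pi> k L"
definition "red = base_change_map R F (cls 1) LR"

lemma K_cring: "cring K" unfolding K_def by (rule cring_trunc)

lemma F_eq: "F = trunc_ring R \<pi> 1" by (simp only: F_def residue_field_eq)

lemma F_field: "field F" unfolding F_eq by (rule field_trunc)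
lemma F_cring: "cring F" unfolding F_eq by (rule cring_trunc)

lemma Lbar_eq: "Lbar = base_change R (cls 1) F LR"
  using \<pi> by (simp add: Lbar_def reduction_def F_def LR_def cls_def)

lemma LK_module: "module K LK"
  unfolding LK_def K_def by (rule restrict_scalars_module[OF L.module_axioms cring_trunc trunc_map_hom]) simp

lemma LR_module: "module R LR"
  unfolding LR_def by (rule restrict_scalars_module[OF L.module_axioms is_cring cls_hom])

lemma LK_cring: "carrier LK = carrier L" "ring.zero LK = ring.zero L" "ring.add LK = ring.add L"
  "lie_bracket LK = lie_bracket L" "smult LK a = smult L (trunc_map R \<pi> k a)"
  by (simp_all add: LK_def)

lemma LR_simps: "carrier LR = carrier L" "ring.zero LR = ring.zero L" "ring.add LR = ring.add L"
  "lie_bracket LR = lie_bracket L" "smult LR a = smult L (cls k a)"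
  by (simp_all add: LR_def)

lemma cls1_hom: "cls 1 \<in> ring_hom R F" unfolding F_eq by (rule cls_hom)
lemma cls1_surj: "cls 1 ` carrier R = carrier F" unfolding F_eq by (rule cls_surj)

lemma LR_bracket:
  "x \<in> carrier LR \<Longrightarrow> y \<in> carrier LR \<Longrightarrow> lie_bracket LR x y \<in> carrier LR"
  "\<lbrakk>x \<in> carrier LR; y \<in> carrier LR; z \<in> carrier LR\<rbrakk> \<Longrightarrow>
     lie_bracket LR (x \<oplus>\<^bsub>LR\<^esub> y) z = lie_bracket LR x z \<oplus>\<^bsub>LR\<^esub> lie_bracket LR y z"
  "\<lbrakk>x \<in> carrier LR; y \<in> carrier LR; z \<in> carrier LR\<rbrakk> \<Longrightarrow>
     lie_bracket LR x (y \<oplus>\<^bsub>LR\<^esub> z) = lie_bracket LR x y \<oplus>\<^bsub>LR\<^esub> lie_bracket LR x z"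
  "\<lbrakk>a \<in> carrier R; x \<in> carrier LR; y \<in> carrier LR\<rbrakk> \<Longrightarrow>
     lie_bracket LR (a \<odot>\<^bsub>LR\<^esub> x) y = a \<odot>\<^bsub>LR\<^esub> lie_bracket LR x y"
  "\<lbrakk>a \<in> carrier R; x \<in> carrier LR; y \<in> carrier LR\<rbrakk> \<Longrightarrow>
     lie_bracket LR x (a \<odot>\<^bsub>LR\<^esub> y) = a \<odot>\<^bsub>LR\<^esub> lie_bracket LR x y"
  by (simp_all add: LR_simps L.bracket_closed L.bracket_add_left L.bracket_add_right
      L.bracket_smult_left L.bracket_smult_right)

section \<open>The reduction map of L and its kernel\<close>

lemma red_surj: "red ` carrier L = carrier Lbar"
  unfolding Lbar_eq red_def
  by (subst base_change_map_surj[OF F_cring LR_module cls1_hom cls1_surj LR_bracket, symmetric]) (simp_all add: LR_simps)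

lemma red_add: "x \<in> carrier L \<Longrightarrow> y \<in> carrier L \<Longrightarrow> red (x \<oplus>\<^bsub>L\<^esub> y) = red x \<oplus>\<^bsub>Lbar\<^esub> red y"
  unfolding Lbar_eq red_def using base_change_map_add[OF F_cring LR_module cls1_hom cls1_surj LR_bracket]
  by (simp add: LR_simps)

lemma red_bracket: "x \<in> carrier L \<Longrightarrow> y \<in> carrier L \<Longrightarrow> red (lie_bracket L x y) = lie_bracket Lbar (red x) (red y)"
  unfolding Lbar_eq red_def using base_change_map_bracket[OF F_cring LR_module cls1_hom cls1_surj LR_bracket]
  by (simp add: LR_simps)

lemma red_cls: "a \<in> carrier R \<Longrightarrow> x \<in> carrier L \<Longrightarrow> red (cls k a \<odot>\<^bsub>L\<^esub> x) = cls 1 a \<odot>\<^bsub>Lbar\<^esub> red x"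
  unfolding Lbar_eq red_def using base_change_map_smult[OF F_cring LR_module cls1_hom cls1_surj LR_bracket]
  by (simp add: LR_simps)

lemma red_smult:
  assumes "a \<in> carrier K" "x \<in> carrier L"
  shows "red (a \<odot>\<^bsub>LK\<^esub> x) = trunc_map R \<pi> 1 a \<odot>\<^bsub>Lbar\<^esub> red x"
proof -
  obtain r where r: "r \<in> carrier R" "a = cls (k + 1) r" using assms(1) unfolding K_def by (rule cls_obtain)
  have "trunc_map R \<pi> k a = cls k r" "trunc_map R \<pi> 1 a = cls 1 r"
    unfolding r(2) using r(1) by (simp_all only: trunc_map_cls le_add1 le_add2)
  then show ?thesis using red_cls[OF r(1) assms(2)] by (simp only: LK_cring)
qed

lemma Lbar_module: "module F Lbar"
  unfolding Lbar_eq by (rule base_change_module[OF F_cring LR_module cls1_hom cls1_surj LR_bracket])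

text \<open>The residue coordinates of L are semilinear functionals and so factor through the tensor
  product. If x tensor 1 vanishes, they all vanish at x, which puts x into \<pi>L. Conversely \<pi>
  acts as zero over the residue field.\<close>

lemma red_zero_iff:
  assumes x: "x \<in> carrier L"
  shows "red x = \<zero>\<^bsub>Lbar\<^esub> \<longleftrightarrow> (\<exists>w\<in>carrier L. x = cls k \<pi> \<odot>\<^bsub>L\<^esub> w)"
proof
  assume z: "red x = \<zero>\<^bsub>Lbar\<^esub>"
  obtain n b where b: "is_basis (trunc_ring R \<pi> k) L n b" using L.free_of_finite_rank by blast
  obtain l where l: "\<And>i x. x \<in> carrier L \<Longrightarrow> i < n \<Longrightarrow> l i x \<in> carrier F"
    "\<And>i x y. x \<in> carrier L \<Longrightarrow> y \<in> carrier L \<Longrightarrow> i < n \<Longrightarrow> l i (x \<oplus>\<^bsub>L\<^esub> y) = l i x \<oplus>\<^bsub>F\<^esub> l i y"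
    "\<And>i a x. a \<in> carrier (trunc_ring R \<pi> k) \<Longrightarrow> x \<in> carrier L \<Longrightarrow> i < n \<Longrightarrow> l i (a \<odot>\<^bsub>L\<^esub> x) = trunc_map R \<pi> 1 a \<otimes>\<^bsub>F\<^esub> l i x"
    and l0: "\<And>x. x \<in> carrier L \<Longrightarrow> (\<And>i. i < n \<Longrightarrow> l i x = \<zero>\<^bsub>F\<^esub>) \<Longrightarrow> \<exists>w\<in>carrier L. x = cls k \<pi> \<odot>\<^bsub>L\<^esub> w"
    unfolding F_eq by (rule residue_coordinates[OF k L.module_axioms b]) blast
  have "l i x = \<zero>\<^bsub>F\<^esub>" if i: "i < n" for i
  proof (rule base_change_map_eq_zero_imp[OF F_cring LR_module cls1_hom cls1_surj LR_bracket])
    show "base_change_map R F (cls 1) LR x = \<zero>\<^bsub>base_change R (cls 1) F LR\<^esub>" using z by (simp only: red_def Lbar_eq)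
    show "l i (a \<odot>\<^bsub>LR\<^esub> x) = cls 1 a \<otimes>\<^bsub>F\<^esub> l i x" if "a \<in> carrier R" "x \<in> carrier LR" for a x
      using l(3)[of "cls k a" x i] i that trunc_map_cls[OF k that(1)] by (simp add: LR_simps)
  qed (use l(1,2) i x in \<open>simp_all add: LR_simps\<close>)
  then show "\<exists>w\<in>carrier L. x = cls k \<pi> \<odot>\<^bsub>L\<^esub> w" by (rule l0[OF x])
next
  interpret Lbar: module F Lbar by (rule Lbar_module)
  assume "\<exists>w\<in>carrier L. x = cls k \<pi> \<odot>\<^bsub>L\<^esub> w"
  then obtain w where w: "w \<in> carrier L" "x = cls k \<pi> \<odot>\<^bsub>L\<^esub> w" by blast
  have "cls 1 \<pi> = \<zero>\<^bsub>F\<^esub>" unfolding F_eq using cls_zero_iff[OF \<pi>, of 1] \<pi> by (auto intro!: bexI[of _ \<one>])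
  moreover have "red w \<in> carrier Lbar" using red_surj w by blast
  ultimately show "red x = \<zero>\<^bsub>Lbar\<^esub>" unfolding w(2) using red_cls[OF \<pi> w(1)] by simp
qed

sublocale lifting_problem K F "trunc_map R \<pi> 1" LK Lbar red "cls (k + 1) \<pi>" "cls (k + 1) (\<pi> [^] k)"
proof (rule lifting_problem.intro)
  show "cring K" "cring F" "module K LK" "module F Lbar" by (rule K_cring F_cring LK_module Lbar_module)+
  have pk: "\<pi> [^] k \<in> carrier R" using \<pi> by simp
  show "cls (k + 1) \<pi> \<in> carrier K" "cls (k + 1) (\<pi> [^] k) \<in> carrier K"
    unfolding K_def using \<pi> pk by (simp_all del: One_nat_def)
  have "\<pi> \<otimes> \<pi> [^] k = \<one> \<otimes> \<pi> [^] (k + 1)" using \<pi> by (simp add: m_comm)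
  then have "cls (k + 1) (\<pi> \<otimes> \<pi> [^] k) = \<zero>\<^bsub>K\<^esub>"
    unfolding K_def using cls_zero_iff[of "\<pi> \<otimes> \<pi> [^] k" "k + 1"] \<pi> by blast
  then show "cls (k + 1) \<pi> \<otimes>\<^bsub>K\<^esub> cls (k + 1) (\<pi> [^] k) = \<zero>\<^bsub>K\<^esub>" unfolding K_def using cls_mult[OF \<pi> pk] by simp
  \<comment> \<open>Here k at least 1 enters: 2k = (k - 1) + (k + 1), so the square is divisible by
    \<pi>^(k+1).\<close>
  have "\<pi> [^] k \<otimes> \<pi> [^] k = \<pi> [^] (k - 1) \<otimes> \<pi> [^] (k + 1)" 
    using nat_pow_mult[OF \<pi>, of "k - 1" "k + 1"] nat_pow_mult[OF \<pi>, of k k] k by simp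
  then have "cls (k + 1) (\<pi> [^] k \<otimes> \<pi> [^] k) = \<zero>\<^bsub>K\<^esub>"
    unfolding K_def using cls_zero_iff[of "\<pi> [^] k \<otimes> \<pi> [^] k" "k + 1"] \<pi> by blast
  then show "cls (k + 1) (\<pi> [^] k) \<otimes>\<^bsub>K\<^esub> cls (k + 1) (\<pi> [^] k) = \<zero>\<^bsub>K\<^esub>" unfolding K_def using cls_mult[OF pk pk] by simp
  show "trunc_map R \<pi> 1 ` carrier K = carrier F" unfolding K_def F_eq by (rule trunc_map_surj) simp
qed (simp_all only: LK_cring(1-4) red_surj red_add red_bracket red_smult)

lemma cls1_\<pi>: "cls 1 \<pi> = \<zero>\<^bsub>F\<^esub>"
  unfolding F_eq using cls_zero_iff[OF \<pi>, of 1] \<pi> by (auto intro!: bexI[of _ \<one>])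

lemma trunc_map_trunc_map: "a \<in> carrier K \<Longrightarrow> trunc_map R \<pi> 1 (trunc_map R \<pi> k a) = trunc_map R \<pi> 1 a"
  unfolding K_def using k by (elim cls_obtain) (simp add: trunc_map_cls del: One_nat_def)

lemma trunc_map_k_cls: "r \<in> carrier R \<Longrightarrow> trunc_map R \<pi> k (cls (k + 1) r) = cls k r"
  by (rule trunc_map_cls) simp_all

text \<open>The reductions of \<open>M\<close> and of \<open>L\<close> are vector spaces of the same dimension \<open>n\<close>, so that the
  surjection between them is injective: if \<open>x\<close> is in its kernel, then the \<open>n\<close> preimages \<open>m j\<close> of a
  basis are linearly dependent together with \<open>x\<close> modulo \<open>\<pi>\<close>, and in such a relation all \<open>m j\<close> have
  coefficient \<open>0\<close>.\<close>

lemma lift_red_kernel: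
  assumes M: "is_lift R \<pi> k L M p" and x: "x \<in> carrier M"
  shows "red (p x) = \<zero>\<^bsub>Lbar\<^esub> \<longleftrightarrow> (\<exists>w\<in>carrier M. x = cls (k + 1) \<pi> \<odot>\<^bsub>M\<^esub> w)"
proof -
  interpret F: field F by (rule F_field)
  interpret Lbar: module F Lbar by (rule Lbar_module)
  have MK: "lie_algebra K M" and p: "p \<in> linear_maps K M LK" and ps: "p ` carrier M = carrier L"
    using M by (auto simp: is_lift_def lie_hom_iff K_def LK_def)
  interpret M: lie_algebra K M by (rule MK)
  note pD = linear_mapsD[OF p, unfolded LK_cring]
  let ?\<rho> = "trunc_map R \<pi> 1"
  have s: "cls (k + 1) \<pi> \<in> carrier K" unfolding K_def using \<pi> by (rule cls_closed)
  have ker: "red (p y) = \<zero>\<^bsub>Lbar\<^esub>" if y: "\<exists>w\<in>carrier M. y = cls (k + 1) \<pi> \<odot>\<^bsub>M\<^esub> w" for y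
  proof -
    obtain w where w: "w \<in> carrier M" "y = cls (k + 1) \<pi> \<odot>\<^bsub>M\<^esub> w" using y by blast
    then have "p y = cls k \<pi> \<odot>\<^bsub>L\<^esub> p w" using pD(3)[OF s w(1)] by (simp only: trunc_map_k_cls[OF \<pi>])
    then show ?thesis using red_zero_iff[OF pD(1)] pD(1) w M.smult_closed[OF s w(1)] by metis
  qed
  have "\<exists>w\<in>carrier M. x = cls (k + 1) \<pi> \<odot>\<^bsub>M\<^esub> w" if z: "red (p x) = \<zero>\<^bsub>Lbar\<^esub>"
  proof -
    define n where "n = free_rank K M"
    have n: "free_rank (trunc_ring R \<pi> k) L = n" using M by (simp add: is_lift_def K_def n_def)
    obtain b where b: "is_basis K M n b" using free_rank_basis[OF MK] unfolding n_def by blast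
    obtain e where e: "is_basis (trunc_ring R \<pi> k) L n e" using free_rank_basis[OF lie] unfolding n by blast
    have ec: "e j \<in> carrier L" if "j < n" for j using e that by (auto simp: is_basis_def)
    obtain \<phi> where \<phi>: "\<And>i x. x \<in> carrier M \<Longrightarrow> i < n \<Longrightarrow> \<phi> i x \<in> carrier F"
      "\<And>i x y. x \<in> carrier M \<Longrightarrow> y \<in> carrier M \<Longrightarrow> i < n \<Longrightarrow> \<phi> i (x \<oplus>\<^bsub>M\<^esub> y) = \<phi> i x \<oplus>\<^bsub>F\<^esub> \<phi> i y"
      "\<And>i a x. a \<in> carrier K \<Longrightarrow> x \<in> carrier M \<Longrightarrow> i < n \<Longrightarrow> \<phi> i (a \<odot>\<^bsub>M\<^esub> x) = ?\<rho> a \<otimes>\<^bsub>F\<^esub> \<phi> i x"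
      and \<phi>0: "\<And>x. x \<in> carrier M \<Longrightarrow> (\<And>i. i < n \<Longrightarrow> \<phi> i x = \<zero>\<^bsub>F\<^esub>) \<Longrightarrow> \<exists>w\<in>carrier M. x = cls (k + 1) \<pi> \<odot>\<^bsub>M\<^esub> w"
      unfolding F_eq K_def
      by (rule residue_coordinates[OF le_add2 M.module_axioms[unfolded K_def] b[unfolded K_def]]) blast
    obtain l where l: "\<And>i x. x \<in> carrier L \<Longrightarrow> i < n \<Longrightarrow> l i x \<in> carrier F"
      "\<And>i x y. x \<in> carrier L \<Longrightarrow> y \<in> carrier L \<Longrightarrow> i < n \<Longrightarrow> l i (x \<oplus>\<^bsub>L\<^esub> y) = l i x \<oplus>\<^bsub>F\<^esub> l i y"
      "\<And>i a x. a \<in> carrier (trunc_ring R \<pi> k) \<Longrightarrow> x \<in> carrier L \<Longrightarrow> i < n \<Longrightarrow> l i (a \<odot>\<^bsub>L\<^esub> x) = ?\<rho> a \<otimes>\<^bsub>F\<^esub> l i x"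
      and le: "\<And>i m. i < n \<Longrightarrow> m < n \<Longrightarrow> l i (e m) = (if i = m then \<one>\<^bsub>F\<^esub> else \<zero>\<^bsub>F\<^esub>)"
      unfolding F_eq by (rule residue_coordinates[OF k L.module_axioms e]) blast
    have "\<exists>y. y \<in> carrier M \<and> p y = e j" if "j < n" for j using ps ec[OF that] by (metis imageE)
    then obtain m where m: "\<And>j. j < n \<Longrightarrow> m j \<in> carrier M \<and> p (m j) = e j" by metis
    \<comment> \<open>The n preimages, followed by x in position n: n + 1 elements against the n
      residue coordinates of M, which forces a nontrivial relation.\<close>
    define y where "y j = (if j < n then m j else x)" for j
    have yc: "y j \<in> carrier M" for j using m x by (simp add: y_def)
    have "\<exists>d\<in>{..n} \<rightarrow> carrier F. (\<exists>i\<in>{..n}. d i \<noteq> \<zero>\<^bsub>F\<^esub>) \<and> (\<forall>i<n. (\<Oplus>\<^bsub>F\<^esub>j\<in>{..n}. d j \<otimes>\<^bsub>F\<^esub> \<phi> i (y j)) = \<zero>\<^bsub>F\<^esub>)"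
      by (rule F.homogeneous_system_solution) (use \<phi>(1) yc in auto)
    then obtain d where d: "d \<in> {..n} \<rightarrow> carrier F" "\<exists>i\<in>{..n}. d i \<noteq> \<zero>\<^bsub>F\<^esub>"
      "\<forall>i<n. (\<Oplus>\<^bsub>F\<^esub>j\<in>{..n}. d j \<otimes>\<^bsub>F\<^esub> \<phi> i (y j)) = \<zero>\<^bsub>F\<^esub>"
      by - (erule bexE, elim conjE, rule that)
    have dc: "d j \<in> carrier F" if "j \<le> n" for j using d(1) that by auto
    have "\<exists>a. a \<in> carrier K \<and> ?\<rho> a = d j" if "j \<le> n" for j
      using dc[OF that] \<rho> by (metis imageE)
    then obtain a where a: "\<And>j. j \<le> n \<Longrightarrow> a j \<in> carrier K \<and> ?\<rho> (a j) = d j" by metis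
    define u where "u = (\<Oplus>\<^bsub>M\<^esub>j\<in>{..n}. a j \<odot>\<^bsub>M\<^esub> y j)"
    define v where "v = (\<Oplus>\<^bsub>M\<^esub>j\<in>{..<n}. a j \<odot>\<^bsub>M\<^esub> y j)"
    have uc: "u \<in> carrier M" "v \<in> carrier M"
      unfolding u_def v_def using a yc by (auto intro!: M.M.finsum_closed)
    have uv: "u = a n \<odot>\<^bsub>M\<^esub> x \<oplus>\<^bsub>M\<^esub> v"
    proof -
      have "u = a n \<odot>\<^bsub>M\<^esub> y n \<oplus>\<^bsub>M\<^esub> v"
        unfolding u_def v_def lessThan_Suc_atMost[symmetric] lessThan_Suc using a yc
        by (subst M.M.finsum_insert) auto
      then show ?thesis by (simp add: y_def)
    qed
    have "\<phi> i u = \<zero>\<^bsub>F\<^esub>" if i: "i < n" for i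
    proof -
      have "\<phi> i u = (\<Oplus>\<^bsub>F\<^esub>j\<in>{..n}. \<phi> i (a j \<odot>\<^bsub>M\<^esub> y j))"
        unfolding u_def using a yc \<phi> i
        by (intro additive_finsum M.M.abelian_group_axioms F.abelian_group_axioms) auto
      also have "\<dots> = (\<Oplus>\<^bsub>F\<^esub>j\<in>{..n}. d j \<otimes>\<^bsub>F\<^esub> \<phi> i (y j))"
        using a yc \<phi> i dc by (intro F.add.finprod_cong') auto
      finally show ?thesis using d(3) i by simp
    qed
    then have "red (p u) = \<zero>\<^bsub>Lbar\<^esub>" using ker \<phi>0[OF uc(1)] by blast
    \<comment> \<open>The term of x reduces to 0 by assumption, so the rest of the relation alone
      already reduces to 0.\<close>
    moreover have "red (p u) = red (p v)"
    proof -
      have an: "a n \<in> carrier K" using a by blast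
      have c: "p x \<in> carrier L" "p v \<in> carrier L" "p (a n \<odot>\<^bsub>M\<^esub> x) \<in> carrier L" using pD(1) x uc an by auto
      then have r: "red (p v) \<in> carrier Lbar" using red_surj by blast
      have "red (p (a n \<odot>\<^bsub>M\<^esub> x)) = ?\<rho> (a n) \<odot>\<^bsub>Lbar\<^esub> red (p x)"
        using linear_mapsD(3)[OF p an x] red_smult[OF an c(1)] by simp
      also have "\<dots> = \<zero>\<^bsub>Lbar\<^esub>" unfolding z using a[of n] dc[of n] by simp
      finally show ?thesis using r c pD(2)[of "a n \<odot>\<^bsub>M\<^esub> x" v] uc an x by (simp add: uv red_add)
    qed
    ultimately have "red (p v) = \<zero>\<^bsub>Lbar\<^esub>" by simp
    then obtain w where w: "w \<in> carrier L" "p v = cls k \<pi> \<odot>\<^bsub>L\<^esub> w" using red_zero_iff[OF pD(1)[OF uc(2)]] by blast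
    have d0: "d i = \<zero>\<^bsub>F\<^esub>" if i: "i < n" for i
    proof -
      \<comment> \<open>The i-th residue coordinate of \<open>p v\<close> is computed twice: it is 0
        because \<open>p v\<close> is divisible by \<pi>, and it is \<open>d i\<close> because each
        \<open>m j\<close> maps to the basis vector \<open>e j\<close>.\<close>
      have "l i (p v) = ?\<rho> (cls k \<pi>) \<otimes>\<^bsub>F\<^esub> l i w" unfolding w(2) using l(3)[OF cls_closed[OF \<pi>] w(1) i] .
      also have "\<dots> = \<zero>\<^bsub>F\<^esub>" using l(1)[OF w(1) i] by (simp only: trunc_map_cls[OF k \<pi>] cls1_\<pi> F.l_null)
      finally have l0: "l i (p v) = \<zero>\<^bsub>F\<^esub>" .
      have ta: "trunc_map R \<pi> k (a j) \<in> carrier (trunc_ring R \<pi> k)" if "j < n" for j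
        using a[of j] that trunc_map_surj[of k "k + 1"] unfolding K_def by auto
      have pa: "p (a j \<odot>\<^bsub>M\<^esub> y j) = trunc_map R \<pi> k (a j) \<odot>\<^bsub>L\<^esub> e j" if "j < n" for j
        using pD(3)[of "a j" "y j"] a[of j] yc[of j] m[OF that] that by (simp add: y_def)
      have "p v = (\<Oplus>\<^bsub>L\<^esub>j\<in>{..<n}. p (a j \<odot>\<^bsub>M\<^esub> y j))"
        unfolding v_def using a yc pD
        by (intro additive_finsum M.M.abelian_group_axioms L.M.abelian_group_axioms) auto
      then have "l i (p v) = l i (\<Oplus>\<^bsub>L\<^esub>j\<in>{..<n}. p (a j \<odot>\<^bsub>M\<^esub> y j))" by simp
      also have "\<dots> = (\<Oplus>\<^bsub>F\<^esub>j\<in>{..<n}. l i (p (a j \<odot>\<^bsub>M\<^esub> y j)))"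
        using a yc pD(1) l(1,2) i
        by (intro additive_finsum L.M.abelian_group_axioms F.abelian_group_axioms) auto
      also have "\<dots> = (\<Oplus>\<^bsub>F\<^esub>j\<in>{..<n}. if i = j then d j else \<zero>\<^bsub>F\<^esub>)"
        using a dc i ec
        by (intro F.add.finprod_cong') (auto simp: pa l(3)[OF ta] le trunc_map_trunc_map simp del: One_nat_def)
      also have "\<dots> = d i" using dc i by (simp add: F.add.finprod_singleton)
      finally show ?thesis using l0 by simp
    qed
    \<comment> \<open>A nontrivial relation whose other coefficients vanish has a nonzero, hence
      invertible, coefficient at x, so all residue coordinates of x vanish.\<close>
    then have dn: "d n \<noteq> \<zero>\<^bsub>F\<^esub>" using d(2) by (metis atMost_iff le_neq_implies_less)
    show ?thesis
    proof (rule \<phi>0[OF x])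
      fix i assume i: "i < n"
      have "(\<Oplus>\<^bsub>F\<^esub>j\<in>{..n}. d j \<otimes>\<^bsub>F\<^esub> \<phi> i (y j)) = (\<Oplus>\<^bsub>F\<^esub>j\<in>{..n}. if n = j then d j \<otimes>\<^bsub>F\<^esub> \<phi> i (y j) else \<zero>\<^bsub>F\<^esub>)"
        using dc \<phi>(1)[OF yc i] d0 by (intro F.add.finprod_cong') auto
      also have "\<dots> = d n \<otimes>\<^bsub>F\<^esub> \<phi> i (y n)" using dc \<phi>(1)[OF yc i] by (subst F.add.finprod_singleton) auto
      finally have "d n \<otimes>\<^bsub>F\<^esub> \<phi> i x = \<zero>\<^bsub>F\<^esub>" using d(3) i by (simp add: y_def)
      then show "\<phi> i x = \<zero>\<^bsub>F\<^esub>" using dn dc[of n] \<phi>(1)[OF x i] F.integral by blast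
    qed
  qed
  then show ?thesis using ker by blast
qed

text \<open>If an element of the kernel of \<open>p\<close> has the form \<open>\<pi>\<^sup>i w\<close> with \<open>i < k\<close>, then torsion in \<open>L\<close> shows that \<open>w\<close>
  reduces to \<open>0\<close>, so that \<open>w\<close> is divisible by \<open>\<pi>\<close>.\<close>

lemma lift_kernel:
  assumes M: "is_lift R \<pi> k L M p" and x: "x \<in> carrier M"
  shows "p x = \<zero>\<^bsub>L\<^esub> \<longleftrightarrow> (\<exists>w\<in>carrier M. x = cls (k + 1) (\<pi> [^] k) \<odot>\<^bsub>M\<^esub> w)"
proof -
  have MK: "lie_algebra K M" and p: "p \<in> linear_maps K M LK"
    using M by (auto simp: is_lift_def lie_hom_iff K_def LK_def)
  interpret M: lie_algebra K M by (rule MK)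
  note pD = linear_mapsD[OF p, unfolded LK_cring]
  have cK: "cls (k + 1) r \<in> carrier K" if "r \<in> carrier R" for r unfolding K_def using that by (rule cls_closed)
  have pw: "p (cls (k + 1) r \<odot>\<^bsub>M\<^esub> w) = cls k r \<odot>\<^bsub>L\<^esub> p w" if "r \<in> carrier R" "w \<in> carrier M" for r w
    using pD(3)[OF cK[OF that(1)] that(2)] by (simp only: trunc_map_k_cls[OF that(1)])
  obtain n b where b: "is_basis (trunc_ring R \<pi> k) L n b" using L.free_of_finite_rank by blast
  show ?thesis
  proof
    assume z: "p x = \<zero>\<^bsub>L\<^esub>"
    have "\<exists>w\<in>carrier M. x = cls (k + 1) (\<pi> [^] i) \<odot>\<^bsub>M\<^esub> w" if "i \<le> k" for i
      using that
    proof (induction i)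
      case 0
      have "cls (k + 1) \<one> = \<one>\<^bsub>K\<^esub>" unfolding K_def by (rule cls_one)
      then show ?case using x by (intro bexI[of _ x]) simp_all
    next
      case (Suc i)
      then obtain w where w: "w \<in> carrier M" "x = cls (k + 1) (\<pi> [^] i) \<odot>\<^bsub>M\<^esub> w" by auto
      have "cls k (\<pi> [^] i) \<odot>\<^bsub>L\<^esub> p w = \<zero>\<^bsub>L\<^esub>" using pw[OF pow_closed w(1)] z w(2) by simp
      then have "\<exists>y\<in>carrier L. p w = cls k \<pi> \<odot>\<^bsub>L\<^esub> y"
        using Suc.prems pD(1)[OF w(1)] by (intro module_torsion[OF L.module_axioms b]) auto
      then have "red (p w) = \<zero>\<^bsub>Lbar\<^esub>" using red_zero_iff[OF pD(1)[OF w(1)]] by blast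
      then obtain v where v: "v \<in> carrier M" "w = cls (k + 1) \<pi> \<odot>\<^bsub>M\<^esub> v"
        using lift_red_kernel[OF M w(1)] by blast
      have "cls (k + 1) (\<pi> [^] Suc i) = cls (k + 1) (\<pi> [^] i) \<otimes>\<^bsub>K\<^esub> cls (k + 1) \<pi>"
        unfolding K_def using cls_mult[OF pow_closed \<pi>] by simp
      then have "x = cls (k + 1) (\<pi> [^] Suc i) \<odot>\<^bsub>M\<^esub> v"
        unfolding w(2) v(2) using v(1) cK[OF pow_closed] cK[OF \<pi>] by (simp only: M.smult_assoc1)
      then show ?case using v(1) by blast
    qed
    then show "\<exists>w\<in>carrier M. x = cls (k + 1) (\<pi> [^] k) \<odot>\<^bsub>M\<^esub> w" by blast
  next
    assume "\<exists>w\<in>carrier M. x = cls (k + 1) (\<pi> [^] k) \<odot>\<^bsub>M\<^esub> w"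
    then obtain w where w: "w \<in> carrier M" "x = cls (k + 1) (\<pi> [^] k) \<odot>\<^bsub>M\<^esub> w" by blast
    have "cls k (\<pi> [^] k) = \<zero>\<^bsub>trunc_ring R \<pi> k\<^esub>"
      using cls_zero_iff[OF pow_closed, of k k] \<pi> by (auto intro!: bexI[of _ \<one>])
    then show "p x = \<zero>\<^bsub>L\<^esub>" unfolding w(2) pw[OF pow_closed w(1)] using pD(1)[OF w(1)] by simp
  qed
qed

text \<open>The two kernels are known already. The annihilator of t in M is sM by torsion in a free
  module over K, applied with the exponents k < k + 1, and sM is the kernel of the
  reduction.\<close>

lemma lift_is_exact:
  assumes M: "is_lift R \<pi> k L M p" shows "is_exact_lift M p"
proof -
  have MK: "lie_algebra K M" and hom: "p \<in> lie_hom K M LK" and ps: "p ` carrier M = carrier LK"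
    using M by (auto simp: is_lift_def K_def LK_def)
  interpret M: lie_algebra K M by (rule MK)
  obtain n b where b: "is_basis K M n b" using M.free_of_finite_rank by blast
  have eq: "cls (k + 1) (\<pi> [^] k) \<odot>\<^bsub>M\<^esub> x = \<zero>\<^bsub>M\<^esub> \<longleftrightarrow> (\<exists>w\<in>carrier M. x = cls (k + 1) \<pi> \<odot>\<^bsub>M\<^esub> w)"
    if x: "x \<in> carrier M" for x
  proof
    assume "cls (k + 1) (\<pi> [^] k) \<odot>\<^bsub>M\<^esub> x = \<zero>\<^bsub>M\<^esub>"
    then show "\<exists>w\<in>carrier M. x = cls (k + 1) \<pi> \<odot>\<^bsub>M\<^esub> w"
      by (intro module_torsion[OF M.module_axioms[unfolded K_def] b[unfolded K_def] _ x]) simp_all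
  next
    assume "\<exists>w\<in>carrier M. x = cls (k + 1) \<pi> \<odot>\<^bsub>M\<^esub> w"
    then obtain w where w: "w \<in> carrier M" "x = cls (k + 1) \<pi> \<odot>\<^bsub>M\<^esub> w" by blast
    have "cls (k + 1) (\<pi> [^] k) \<otimes>\<^bsub>K\<^esub> cls (k + 1) \<pi> = \<zero>\<^bsub>K\<^esub>" using st s t M.R.m_comm by metis
    then show "cls (k + 1) (\<pi> [^] k) \<odot>\<^bsub>M\<^esub> x = \<zero>\<^bsub>M\<^esub>"
      unfolding w(2) using s t w(1) by (simp flip: M.smult_assoc1)
  qed
  show ?thesis
    unfolding is_exact_lift_def
  proof (intro conjI ballI MK hom ps)
    fix x assume x: "x \<in> carrier M"
    show "p x = \<zero>\<^bsub>LK\<^esub> \<longleftrightarrow> (\<exists>w\<in>carrier M. x = cls (k + 1) (\<pi> [^] k) \<odot>\<^bsub>M\<^esub> w)"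
      unfolding LK_cring by (rule lift_kernel[OF M x])
    show "red (p x) = \<zero>\<^bsub>Lbar\<^esub> \<longleftrightarrow> (\<exists>w\<in>carrier M. x = cls (k + 1) \<pi> \<odot>\<^bsub>M\<^esub> w)" by (rule lift_red_kernel[OF M x])
    show "cls (k + 1) (\<pi> [^] k) \<odot>\<^bsub>M\<^esub> x = \<zero>\<^bsub>M\<^esub> \<longleftrightarrow> red (p x) = \<zero>\<^bsub>Lbar\<^esub>"
      by (rule trans[OF eq[OF x] lift_red_kernel[OF M x, symmetric]])
  qed
qed

text \<open>The rank is the only condition on a lift that exactness does not record, so it is
  supplied separately.\<close>

lemma exact_is_lift:
  assumes "is_exact_lift M p" "free_rank K M = free_rank (trunc_ring R \<pi> k) L" shows "is_lift R \<pi> k L M p"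
  using assms(1)[unfolded is_exact_lift_def] assms(2) by (simp add: is_lift_def K_def LK_def)

end

section \<open>The classification of lifts by the second cohomology\<close>

theorem theorem3p1:
  fixes R :: "('a, 'r) ring_scheme"
    and \<pi> :: 'a
    and k :: nat
    and L :: "('a set, 'b) lie_algebra"
  assumes "discrete_valuation_ring R"
    and "\<pi> \<in> carrier R"
    and "maximalideal (PIdl\<^bsub>R\<^esub> \<pi>) R"
    and "k \<ge> 1"
    and "lie_algebra (trunc_ring R \<pi> k) L"
    and "\<exists>(M :: ('a set, 'c) lie_algebra) p. is_lift R \<pi> k L M p"
  shows "\<exists>\<Phi>. bij_betw \<Phi>
      ((lifts R \<pi> k L :: (('a set, 'c) lie_algebra \<times> ('c \<Rightarrow> 'b)) set) // lift_equiv R \<pi> k L)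
      (cohomology (residue_field R \<pi>) (reduction R \<pi> k L) 2)"
proof -
  interpret lie_truncation R \<pi> k L by (intro lie_truncation.intro truncation.intro lie_truncation_axioms.intro) (use assms in auto)
  \<comment> \<open>This lift is the base point from which all others are measured; the bijection
    depends on it.\<close>
  from assms(6) obtain M :: "('a set, 'c) lie_algebra" and p where M: "is_lift R \<pi> k L M p" by blast
  interpret M: exact_lift K F "trunc_map R \<pi> 1" LK Lbar red "cls (k + 1) \<pi>" "cls (k + 1) (\<pi> [^]\<^bsub>R\<^esub> k)" M p
    by (intro exact_lift.intro exact_lift_axioms.intro lifting_problem_axioms lift_is_exact[OF M])
  have "\<exists>\<Phi>. bij_betw \<Phi>
      ((lifts R \<pi> k L :: (('a set, 'c) lie_algebra \<times> ('c \<Rightarrow> 'b)) set) // lift_equiv R \<pi> k L) (cohomology F Lbar 2)"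
  proof (rule M.lifts_cohomology)
    show "is_exact_lift M' p'" if "(M', p') \<in> lifts R \<pi> k L" for M' :: "('a set, 'c) lie_algebra" and p'
      using that lift_is_exact by (simp add: lifts_def)
    show "(M\<lparr>lie_bracket := M.deform \<omega>\<rparr>, p) \<in> lifts R \<pi> k L" if "\<omega> \<in> cocycles F Lbar 2" for \<omega>
    proof -
      \<comment> \<open>A deformation lives on the carrier of M itself, so it stays in the given
        type and keeps the rank.\<close>
      have "free_rank K (M\<lparr>lie_bracket := M.deform \<omega>\<rparr>) = free_rank K M"
        by (simp add: free_rank_def is_basis_bracket_update)
      then show ?thesis
        using exact_is_lift[OF M.deform_exact[OF that]] M by (simp add: lifts_def is_lift_def K_def)
    qed
  qed (auto simp: lift_equiv_def isomorphic_lifts_def K_def)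
  then show ?thesis by (simp only: F_def Lbar_def)
qed

end
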